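(* Consider multi-step MAML in the finite-sum case (see context) and assume: (A1) for each task $i$, $l_{S_i}$ and $l_{T_i}$ are bounded below, $\nabla l_{S_i},\nabla l_{T_i}$ are $L$-Lipschitz and $\nabla^2l_{S_i},\nabla^2l_{T_i}$ are $\rho$-Lipschitz on $\mathbb{R}^d$; (A2) $\mathbb{E}_i\|\nabla l_{T_i}(w)-\nabla l_T(w)\|^2\le\sigma^2$ for all $w$, where $\nabla l_T=\mathbb{E}_i\nabla l_{T_i}$, and for each $i$ there is $b_i>0$ with $\|\nabla l_{S_i}(w)-\nabla l_{T_i}(w)\|\le b_i$ for all $w$; let $b=\mathbb{E}_i[b_i]$. Let $\alpha=\frac{1}{8NL}$, and let $\beta_k=\frac{1}{C_\beta\widehat L_{w_k}}$ with $C_\beta=80$ and $\widehat L_{w_k}=(1+\alpha L)^{2N}L+C_bb+\frac{C_{\mathcal{L}}}{|B_k'|}\sum_{i\in B_k'}\|\nabla l_{T_i}(w_k)\|$, where $C_b=C_{\mathcal{L}}=\big(\alpha\rho+\frac{\rho}{L}(1+\alpha L)^{N-1}\big)(1+\alpha L)^{2N}$ and $|B_k'|\ge\frac{2C_{\mathcal{L}}^2\sigma^2}{(C_bb+(1+\alpha L)^{2N}L)^2}$. Then, for $\zeta$ uniform on $\{0,\dots,K-1\}$, $$\mathbb{E}\|\nabla\mathcal{L}(w_\zeta)\|\le\mathcal{O}\Big(\frac1K+\frac{\sigma^2}{B}+\sqrt{\frac1K+\frac{\sigma^2}{B}}\Big).$$ In addition, suppose the task batch size satisfies $B\ge C_B\sigma^2\epsilon^{-2}$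 with a sufficiently large constant $C_B$. Then, to achieve an $\epsilon$-approximate stationary point, i.e. $\mathbb{E}\|\nabla\mathcal{L}(w_\zeta)\|\le\epsilon$, the algorithm requires at most $K=\mathcal{O}(\epsilon^{-2})$ iterations, and a total of $\mathcal{O}((T+NS)\epsilon^{-2})$ gradient computations and $\mathcal{O}(NS\epsilon^{-2})$ Hessian computations per iteration, where $T$ and $S$ are the sample sizes of the pre-assigned sets $T_i$ and $S_i$, $i\in\mathcal{I}$.
   Context: Tasks $\mathcal{T}_i$, $i\in\mathcal{I}$, are sampled from a distribution $p(\mathcal{T})$; $\mathbb{E}_i$ is expectation over $i\sim p(\mathcal{T})$. Each task has fixed finite sample sets $S_i,T_i$ (of sizes $S,T$) and losses $l_{S_i}(w)=\frac{1}{|S_i|}\sum_{\tau\in S_i}l_i(w;\tau)$, $l_{T_i}(w)=\frac{1}{|T_i|}\sum_{\tau\in T_i}l_i(w;\tau)$, $w\in\mathbb{R}^d$. Meta objective: $\mathcal{L}(w)=\mathbb{E}_i[l_{T_i}(\widetilde w_N^i)]$, where $\widetilde w_0^i=w$, $\widetilde w_{j+1}^i=\widetilde w_j^i-\alpha\nabla l_{S_i}(\widetilde w_j^i)$, $j=0,\dots,N-1$. Multi-step MAML (finite-sum case), from $w_0$: at each meta iteration $k$, sample a set $B_k$ of $B$ i.i.d. tasks from $p(\mathcal{T})$; for each $i\in B_k$ set $w_{k,0}^i=w_k$, $w_{k,j+1}^i=w_{k,j}^i-\alpha\nabla l_{S_i}(w_{k,j}^i)$, $j=0,\dots,N-1$,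 and $$\widehat G_i(w_k)=\prod_{j=0}^{N-1}\big(I-\alpha\nabla^2l_{S_i}(w_{k,j}^i)\big)\nabla l_{T_i}(w_{k,N}^i);$$ set $w_{k+1}=w_k-\frac{\beta_k}{B}\sum_{i\in B_k}\widehat G_i(w_k)$. The task batch $B_k'$ used in $\widehat L_{w_k}$ is sampled i.i.d. from $p(\mathcal{T})$ independently of $B_k$. $\mathcal{O}$ treats $\mathcal{L}(w_0)-\inf\mathcal{L}$, $\rho$, $L$, $b$, $\mathbb{E}_i[b_i^2]$ as constants (the latter two relative to $\sigma$: the additive variance level is of the order of $\sigma^2$), with hidden constants independent of $N$. Gradient and Hessian computations are counted per data sample.
   Formalization: The hidden constants may depend on an arbitrary upper bound for σ, and E[b_i²] is at most a constant times σ²; uniformly in unbounded σ the rate fails (losses w²/2 ± σw, B ≫ σ², σ ≫ K: steps are O(1/σ), so the gradient does not decrease). *)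

theory Defs
  imports "HOL-Probability.Probability"
begin

definition grad :: "('a::real_inner \<Rightarrow> real) \<Rightarrow> 'a \<Rightarrow> 'a" where
  "grad f w = (THE g. GDERIV f w :> g)"

text \<open>The Hessian is a bounded linear operator, so that its norm is the operator norm.\<close>

definition hess :: "('a::real_inner \<Rightarrow> real) \<Rightarrow> 'a \<Rightarrow> 'a \<Rightarrow>\<^sub>L 'a" where
  "hess f w = Blinfun (frechet_derivative (grad f) (at w))"

definition smooth_loss :: "real \<Rightarrow> real \<Rightarrow> ('a::real_inner \<Rightarrow> real) \<Rightarrow> bool" where
  "smooth_loss L \<rho> f \<longleftrightarrow>
     bdd_below (range f) \<and>
     (\<forall>w. f differentiable (at w)) \<and> (\<forall>w. grad f differentiable (at w)) \<and>
     lipschitz_on L UNIV (grad f) \<and> lipschitz_on \<rho> UNIV (hess f)"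

text \<open>The index set of the tasks is the carrier \<open>space (task_dist P)\<close>; a task \<open>i\<close> has the
  per-sample loss \<open>loss P i w \<tau>\<close>, the sample sets \<open>S_i\<close> and \<open>T_i\<close>, and the bound \<open>b_i\<close> on the
  distance between the gradients of its two empirical losses.\<close>

record ('i, 't, 'a) task_family =
  task_dist :: "'i measure"
  loss :: "'i \<Rightarrow> 'a \<Rightarrow> 't \<Rightarrow> real"
  S_set :: "'i \<Rightarrow> 't set"
  T_set :: "'i \<Rightarrow> 't set"
  grad_gap :: "'i \<Rightarrow> real"

definition loss_S :: "('i, 't, 'a) task_family \<Rightarrow> 'i \<Rightarrow> 'a \<Rightarrow> real" where
  "loss_S P i w = (\<Sum>\<tau>\<in>S_set P i. loss P i w \<tau>) / real (card (S_set P i))"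

definition loss_T :: "('i, 't, 'a) task_family \<Rightarrow> 'i \<Rightarrow> 'a \<Rightarrow> real" where
  "loss_T P i w = (\<Sum>\<tau>\<in>T_set P i. loss P i w \<tau>) / real (card (T_set P i))"

definition mean_grad_T :: "('i, 't, 'a::euclidean_space) task_family \<Rightarrow> 'a \<Rightarrow> 'a" where
  "mean_grad_T P w = (\<integral>i. grad (loss_T P i) w \<partial>task_dist P)"

definition mean_gap :: "('i, 't, 'a) task_family \<Rightarrow> real" where
  "mean_gap P = (\<integral>i. grad_gap P i \<partial>task_dist P)"

text \<open>Measurability and integrability are spelled out because the Bochner integral of a
  non-integrable function is 0, which would make the moment bounds vacuous.\<close>

locale smooth_task_family = prob_space "task_dist P"
  for P :: "('i, 't, 'a::euclidean_space) task_family" +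
  fixes L \<rho> \<sigma> :: real and nS nT :: nat
  assumes L_pos: "0 < L" and rho_nonneg: "0 \<le> \<rho>" and sigma_nonneg: "0 \<le> \<sigma>"
    and nS_pos: "0 < nS" and nT_pos: "0 < nT"
    and finite_S: "i \<in> space (task_dist P) \<Longrightarrow> finite (S_set P i)"
    and finite_T: "i \<in> space (task_dist P) \<Longrightarrow> finite (T_set P i)"
    and card_S: "i \<in> space (task_dist P) \<Longrightarrow> card (S_set P i) = nS"
    and card_T: "i \<in> space (task_dist P) \<Longrightarrow> card (T_set P i) = nT"
    and measurable_S: "(\<lambda>i. loss_S P i w) \<in> borel_measurable (task_dist P)"
    and measurable_T: "(\<lambda>i. loss_T P i w) \<in> borel_measurable (task_dist P)"
    and smooth_S: "i \<in> space (task_dist P) \<Longrightarrow> smooth_loss L \<rho> (loss_S P i)"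
    and smooth_T: "i \<in> space (task_dist P) \<Longrightarrow> smooth_loss L \<rho> (loss_T P i)"
    and integrable_grad: "integrable (task_dist P) (\<lambda>i. grad (loss_T P i) w)"
    and integrable_variance:
      "integrable (task_dist P) (\<lambda>i. (norm (grad (loss_T P i) w - mean_grad_T P w))\<^sup>2)"
    and variance_le:
      "(\<integral>i. (norm (grad (loss_T P i) w - mean_grad_T P w))\<^sup>2 \<partial>task_dist P) \<le> \<sigma>\<^sup>2"
    and gap_pos: "i \<in> space (task_dist P) \<Longrightarrow> 0 < grad_gap P i"
    and gap_bound: "i \<in> space (task_dist P) \<Longrightarrow>
      norm (grad (loss_S P i) w - grad (loss_T P i) w) \<le> grad_gap P i"
    and integrable_gap: "integrable (task_dist P) (grad_gap P)"
    and integrable_gap_sq: "integrable (task_dist P) (\<lambda>i. (grad_gap P i)\<^sup>2)"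

definition inner_rate :: "nat \<Rightarrow> real \<Rightarrow> real" where
  "inner_rate N L = 1 / (8 * real N * L)"

primrec inner_iter :: "('a::real_inner \<Rightarrow> real) \<Rightarrow> real \<Rightarrow> 'a \<Rightarrow> nat \<Rightarrow> 'a" where
  "inner_iter f \<alpha> w 0 = w"
| "inner_iter f \<alpha> w (Suc j) =
     inner_iter f \<alpha> w j - \<alpha> *\<^sub>R grad f (inner_iter f \<alpha> w j)"

definition adapted_loss ::
    "('i, 't, 'a::euclidean_space) task_family \<Rightarrow> real \<Rightarrow> nat \<Rightarrow> 'a \<Rightarrow> 'i \<Rightarrow> real" where
  "adapted_loss P \<alpha> N w i = loss_T P i (inner_iter (loss_S P i) \<alpha> w N)"

definition meta_loss ::
    "('i, 't, 'a::euclidean_space) task_family \<Rightarrow> real \<Rightarrow> nat \<Rightarrow> 'a \<Rightarrow> real" where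
  "meta_loss P \<alpha> N w = (\<integral>i. adapted_loss P \<alpha> N w i \<partial>task_dist P)"

text \<open>In the operator product the factor for \<open>j = 0\<close> is the leftmost one.\<close>

definition meta_grad_est ::
    "('i, 't, 'a::euclidean_space) task_family \<Rightarrow> real \<Rightarrow> nat \<Rightarrow> 'i \<Rightarrow> 'a \<Rightarrow> 'a" where
  "meta_grad_est P \<alpha> N i w =
     blinfun_apply
       (foldr (\<lambda>j A. (id_blinfun - \<alpha> *\<^sub>R hess (loss_S P i) (inner_iter (loss_S P i) \<alpha> w j)) o\<^sub>L A)
          [0..<N] id_blinfun)
       (grad (loss_T P i) (inner_iter (loss_S P i) \<alpha> w N))"

text \<open>The common value of \<open>C_b\<close> and \<open>C_\<L>\<close>.\<close>

definition C_lip :: "real \<Rightarrow> real \<Rightarrow> real \<Rightarrow> nat \<Rightarrow> real" where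
  "C_lip L \<rho> \<alpha> N = (\<alpha> * \<rho> + \<rho> / L * (1 + \<alpha> * L) ^ (N - 1)) * (1 + \<alpha> * L) ^ (2 * N)"

text \<open>The tasks drawn in meta iteration \<open>k\<close>: the \<open>m\<close>-th member of the batch \<open>B_k\<close> is \<open>Batch k m\<close>,
  that of \<open>B'_k\<close> is \<open>AuxBatch k m\<close>. A point \<open>\<omega>\<close> of the sample space fixes all draws.\<close>

datatype draw = Batch nat nat | AuxBatch nat nat

definition L_hat ::
    "('i, 't, 'a::euclidean_space) task_family \<Rightarrow> real \<Rightarrow> real \<Rightarrow> real \<Rightarrow> nat \<Rightarrow> nat \<Rightarrow>
     (nat \<Rightarrow> 'i) \<Rightarrow> 'a \<Rightarrow> real" where
  "L_hat P L \<rho> \<alpha> N n i w =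
     (1 + \<alpha> * L) ^ (2 * N) * L + C_lip L \<rho> \<alpha> N * mean_gap P
     + C_lip L \<rho> \<alpha> N / real n * (\<Sum>m<n. norm (grad (loss_T P (i m)) w))"

definition outer_rate ::
    "('i, 't, 'a::euclidean_space) task_family \<Rightarrow> real \<Rightarrow> real \<Rightarrow> real \<Rightarrow> nat \<Rightarrow> (nat \<Rightarrow> nat) \<Rightarrow>
     (draw \<Rightarrow> 'i) \<Rightarrow> nat \<Rightarrow> 'a \<Rightarrow> real" where
  "outer_rate P L \<rho> \<alpha> N B' \<omega> k w =
     1 / (80 * L_hat P L \<rho> \<alpha> N (B' k) (\<lambda>m. \<omega> (AuxBatch k m)) w)"

primrec maml_iter ::
    "('i, 't, 'a::euclidean_space) task_family \<Rightarrow> real \<Rightarrow> real \<Rightarrow> real \<Rightarrow> nat \<Rightarrow> nat \<Rightarrow>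
     (nat \<Rightarrow> nat) \<Rightarrow> 'a \<Rightarrow> (draw \<Rightarrow> 'i) \<Rightarrow> nat \<Rightarrow> 'a" where
  "maml_iter P L \<rho> \<alpha> N B B' w0 \<omega> 0 = w0"
| "maml_iter P L \<rho> \<alpha> N B B' w0 \<omega> (Suc k) =
     (let w = maml_iter P L \<rho> \<alpha> N B B' w0 \<omega> k
      in w - (outer_rate P L \<rho> \<alpha> N B' \<omega> k w / real B) *\<^sub>R
               (\<Sum>m<B. meta_grad_est P \<alpha> N (\<omega> (Batch k m)) w))"

text \<open>All draws are i.i.d.; \<open>\<zeta>\<close> is uniform on \<open>{0..K-1}\<close> and independent of them.\<close>

definition draw_space :: "('i, 't, 'a) task_family \<Rightarrow> (draw \<Rightarrow> 'i) measure" where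
  "draw_space P = (\<Pi>\<^sub>M d\<in>UNIV. task_dist P)"

definition run_space :: "('i, 't, 'a) task_family \<Rightarrow> nat \<Rightarrow> ((draw \<Rightarrow> 'i) \<times> nat) measure" where
  "run_space P K = draw_space P \<Otimes>\<^sub>M measure_pmf (pmf_of_set {..<K})"

definition output_grad_norm ::
    "('i, 't, 'a::euclidean_space) task_family \<Rightarrow> real \<Rightarrow> real \<Rightarrow> real \<Rightarrow> nat \<Rightarrow> nat \<Rightarrow>
     (nat \<Rightarrow> nat) \<Rightarrow> 'a \<Rightarrow> (draw \<Rightarrow> 'i) \<times> nat \<Rightarrow> real" where
  "output_grad_norm P L \<rho> \<alpha> N B B' w0 =
     (\<lambda>(\<omega>, \<zeta>). norm (grad (meta_loss P \<alpha> N) (maml_iter P L \<rho> \<alpha> N B B' w0 \<omega> \<zeta>)))"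

text \<open>The assertion \<open>E \<parallel>\<nabla>\<L>(w_\<zeta>)\<parallel> \<le> r\<close>, including existence of the expectation.\<close>

definition expected_grad_norm_le ::
    "('i, 't, 'a::euclidean_space) task_family \<Rightarrow> real \<Rightarrow> real \<Rightarrow> real \<Rightarrow> nat \<Rightarrow> nat \<Rightarrow> nat \<Rightarrow>
     (nat \<Rightarrow> nat) \<Rightarrow> 'a \<Rightarrow> real \<Rightarrow> bool" where
  "expected_grad_norm_le P L \<rho> \<alpha> N K B B' w0 r \<longleftrightarrow>
     integrable (run_space P K) (output_grad_norm P L \<rho> \<alpha> N B B' w0) \<and>
     (\<integral>x. output_grad_norm P L \<rho> \<alpha> N B B' w0 x \<partial>run_space P K) \<le> r"

definition aux_batch_bound ::
    "('i, 't, 'a) task_family \<Rightarrow> real \<Rightarrow> real \<Rightarrow> real \<Rightarrow> real \<Rightarrow> nat \<Rightarrow> real" where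
  "aux_batch_bound P L \<rho> \<sigma> \<alpha> N =
     2 * (C_lip L \<rho> \<alpha> N)\<^sup>2 * \<sigma>\<^sup>2
       / (C_lip L \<rho> \<alpha> N * mean_gap P + (1 + \<alpha> * L) ^ (2 * N) * L)\<^sup>2"

text \<open>A task of \<open>B_k\<close> requires the gradient and the Hessian of \<open>loss_S\<close> at each of its \<open>N\<close> inner
  iterates and one gradient of \<open>loss_T\<close>; a task of \<open>B'_k\<close> requires one gradient of \<open>loss_T\<close>.\<close>

definition grad_count ::
    "('i, 't, 'a) task_family \<Rightarrow> nat \<Rightarrow> nat \<Rightarrow> (nat \<Rightarrow> nat) \<Rightarrow> (draw \<Rightarrow> 'i) \<Rightarrow> nat \<Rightarrow> nat" where
  "grad_count P N B B' \<omega> k =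
     (\<Sum>m<B. (\<Sum>j<N. card (S_set P (\<omega> (Batch k m)))) + card (T_set P (\<omega> (Batch k m))))
     + (\<Sum>m<B' k. card (T_set P (\<omega> (AuxBatch k m))))"

definition hess_count ::
    "('i, 't, 'a) task_family \<Rightarrow> nat \<Rightarrow> nat \<Rightarrow> (draw \<Rightarrow> 'i) \<Rightarrow> nat \<Rightarrow> nat" where
  "hess_count P N B \<omega> k = (\<Sum>m<B. \<Sum>j<N. card (S_set P (\<omega> (Batch k m))))"

text \<open>The instances over which the hidden constants are uniform: the gap \<open>\<L>(w0) - inf \<L>\<close> is at most
  \<open>D\<close>, the noise level \<open>\<sigma>\<close> is at most \<open>s\<close>, and \<open>E (b_i)^2\<close> is at most \<open>\<kappa> \<sigma>^2\<close>, whence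
  \<open>b\<close> is at most \<open>sqrt \<kappa> * \<sigma>\<close>.\<close>

definition maml_instance ::
    "('i, 't, 'a::euclidean_space) task_family \<Rightarrow> real \<Rightarrow> real \<Rightarrow> real \<Rightarrow> nat \<Rightarrow> nat \<Rightarrow> nat \<Rightarrow>
     'a \<Rightarrow> real \<Rightarrow> real \<Rightarrow> real \<Rightarrow> bool" where
  "maml_instance P L \<rho> \<sigma> nS nT N w0 D s \<kappa> \<longleftrightarrow>
     smooth_task_family P L \<rho> \<sigma> nS nT \<and>
     1 \<le> N \<and>
     (\<forall>w. integrable (task_dist P) (adapted_loss P (inner_rate N L) N w)) \<and>
     bdd_below (range (meta_loss P (inner_rate N L) N)) \<and>
     meta_loss P (inner_rate N L) N w0 - (INF w. meta_loss P (inner_rate N L) N w) \<le> D \<and>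
     \<sigma> \<le> s \<and>
     (\<integral>i. (grad_gap P i)\<^sup>2 \<partial>task_dist P) \<le> \<kappa> * \<sigma>\<^sup>2"

end

theory Submission
  imports Defs
begin

text \<open>
  Each adapted loss \<open>F_i\<close> has gradient \<open>G_i\<close> (the chain rule together with the symmetry of the
  Hessian), and \<open>G_i\<close> is Lipschitz at \<open>w\<close> with constant
  \<open>(1 + \<alpha>L)^(2N) L + C_\<L> (b_i + \<parallel>\<nabla>l_{T_i}(w)\<parallel>)\<close>. Averaging the resulting quadratic bound over \<open>i\<close>
  gives \<open>\<nabla>\<L> = E G_i\<close> and a descent inequality with the constant
  \<open>L_w = (1 + \<alpha>L)^(2N) L + C_b b + C_\<L> E \<parallel>\<nabla>l_{T_i}(w)\<parallel>\<close>, of which \<open>L_hat\<close> is an unbiased estimate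
  with \<open>E 1/L_hat \<ge> 1/L_w\<close> and, by the bound on \<open>B'\<close>, \<open>E 1/L_hat^2 \<le> 3/L_w^2\<close>. Since
  \<open>(1 + \<alpha>L)^(2N) \<le> 4/3\<close>, the second moment of \<open>G_i\<close> is at most
  \<open>16 \<parallel>\<nabla>\<L>(w)\<parallel>^2 + 8 (\<sigma>^2 + E b_i^2)\<close>, and a step decreases \<open>\<L>\<close> on average by
  \<open>\<parallel>\<nabla>\<L>(w)\<parallel>^2 / (160 L_w)\<close> up to noise of order \<open>\<sigma>^2 / B\<close>. Telescoping bounds the mean of
  \<open>\<parallel>\<nabla>\<L>\<parallel>^2 / L_w\<close> along the run, and \<open>L_w \<le> a + c \<parallel>\<nabla>\<L>(w)\<parallel>\<close> turns this into a bound on the mean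
  of \<open>\<parallel>\<nabla>\<L>\<parallel>\<close>. The iterates need no moment bounds: telescoping is done with nonnegative integrals of
  \<open>\<L> - inf \<L>\<close>.
\<close>

section \<open>Gradients and Hessians of smooth losses\<close>

text \<open>The obstacle is that the meta objective has no global smoothness constant: the Lipschitz
  constant of its gradient at \<open>w\<close> grows with the task gradients at \<open>w\<close>.
  Bounds for the meta-gradient are therefore centred at one fixed point, with a constant that may
  depend on that point. Such one-centred bounds suffice for the descent step, for the derivative of
  the averaged loss and for continuity. The growth also explains the shape of the rate. As L_w is at
  most affine in the gradient norm, the telescoped quantity is of quadratic order for small
  gradients but only of linear order for large ones; the first regime yields the square root, the
  second the linear term. The step size is random, but it is computed from draws disjoint from those
  of the batch gradient, so expectations of their products factor. The second moments cost a factor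
  3 for 1/L_hat and at most 17 for the batch gradient, even when B = 1; the constant 80 absorbs both
  with room to spare.\<close>

lemma GDERIV_unique:
  assumes "GDERIV f x :> D" and "GDERIV f x :> E"
  shows "D = E"
proof -
  have "(\<lambda>h. h \<bullet> D) = (\<lambda>h. h \<bullet> E)"
    using assms unfolding gderiv_def by (rule has_derivative_unique)
  then show ?thesis
    by (metis inner_commute vector_eq_rdot)
qed

lemma grad_eqI: "GDERIV f w :> D \<Longrightarrow> grad f w = D"
  unfolding grad_def by (blast intro: GDERIV_unique)

text \<open>Finite dimension provides the representing vector: its coordinates are the values of the
  derivative on the basis. Differentiability thus makes the definite description in
  \<open>grad\<close> meaningful.\<close>

lemma GDERIV_grad:
  fixes f :: "'a::euclidean_space \<Rightarrow> real"
  assumes "f differentiable (at w)"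
  shows "GDERIV f w :> grad f w"
proof -
  obtain f' where f': "(f has_derivative f') (at w)"
    using assms by (auto simp: differentiable_def)
  have "f' h = h \<bullet> (\<Sum>e\<in>Basis. f' e *\<^sub>R e)" for h
  proof -
    interpret bounded_linear f' using f' by (rule has_derivative_bounded_linear)
    have "f' h = f' (\<Sum>e\<in>Basis. (h \<bullet> e) *\<^sub>R e)"
      by (simp add: euclidean_representation)
    also have "\<dots> = (\<Sum>e\<in>Basis. (h \<bullet> e) * f' e)"
      by (simp add: sum scaleR)
    finally show ?thesis by (simp add: inner_sum_right mult.commute)
  qed
  then have "GDERIV f w :> (\<Sum>e\<in>Basis. f' e *\<^sub>R e)"
    using f' unfolding gderiv_def by (metis (no_types, lifting) ext)
  then show ?thesis using grad_eqI by metis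
qed

lemma GDERIV_along_line:
  assumes "GDERIV f (x + t *\<^sub>R v) :> D"
  shows "((\<lambda>t. f (x + t *\<^sub>R v)) has_real_derivative v \<bullet> D) (at t within S)"
proof -
  have "((\<lambda>t. x + t *\<^sub>R v) has_derivative (\<lambda>h. h *\<^sub>R v)) (at t)"
    by (auto intro!: derivative_eq_intros)
  from has_derivative_compose[OF this] assms
  have "((\<lambda>t. f (x + t *\<^sub>R v)) has_derivative (\<lambda>h. (h *\<^sub>R v) \<bullet> D)) (at t)"
    unfolding gderiv_def by blast
  then have "((\<lambda>t. f (x + t *\<^sub>R v)) has_real_derivative v \<bullet> D) (at t)"
    unfolding has_field_derivative_def by (simp add: mult.commute[of "v \<bullet> D"] mult_commute_abs)
  then show ?thesis by (rule has_field_derivative_at_within)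
qed

text \<open>The gradient is compared only with its value at the centre \<open>w\<close>, so
  \<open>M\<close> may depend on \<open>w\<close>. Along the segment to \<open>u\<close>, the
  function minus its tangent and minus the parabola has nonpositive derivative.\<close>

lemma quadratic_upper_bound:
  assumes F: "\<And>w. GDERIV F w :> G w"
    and lip: "\<And>u. norm (G u - G w) \<le> M * norm (u - w)"
  shows "F u - F w - G w \<bullet> (u - w) \<le> M / 2 * (norm (u - w))\<^sup>2"
proof -
  define v where "v = u - w"
  define \<psi> where "\<psi> t = F (w + t *\<^sub>R v) - t * (v \<bullet> G w) - M / 2 * t\<^sup>2 * (norm v)\<^sup>2" for t
  have "\<psi> 1 \<le> \<psi> 0"
  proof (rule DERIV_nonpos_imp_nonincreasing[of 0 1 \<psi>])
    fix t :: real assume t: "0 \<le> t" "t \<le> 1"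
    have "(\<psi> has_real_derivative
        v \<bullet> G (w + t *\<^sub>R v) - v \<bullet> G w - M / 2 * (2 * t) * (norm v)\<^sup>2) (at t)"
      unfolding \<psi>_def by (auto intro!: derivative_eq_intros GDERIV_along_line F)
    moreover have "v \<bullet> G (w + t *\<^sub>R v) - v \<bullet> G w \<le> M * t * (norm v)\<^sup>2"
    proof -
      have "v \<bullet> G (w + t *\<^sub>R v) - v \<bullet> G w \<le> norm v * norm (G (w + t *\<^sub>R v) - G w)"
        by (metis inner_diff_right norm_cauchy_schwarz)
      also have "\<dots> \<le> norm v * (M * (t * norm v))"
        using lip[of "w + t *\<^sub>R v"] t by (intro mult_left_mono) auto
      finally show ?thesis by (simp add: power2_eq_square algebra_simps)
    qed
    ultimately show "\<exists>y. (\<psi> has_real_derivative y) (at t) \<and> y \<le> 0"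
      by (intro exI conjI) auto
  qed simp
  then show ?thesis unfolding \<psi>_def v_def by (simp add: inner_commute)
qed

lemma quadratic_bound:
  assumes F: "\<And>w. GDERIV F w :> G w"
    and lip: "\<And>u. norm (G u - G w) \<le> M * norm (u - w)"
  shows "\<bar>F u - F w - G w \<bullet> (u - w)\<bar> \<le> M / 2 * (norm (u - w))\<^sup>2"
proof -
  have "GDERIV (\<lambda>x. - F x) x :> - G x" for x
    using F[of x] by (rule GDERIV_minus)
  moreover have "norm (- G u - - G w) \<le> M * norm (u - w)" for u
    using lip[of u] by (simp add: norm_minus_commute)
  ultimately have "- F u - - F w - (- G w) \<bullet> (u - w) \<le> M / 2 * (norm (u - w))\<^sup>2"
    by (rule quadratic_upper_bound[where G = "\<lambda>x. - G x"])
  then have "- (F u - F w - G w \<bullet> (u - w)) \<le> M / 2 * (norm (u - w))\<^sup>2" by simp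
  then show ?thesis
    using quadratic_upper_bound[of F G, OF F lip, of u] by (rule abs_leI[rotated])
qed

text \<open>Along a short multiple of \<open>h\<close> the difference quotient of \<open>f\<close>
  has norm at most \<open>C * norm h\<close>, and it differs from \<open>f' h\<close> by an
  arbitrarily small multiple of \<open>norm h\<close>.\<close>

lemma has_derivative_norm_le_lipschitz:
  fixes f :: "'a::real_normed_vector \<Rightarrow> 'b::real_normed_vector"
  assumes f: "(f has_derivative f') (at x)" and lip: "lipschitz_on C UNIV f"
  shows "norm (f' h) \<le> C * norm h"
proof (cases "h = 0")
  case True
  then show ?thesis using linear_0[OF has_derivative_linear[OF f]] by simp
next
  case False
  interpret bounded_linear f' using f by (rule has_derivative_bounded_linear)
  have "norm (f' h) / norm h \<le> C + e" if "e > 0" for e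
  proof -
    obtain d where "d > 0" and d: "\<And>y. 0 < norm (y - x) \<Longrightarrow> norm (y - x) < d \<Longrightarrow>
        norm (f y - f x - f' (y - x)) / norm (y - x) < e"
      using f \<open>e > 0\<close> unfolding has_derivative_at' by blast
    define t where "t = d / (2 * norm h)"
    have t: "t > 0" "t * norm h < d" using \<open>d > 0\<close> False by (auto simp: t_def)
    have *: "norm (f (x + t *\<^sub>R h) - f x - f' (t *\<^sub>R h)) < e * (t * norm h)"
      using d[of "x + t *\<^sub>R h"] t False by (simp add: field_simps)
    have "norm (f (x + t *\<^sub>R h) - f x) \<le> C * (t * norm h)"
      using lipschitz_onD[OF lip, of "x + t *\<^sub>R h" x] t by (simp add: dist_norm)
    then have "norm (f' (t *\<^sub>R h)) \<le> C * (t * norm h) + e * (t * norm h)"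
      using * norm_triangle_ineq4[of "f (x + t *\<^sub>R h) - f x"
          "f (x + t *\<^sub>R h) - f x - f' (t *\<^sub>R h)"] by simp
    then have "t * norm (f' h) \<le> t * ((C + e) * norm h)"
      using t by (simp add: scaleR algebra_simps)
    then have "norm (f' h) \<le> (C + e) * norm h" using t(1) by (simp only: mult_le_cancel_left_pos)
    then show ?thesis using False by (simp add: pos_divide_le_eq)
  qed
  then have "norm (f' h) / norm h \<le> C" by (rule field_le_epsilon)
  then show ?thesis using False by (simp add: field_simps)
qed

text \<open>With \<open>v\<close> fixed, the second difference is the increment in \<open>s\<close>
  of the difference of \<open>f\<close> on two parallel lines of direction \<open>u\<close>. The
  derivative in \<open>s\<close> compares two values of \<open>G\<close>; linearising both at
  \<open>w\<close> leaves \<open>t * (H w v \<bullet> u)\<close> and an error of order t^2, and the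
  mean value bound over length \<open>t\<close> makes it cubic.\<close>

lemma second_difference_bound:
  fixes G :: "'a::real_inner \<Rightarrow> 'a" and H :: "'a \<Rightarrow> 'a \<Rightarrow>\<^sub>L 'a"
  assumes f: "\<And>w. GDERIV f w :> G w"
    and G: "\<And>h. norm (G (w + h) - G w - H w h) \<le> M * (norm h)\<^sup>2"
    and "0 \<le> M" and "0 < t"
  shows "\<bar>f (w + t *\<^sub>R u + t *\<^sub>R v) - f (w + t *\<^sub>R u) - f (w + t *\<^sub>R v) + f w - t\<^sup>2 * (H w v \<bullet> u)\<bar>
    \<le> t ^ 3 * (norm u * (M * ((norm u + norm v)\<^sup>2 + (norm u)\<^sup>2)))"
proof -
  define \<psi> where "\<psi> s = f (w + t *\<^sub>R v + s *\<^sub>R u) - f (w + s *\<^sub>R u) - s * t * (H w v \<bullet> u)" for s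
  define \<psi>' where "\<psi>' s = u \<bullet> G (w + t *\<^sub>R v + s *\<^sub>R u) - u \<bullet> G (w + s *\<^sub>R u) - t * (H w v \<bullet> u)" for s
  have "\<bar>\<psi> t - \<psi> 0\<bar> \<le> (t\<^sup>2 * (norm u * (M * ((norm u + norm v)\<^sup>2 + (norm u)\<^sup>2)))) * \<bar>t - 0\<bar>"
  proof (rule field_differentiable_bound[of "{0..t}" \<psi> \<psi>', folded real_norm_def, simplified])
    fix s assume s: "0 \<le> s \<and> s \<le> t"
    show "(\<psi> has_real_derivative \<psi>' s) (at s within {0..t})"
      unfolding \<psi>_def \<psi>'_def by (auto intro!: derivative_eq_intros GDERIV_along_line f)
    let ?a = "t *\<^sub>R v + s *\<^sub>R u" and ?b = "s *\<^sub>R u"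
    have split: "G (w + ?a) - G (w + ?b) - H w (t *\<^sub>R v)
        = (G (w + ?a) - G w - H w ?a) - (G (w + ?b) - G w - H w ?b)"
      by (simp add: blinfun.add_right)
    have "norm ?a \<le> norm (t *\<^sub>R v) + norm (s *\<^sub>R u)" by (rule norm_triangle_ineq)
    also have "\<dots> \<le> t * (norm u + norm v)"
      using s \<open>0 < t\<close> by (simp add: algebra_simps mult_right_mono)
    finally have na: "(norm ?a)\<^sup>2 \<le> t\<^sup>2 * (norm u + norm v)\<^sup>2"
      using power_mono[of "norm ?a" "t * (norm u + norm v)" 2] by (simp add: power_mult_distrib)
    have "norm ?b \<le> t * norm u" using s by (simp add: mult_right_mono)
    then have nb: "(norm ?b)\<^sup>2 \<le> t\<^sup>2 * (norm u)\<^sup>2"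
      using power_mono[of "norm ?b" "t * norm u" 2] by (simp add: power_mult_distrib)
    have "norm (G (w + ?a) - G (w + ?b) - H w (t *\<^sub>R v)) \<le> M * (norm ?a)\<^sup>2 + M * (norm ?b)\<^sup>2"
      unfolding split using G[of ?a] G[of ?b] by (intro norm_triangle_le_diff) simp
    also have "\<dots> \<le> M * (t\<^sup>2 * (norm u + norm v)\<^sup>2) + M * (t\<^sup>2 * (norm u)\<^sup>2)"
      using na nb \<open>0 \<le> M\<close> by (intro add_mono mult_left_mono)
    finally have *: "norm (G (w + ?a) - G (w + ?b) - H w (t *\<^sub>R v))
      \<le> t\<^sup>2 * (M * ((norm u + norm v)\<^sup>2 + (norm u)\<^sup>2))"
      by (simp add: algebra_simps)
    have "\<psi>' s = u \<bullet> (G (w + ?a) - G (w + ?b) - H w (t *\<^sub>R v))"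
      by (simp add: \<psi>'_def blinfun.scaleR_right inner_diff_right inner_commute algebra_simps)
    also have "\<bar>\<dots>\<bar> \<le> norm u * (t\<^sup>2 * (M * ((norm u + norm v)\<^sup>2 + (norm u)\<^sup>2)))"
      using Cauchy_Schwarz_ineq2 mult_left_mono[OF * norm_ge_zero[of u]] by (rule order_trans)
    finally show "\<bar>\<psi>' s\<bar> \<le> t\<^sup>2 * (norm u * (M * ((norm u + norm v)\<^sup>2 + (norm u)\<^sup>2)))"
      by (simp add: algebra_simps)
  qed (use \<open>0 < t\<close> in auto)
  then show ?thesis using \<open>0 < t\<close> unfolding \<psi>_def
    by (simp add: power2_eq_square power3_eq_cube algebra_simps)
qed

text \<open>The second difference of \<open>f\<close> along \<open>u\<close> and \<open>v\<close> is symmetric in \<open>u\<close> and \<open>v\<close>, and it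
  agrees with both sides up to third order.\<close>

lemma derivative_gradient_symmetric:
  fixes G :: "'a::real_inner \<Rightarrow> 'a" and H :: "'a \<Rightarrow> 'a \<Rightarrow>\<^sub>L 'a"
  assumes f: "\<And>w. GDERIV f w :> G w"
    and G: "\<And>h. norm (G (w + h) - G w - H w h) \<le> M * (norm h)\<^sup>2"
    and "0 \<le> M"
  shows "H w u \<bullet> v = H w v \<bullet> u"
proof -
  define c where "c u v = norm u * (M * ((norm u + norm v)\<^sup>2 + (norm u)\<^sup>2))" for u v :: 'a
  have c0: "0 \<le> c u v" for u v using \<open>0 \<le> M\<close> by (simp add: c_def)
  have "\<bar>H w u \<bullet> v - H w v \<bullet> u\<bar> \<le> 0 + e" if "e > 0" for e
  proof -
    define t where "t = e / (1 + c u v + c v u)"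
    have pos: "0 < 1 + c u v + c v u" using c0[of u v] c0[of v u] by simp
    then have "0 < t" using \<open>e > 0\<close> by (simp add: t_def)
    have "\<bar>t\<^sup>2 * (H w u \<bullet> v) - t\<^sup>2 * (H w v \<bullet> u)\<bar> \<le> t ^ 3 * c u v + t ^ 3 * c v u"
      using second_difference_bound[where H = H, OF f G \<open>0 \<le> M\<close> \<open>0 < t\<close>, of u v]
        second_difference_bound[where H = H, OF f G \<open>0 \<le> M\<close> \<open>0 < t\<close>, of v u]
      unfolding c_def by (simp add: add.commute add.left_commute)
    then have "t\<^sup>2 * \<bar>H w u \<bullet> v - H w v \<bullet> u\<bar> \<le> t\<^sup>2 * (t * (c u v + c v u))"
      by (simp flip: right_diff_distrib add: abs_mult) (simp add: power2_eq_square power3_eq_cube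
          algebra_simps)
    then have "\<bar>H w u \<bullet> v - H w v \<bullet> u\<bar> \<le> t * (c u v + c v u)" using \<open>0 < t\<close> by simp
    also have "\<dots> \<le> t * (1 + c u v + c v u)" using \<open>0 < t\<close> by simp
    also have "\<dots> = e" using pos by (simp add: t_def)
    finally show ?thesis by simp
  qed
  then have "\<bar>H w u \<bullet> v - H w v \<bullet> u\<bar> \<le> 0" by (rule field_le_epsilon)
  then show ?thesis by simp
qed

text \<open>Mean value inequality for \<open>G\<close> minus the linear map \<open>H w\<close> on
  the ball of radius \<open>norm h\<close>, where the derivative of this difference is at most
  \<open>\<rho> * norm h\<close>.\<close>

lemma norm_remainder_le:
  fixes G :: "'a::real_inner \<Rightarrow> 'b::real_inner" and H :: "'a \<Rightarrow> 'a \<Rightarrow>\<^sub>L 'b"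
  assumes G: "\<And>w. (G has_derivative blinfun_apply (H w)) (at w)"
    and lip: "lipschitz_on \<rho> UNIV H"
  shows "norm (G (w + h) - G w - H w h) \<le> \<rho> * (norm h)\<^sup>2"
proof -
  have \<rho>: "0 \<le> \<rho>" using lip by (rule lipschitz_on_nonneg)
  have "norm (G (w + h) - H w (w + h) - (G w - H w w)) \<le> (\<rho> * norm h) * norm (w + h - w)"
  proof (rule differentiable_bound[of "cball w (norm h)" "\<lambda>x. G x - H w x" "\<lambda>x y. H x y - H w y"])
    fix x assume x: "x \<in> cball w (norm h)"
    show "((\<lambda>x. G x - H w x) has_derivative (\<lambda>y. H x y - H w y)) (at x within cball w (norm h))"
      by (intro has_derivative_diff has_derivative_at_withinI[OF G]
          bounded_linear_imp_has_derivative blinfun.bounded_linear_right)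
    have "norm (H x - H w) \<le> \<rho> * norm (x - w)"
      using lipschitz_onD[OF lip, of x w] by (simp add: dist_norm)
    also have "\<dots> \<le> \<rho> * norm h"
      using x \<rho> by (intro mult_left_mono) (auto simp: dist_norm norm_minus_commute)
    finally show "onorm (\<lambda>y. H x y - H w y) \<le> \<rho> * norm h"
      by (simp add: norm_blinfun.rep_eq blinfun.diff_left[symmetric])
  qed (auto simp: dist_norm)
  then show ?thesis by (simp add: blinfun.add_right power2_eq_square algebra_simps)
qed

section \<open>Consequences of smoothness for a single loss\<close>

context
  fixes f :: "'a::euclidean_space \<Rightarrow> real" and L \<rho> :: real
  assumes smooth: "smooth_loss L \<rho> f"
begin

lemma smooth_loss_GDERIV: "GDERIV f w :> grad f w"
  using smooth by (auto simp: smooth_loss_def intro: GDERIV_grad)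

lemma smooth_loss_grad_lipschitz: "norm (grad f u - grad f w) \<le> L * norm (u - w)"
  using smooth lipschitz_onD[of L UNIV "grad f"] by (auto simp: smooth_loss_def dist_norm)

lemma smooth_loss_hess_lipschitz: "norm (hess f u - hess f w) \<le> \<rho> * norm (u - w)"
  using smooth lipschitz_onD[of \<rho> UNIV "hess f"] by (auto simp: smooth_loss_def dist_norm)

lemma smooth_loss_hess: "(grad f has_derivative blinfun_apply (hess f w)) (at w)"
proof -
  have "(grad f has_derivative frechet_derivative (grad f) (at w)) (at w)"
    using smooth by (auto simp: smooth_loss_def frechet_derivative_works[symmetric])
  then show ?thesis
    unfolding hess_def
    by (subst bounded_linear_Blinfun_apply) (auto dest: has_derivative_bounded_linear)
qed

lemma smooth_loss_norm_hess_le: "norm (hess f w) \<le> L"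
proof (rule norm_blinfun_bound)
  have lip: "lipschitz_on L UNIV (grad f)" using smooth by (simp add: smooth_loss_def)
  then show "0 \<le> L" by (rule lipschitz_on_nonneg)
  show "norm (hess f w h) \<le> L * norm h" for h
    using smooth_loss_hess lip by (rule has_derivative_norm_le_lipschitz)
qed

text \<open>Makes every factor I - \<alpha>H of the estimator self-adjoint; the chain rule by itself
  produces transposed Hessians. The Lipschitz Hessian supplies the quadratic remainder on which
  symmetry rests.\<close>

lemma smooth_loss_hess_symmetric: "hess f w u \<bullet> v = u \<bullet> hess f w v"
proof -
  have lip: "lipschitz_on \<rho> UNIV (hess f)" using smooth by (simp add: smooth_loss_def)
  have "hess f w u \<bullet> v = hess f w v \<bullet> u"
    by (rule derivative_gradient_symmetric[OF smooth_loss_GDERIV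
          norm_remainder_le[OF smooth_loss_hess lip] lipschitz_on_nonneg[OF lip]])
  then show ?thesis by (simp add: inner_commute)
qed

end

section \<open>The adapted loss of a single task\<close>

lemma norm_add_scaleR_le: "0 \<le> c \<Longrightarrow> norm (u + c *\<^sub>R v) \<le> norm u + c * norm v"
  using norm_triangle_ineq[of u "c *\<^sub>R v"] by simp

lemma norm_diff_scaleR_le: "0 \<le> c \<Longrightarrow> norm (u - c *\<^sub>R v) \<le> norm u + c * norm v"
  using norm_triangle_ineq4[of u "c *\<^sub>R v"] by simp

text \<open>The adjoint of the derivative of the \<open>j\<close>-fold inner map, hence new factors
  enter on the right. This order agrees with the estimator, whose leftmost factor is the one for
  \<open>j = 0\<close>, and it permits induction on \<open>j\<close>.\<close>

primrec inner_jacobian :: "('a::euclidean_space \<Rightarrow> real) \<Rightarrow> real \<Rightarrow> 'a \<Rightarrow> nat \<Rightarrow> 'a \<Rightarrow>\<^sub>L 'a" where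
  "inner_jacobian f \<alpha> w 0 = id_blinfun"
| "inner_jacobian f \<alpha> w (Suc j) =
     inner_jacobian f \<alpha> w j o\<^sub>L (id_blinfun - \<alpha> *\<^sub>R hess f (inner_iter f \<alpha> w j))"

lemma foldr_blinfun_compose:
  "foldr (\<lambda>j A. T j o\<^sub>L A) xs A = foldr (\<lambda>j A. T j o\<^sub>L A) xs id_blinfun o\<^sub>L A"
  by (induction xs) (auto simp: blinfun_eqI)

lemma blinfun_compose_id_right [simp]: "A o\<^sub>L id_blinfun = A"
  by (rule blinfun_eqI) simp

lemma inner_jacobian_eq_foldr:
  "foldr (\<lambda>j A. (id_blinfun - \<alpha> *\<^sub>R hess f (inner_iter f \<alpha> w j)) o\<^sub>L A) [0..<N] id_blinfun
    = inner_jacobian f \<alpha> w N"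
proof (induction N)
  case (Suc N)
  then show ?case
    using foldr_blinfun_compose[of "\<lambda>j. id_blinfun - \<alpha> *\<^sub>R hess f (inner_iter f \<alpha> w j)" "[0..<N]"
        "id_blinfun - \<alpha> *\<^sub>R hess f (inner_iter f \<alpha> w N)"]
    by simp
qed simp

section \<open>Stability of the inner gradient steps\<close>

locale inner_loop =
  fixes f :: "'a::euclidean_space \<Rightarrow> real" and L \<rho> \<alpha> :: real
  assumes smooth: "smooth_loss L \<rho> f" and L_nonneg: "0 \<le> L" and \<alpha>_nonneg: "0 \<le> \<alpha>"
begin

abbreviation "x \<equiv> inner_iter f \<alpha>"
abbreviation "J \<equiv> inner_jacobian f \<alpha>"
definition q where "q = 1 + \<alpha> * L"

lemma rho_nonneg: "0 \<le> \<rho>"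
  using smooth lipschitz_on_nonneg by (auto simp: smooth_loss_def)

lemma q_ge_1: "1 \<le> q"
  using L_nonneg \<alpha>_nonneg by (simp add: q_def)

lemma q_power_ge_1: "1 \<le> q ^ j"
  using q_ge_1 by (rule one_le_power)

lemma norm_factor_le: "norm (id_blinfun - \<alpha> *\<^sub>R hess f u) \<le> q"
proof (rule norm_blinfun_bound)
  fix h
  have "norm (h - \<alpha> *\<^sub>R hess f u h) \<le> norm h + \<alpha> * norm (hess f u h)"
    using norm_triangle_ineq4[of h "\<alpha> *\<^sub>R hess f u h"] \<alpha>_nonneg by simp
  also have "norm (hess f u h) \<le> L * norm h"
    using norm_blinfun[of "hess f u" h] smooth_loss_norm_hess_le[OF smooth, of u]
    by (meson mult_right_mono norm_ge_zero order_trans)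
  finally show "norm ((id_blinfun - \<alpha> *\<^sub>R hess f u) h) \<le> q * norm h"
    using \<alpha>_nonneg
    by (simp add: q_def blinfun.diff_left blinfun.scaleR_left distrib_right mult_left_mono)
qed (use q_ge_1 in simp)

lemma norm_iter_diff_le: "norm (x w j - x u j) \<le> q ^ j * norm (w - u)"
proof (induction j)
  case (Suc j)
  have "norm (x w (Suc j) - x u (Suc j))
      = norm ((x w j - x u j) - \<alpha> *\<^sub>R (grad f (x w j) - grad f (x u j)))"
    by (simp add: algebra_simps)
  also have "\<dots> \<le> norm (x w j - x u j) + \<alpha> * norm (grad f (x w j) - grad f (x u j))"
    using \<alpha>_nonneg by (rule norm_diff_scaleR_le)
  also have "\<dots> \<le> norm (x w j - x u j) + \<alpha> * (L * norm (x w j - x u j))"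
    using smooth_loss_grad_lipschitz[OF smooth] \<alpha>_nonneg by (intro add_left_mono mult_left_mono)
  also have "\<dots> = q * norm (x w j - x u j)" by (simp add: q_def algebra_simps)
  also have "\<dots> \<le> q * (q ^ j * norm (w - u))" using Suc q_ge_1 by (intro mult_left_mono) auto
  finally show ?case by (simp add: algebra_simps)
qed simp

text \<open>Displacement and gradient growth are bounded together: a displacement bound gives
  \<open>norm (grad f (x w j)) \<le> q ^ j * norm (grad f w)\<close>, which bounds the next step.
  Scaling by \<open>L\<close> makes the increments telescope, as
  \<open>\<alpha> * L * q ^ j = q ^ Suc j - q ^ j\<close>, and avoids dividing by \<open>L\<close>,
  which may be 0 here.\<close>

lemma norm_iter_displacement_le: "L * norm (x w j - w) \<le> (q ^ j - 1) * norm (grad f w)"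
proof -
  have grad: "norm (grad f (x w j)) \<le> q ^ j * norm (grad f w)"
    if "L * norm (x w j - w) \<le> (q ^ j - 1) * norm (grad f w)" for j
  proof -
    have "norm (grad f (x w j)) \<le> norm (grad f w) + norm (grad f (x w j) - grad f w)"
      using norm_triangle_ineq[of "grad f w" "grad f (x w j) - grad f w"] by simp
    then show ?thesis
      using that smooth_loss_grad_lipschitz[OF smooth, of "x w j" w] by (simp add: algebra_simps)
  qed
  show "L * norm (x w j - w) \<le> (q ^ j - 1) * norm (grad f w)"
  proof (induction j)
    case (Suc j)
    have "norm (x w (Suc j) - w) \<le> norm (x w j - w) + \<alpha> * norm (grad f (x w j))"
      using norm_triangle_ineq4[of "x w j - w" "\<alpha> *\<^sub>R grad f (x w j)"] \<alpha>_nonneg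
      by (simp add: algebra_simps)
    also have "\<dots> \<le> norm (x w j - w) + \<alpha> * (q ^ j * norm (grad f w))"
      using grad[OF Suc] \<alpha>_nonneg by (intro add_left_mono mult_left_mono)
    finally have "L * norm (x w (Suc j) - w)
        \<le> L * (norm (x w j - w) + \<alpha> * (q ^ j * norm (grad f w)))"
      using L_nonneg by (rule mult_left_mono)
    moreover have "(q ^ Suc j - 1) * norm (grad f w)
        = (q ^ j - 1) * norm (grad f w) + L * (\<alpha> * (q ^ j * norm (grad f w)))"
      by (simp add: q_def algebra_simps)
    ultimately show ?case using Suc by (simp add: distrib_left)
  qed simp
qed

lemma norm_jacobian_le: "norm (J w j) \<le> q ^ j"
proof (induction j)
  case 0
  then show ?case by (simp add: norm_blinfun_id_le)
next
  case (Suc j)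
  have "norm (J w (Suc j)) \<le> norm (J w j) * norm (id_blinfun - \<alpha> *\<^sub>R hess f (x w j))"
    by (simp add: norm_blinfun_compose)
  also have "\<dots> \<le> q ^ j * q"
    using Suc norm_factor_le q_power_ge_1[of j] by (intro mult_mono) auto
  finally show ?case by (simp add: algebra_simps)
qed

lemma norm_jacobian_minus_id_le: "norm (J w j - id_blinfun) \<le> q ^ j - 1"
proof (induction j)
  case (Suc j)
  have eq: "J w (Suc j) - id_blinfun = (J w j - id_blinfun) - \<alpha> *\<^sub>R (J w j o\<^sub>L hess f (x w j))"
    by (rule blinfun_eqI) (simp add: blinfun.bilinear_simps)
  have "norm (J w (Suc j) - id_blinfun)
      \<le> norm (J w j - id_blinfun) + \<alpha> * norm (J w j o\<^sub>L hess f (x w j))"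
    unfolding eq using \<alpha>_nonneg by (rule norm_diff_scaleR_le)
  also have "norm (J w j o\<^sub>L hess f (x w j)) \<le> norm (J w j) * norm (hess f (x w j))"
    by (rule norm_blinfun_compose)
  also have "\<dots> \<le> q ^ j * L"
    using norm_jacobian_le smooth_loss_norm_hess_le[OF smooth] q_power_ge_1[of j]
    by (intro mult_mono) auto
  finally have "norm (J w (Suc j) - id_blinfun) \<le> (q ^ j - 1) + \<alpha> * (q ^ j * L)"
    using Suc \<alpha>_nonneg by (simp add: mult_left_mono)
  also have "\<dots> = q ^ Suc j - 1" by (simp add: q_def algebra_simps)
  finally show ?case .
qed simp

text \<open>The right side solves the recursion \<open>d (Suc j) \<le> q * d j + \<alpha> * \<rho> *
  q ^ (2 * j) * norm (w - u)\<close>: the old difference times a new factor, plus the old product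
  times a Hessian difference at points that have drifted apart by a factor \<open>q ^ j\<close>.
  Multiplying by \<open>q * L\<close> clears the denominators of the geometric sum.\<close>

lemma norm_jacobian_diff_le:
  "q * L * norm (J w j - J u j) \<le> \<rho> * (q ^ j * (q ^ j - 1)) * norm (w - u)"
proof (induction j)
  case (Suc j)
  let ?H = "\<lambda>w. hess f (x w j)"
  have eq: "J w (Suc j) - J u (Suc j)
      = ((J w j - J u j) o\<^sub>L (id_blinfun - \<alpha> *\<^sub>R ?H w)) + \<alpha> *\<^sub>R (J u j o\<^sub>L (?H u - ?H w))"
    by (rule blinfun_eqI) (simp add: blinfun.bilinear_simps algebra_simps)
  have "norm (J w (Suc j) - J u (Suc j))
      \<le> norm ((J w j - J u j) o\<^sub>L (id_blinfun - \<alpha> *\<^sub>R ?H w)) + \<alpha> * norm (J u j o\<^sub>L (?H u - ?H w))"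
    unfolding eq using \<alpha>_nonneg by (rule norm_add_scaleR_le)
  also have "\<dots> \<le> norm (J w j - J u j) * q + \<alpha> * (q ^ j * (\<rho> * (q ^ j * norm (w - u))))"
  proof -
    have a: "norm ((J w j - J u j) o\<^sub>L (id_blinfun - \<alpha> *\<^sub>R ?H w)) \<le> norm (J w j - J u j) * q"
      using norm_blinfun_compose[of "J w j - J u j" "id_blinfun - \<alpha> *\<^sub>R ?H w"]
        mult_left_mono[OF norm_factor_le[of "x w j"] norm_ge_zero[of "J w j - J u j"]]
      by linarith
    have "norm (?H u - ?H w) \<le> \<rho> * norm (x w j - x u j)"
      using smooth_loss_hess_lipschitz[OF smooth, of "x u j" "x w j"]
      by (simp only: norm_minus_commute)
    also have "\<dots> \<le> \<rho> * (q ^ j * norm (w - u))"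
      using norm_iter_diff_le rho_nonneg by (rule mult_left_mono)
    finally have "norm (J u j) * norm (?H u - ?H w) \<le> q ^ j * (\<rho> * (q ^ j * norm (w - u)))"
      using norm_jacobian_le[of u j] q_power_ge_1[of j] by (intro mult_mono) auto
    then have b: "norm (J u j o\<^sub>L (?H u - ?H w)) \<le> q ^ j * (\<rho> * (q ^ j * norm (w - u)))"
      using norm_blinfun_compose[of "J u j" "?H u - ?H w"] by linarith
    show ?thesis by (rule add_mono[OF a mult_left_mono[OF b \<alpha>_nonneg]])
  qed
  finally have "(q * L) * norm (J w (Suc j) - J u (Suc j))
      \<le> (q * L) * (norm (J w j - J u j) * q + \<alpha> * (q ^ j * (\<rho> * (q ^ j * norm (w - u)))))"
    using q_ge_1 L_nonneg by (intro mult_left_mono) auto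
  also have "\<dots> = q * (q * L * norm (J w j - J u j)) + q * \<rho> * q ^ j * (\<alpha> * L * q ^ j) * norm (w - u)"
    by (simp add: algebra_simps)
  also have "\<dots> \<le> q * (\<rho> * (q ^ j * (q ^ j - 1)) * norm (w - u))
      + q * \<rho> * q ^ j * (\<alpha> * L * q ^ j) * norm (w - u)"
    using Suc q_ge_1 by (intro add_right_mono mult_left_mono) auto
  also have "\<alpha> * L * q ^ j = q ^ Suc j - q ^ j"
    by (simp add: q_def algebra_simps)
  also have "q * (\<rho> * (q ^ j * (q ^ j - 1)) * norm (w - u))
      + q * \<rho> * q ^ j * (q ^ Suc j - q ^ j) * norm (w - u)
      = \<rho> * (q ^ Suc j * (q ^ Suc j - 1)) * norm (w - u)"
    by (simp add: algebra_simps)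
  finally show ?case .
qed simp

text \<open>The adjoint relation is carried along because the induction closes in this form: the
  chain rule puts a new Hessian factor to the left of \<open>D\<close>, and symmetry moves it across
  the inner product to the right of \<open>J w j\<close>.\<close>

lemma inner_iter_has_derivative:
  "\<exists>D. ((\<lambda>w. x w j) has_derivative D) (at w) \<and> (\<forall>h v. D h \<bullet> v = h \<bullet> J w j v)"
proof (induction j)
  case 0
  show ?case by (auto intro!: exI[of _ "\<lambda>h. h"] derivative_eq_intros)
next
  case (Suc j)
  then obtain D where D: "((\<lambda>w. x w j) has_derivative D) (at w)"
    and adj: "\<And>h v. D h \<bullet> v = h \<bullet> J w j v" by blast
  have "((\<lambda>w. grad f (x w j)) has_derivative (\<lambda>h. hess f (x w j) (D h))) (at w)"
    using has_derivative_compose[OF D smooth_loss_hess[OF smooth]] .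
  then have "((\<lambda>w. x w (Suc j)) has_derivative (\<lambda>h. D h - \<alpha> *\<^sub>R hess f (x w j) (D h))) (at w)"
    using D by (auto intro!: derivative_eq_intros)
  moreover have "(D h - \<alpha> *\<^sub>R hess f (x w j) (D h)) \<bullet> v = h \<bullet> J w (Suc j) v" for h v
  proof -
    have "(D h - \<alpha> *\<^sub>R hess f (x w j) (D h)) \<bullet> v = D h \<bullet> (v - \<alpha> *\<^sub>R hess f (x w j) v)"
      by (simp add: inner_diff_left inner_diff_right smooth_loss_hess_symmetric[OF smooth])
    then show ?thesis by (simp add: adj blinfun.diff_left blinfun.scaleR_left)
  qed
  ultimately show ?case by blast
qed

end

section \<open>Meta-gradient of a single task\<close>

locale adapted_task = inner_loop f L \<rho> \<alpha>
  for f :: "'a::euclidean_space \<Rightarrow> real" and L \<rho> \<alpha> +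
  fixes g :: "'a \<Rightarrow> real" and b :: real and N :: nat
  assumes smooth': "smooth_loss L \<rho> g"
    and gap: "norm (grad f w - grad g w) \<le> b"
begin

definition meta_grad where "meta_grad w = J w N (grad g (x w N))"

lemma q_power_double: "q ^ (2 * N) = q ^ N * q ^ N"
  by (simp add: mult_2 power_add)

lemma b_nonneg: "0 \<le> b"
  using gap[of 0] norm_ge_zero order_trans by blast

lemma GDERIV_adapted: "GDERIV (\<lambda>w. g (x w N)) w :> meta_grad w"
proof -
  obtain D where D: "((\<lambda>w. x w N) has_derivative D) (at w)"
    and adj: "\<And>h v. D h \<bullet> v = h \<bullet> J w N v" using inner_iter_has_derivative by blast
  have "(g has_derivative (\<lambda>h. h \<bullet> grad g (x w N))) (at (x w N))"
    using smooth_loss_GDERIV[OF smooth'] unfolding gderiv_def .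
  from has_derivative_compose[OF D this] show ?thesis
    unfolding gderiv_def meta_grad_def adj .
qed

lemma norm_grad_f_le: "norm (grad f w) \<le> norm (grad g w) + b"
  using gap[of w] norm_triangle_ineq2[of "grad f w" "grad g w"] by simp

text \<open>The inner loop is driven by \<open>f\<close>, whereas the later moments are those of
  \<open>grad g\<close>; the gap \<open>b\<close> exchanges one gradient for the other at the
  starting point.\<close>

lemma norm_grad_adapted_diff_le:
  "norm (grad g (x w N) - grad g w) \<le> (q ^ N - 1) * (norm (grad g w) + b)"
proof -
  have "norm (grad g (x w N) - grad g w) \<le> L * norm (x w N - w)"
    using smooth_loss_grad_lipschitz[OF smooth'] .
  also have "\<dots> \<le> (q ^ N - 1) * norm (grad f w)" by (rule norm_iter_displacement_le)
  also have "\<dots> \<le> (q ^ N - 1) * (norm (grad g w) + b)"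
    using q_power_ge_1[of N] norm_grad_f_le by (intro mult_left_mono) auto
  finally show ?thesis .
qed

lemma norm_grad_adapted_le: "norm (grad g (x w N)) \<le> q ^ N * (norm (grad g w) + b)"
proof -
  have "norm (grad g (x w N)) \<le> norm (grad g w) + norm (grad g (x w N) - grad g w)"
    using norm_triangle_ineq[of "grad g w" "grad g (x w N) - grad g w"] by simp
  then show ?thesis using norm_grad_adapted_diff_le[of w] b_nonneg by (simp add: algebra_simps)
qed

lemma norm_meta_grad_le: "norm (meta_grad w) \<le> q ^ (2 * N) * (norm (grad g w) + b)"
proof -
  have "norm (meta_grad w) \<le> norm (J w N) * norm (grad g (x w N))"
    unfolding meta_grad_def by (rule norm_blinfun)
  also have "\<dots> \<le> q ^ N * (q ^ N * (norm (grad g w) + b))"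
    using norm_jacobian_le norm_grad_adapted_le q_power_ge_1[of N] by (intro mult_mono) auto
  finally show ?thesis by (simp add: mult_2 power_add mult.assoc)
qed

text \<open>Moving the point and multiplying by the Jacobian contribute
  \<open>q ^ N * (q ^ N - 1)\<close> and \<open>q ^ N - 1\<close>, which add up exactly to the
  stated factor. At the chosen inner rate this is at most 1/3, so the meta-gradient is a small
  perturbation of the plain gradient.\<close>

lemma norm_meta_grad_diff_grad_le:
  "norm (meta_grad w - grad g w) \<le> (q ^ (2 * N) - 1) * (norm (grad g w) + b)"
proof -
  have "meta_grad w - grad g w
      = J w N (grad g (x w N) - grad g w) + (J w N - id_blinfun) (grad g w)"
    by (simp add: meta_grad_def blinfun.bilinear_simps)
  also have "norm \<dots>
      \<le> norm (J w N) * norm (grad g (x w N) - grad g w) + norm (J w N - id_blinfun) * norm (grad g w)"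
    by (intro norm_triangle_mono norm_blinfun)
  also have "\<dots> \<le> q ^ N * ((q ^ N - 1) * (norm (grad g w) + b)) + (q ^ N - 1) * (norm (grad g w) + b)"
    using norm_jacobian_le[of w N] norm_grad_adapted_diff_le[of w] norm_jacobian_minus_id_le[of w N]
      q_power_ge_1[of N] b_nonneg
    by (intro add_mono mult_mono) simp_all
  finally show ?thesis unfolding q_power_double by (simp add: algebra_simps)
qed

text \<open>The product is split so that the Jacobian difference acts on the gradient at
  \<open>x w N\<close> and not at \<open>x u N\<close>. Hence the constant depends on
  \<open>w\<close> alone, as the centred quadratic bound requires.\<close>

lemma norm_meta_grad_diff_le:
  assumes "0 < L" and "1 \<le> N"
  shows "norm (meta_grad u - meta_grad w)
    \<le> (q ^ (2 * N) * L + C_lip L \<rho> \<alpha> N * (norm (grad g w) + b)) * norm (u - w)"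
proof -
  \<comment> \<open>Writing \<open>N = Suc n\<close> lets one factor \<open>q\<close> cancel in
    \<open>norm_jacobian_diff_le\<close>; this is the origin of the exponent \<open>N - 1\<close> in
    \<open>C_lip\<close>.\<close>
  obtain n where N: "N = Suc n" using assms(2) by (cases N) auto
  have "norm (J u N - J w N) \<le> \<rho> / L * (q ^ n * (q ^ N - 1)) * norm (u - w)"
  proof -
    have "q * (L * norm (J u N - J w N)) \<le> q * (\<rho> * (q ^ n * (q ^ N - 1)) * norm (u - w))"
      using norm_jacobian_diff_le[of u N w] by (simp add: N algebra_simps)
    then have "L * norm (J u N - J w N) \<le> \<rho> * (q ^ n * (q ^ N - 1)) * norm (u - w)"
      using q_ge_1 by (subst (asm) mult_le_cancel_left_pos) auto
    then show ?thesis using assms(1) by (simp add: field_simps)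
  qed
  then have "norm ((J u N - J w N) (grad g (x w N)))
      \<le> (\<rho> / L * (q ^ n * (q ^ N - 1)) * norm (u - w)) * (q ^ N * (norm (grad g w) + b))"
    using norm_blinfun[of "J u N - J w N" "grad g (x w N)"] norm_grad_adapted_le[of w]
    by (meson mult_mono norm_ge_zero order_trans)
  also have "\<dots> = (\<rho> / L * q ^ n * (q ^ N - 1) * q ^ N) * ((norm (grad g w) + b) * norm (u - w))"
    by (simp only: mult_ac)
  also have "\<dots> \<le> C_lip L \<rho> \<alpha> N * ((norm (grad g w) + b) * norm (u - w))"
  proof (rule mult_right_mono)
    have "\<rho> / L * q ^ n * (q ^ N - 1) * q ^ N \<le> \<rho> / L * q ^ n * q ^ N * q ^ N"
      using rho_nonneg assms(1) q_power_ge_1[of n] q_power_ge_1[of N]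
      by (intro mult_left_mono mult_right_mono) auto
    also have "\<dots> = \<rho> / L * q ^ n * q ^ (2 * N)" by (simp add: mult_2 power_add mult.assoc)
    also have "\<dots> \<le> (\<alpha> * \<rho> + \<rho> / L * q ^ n) * q ^ (2 * N)"
      using rho_nonneg \<alpha>_nonneg q_power_ge_1[of "2 * N"] by (intro mult_right_mono) auto
    also have "\<dots> = C_lip L \<rho> \<alpha> N" by (simp only: C_lip_def q_def N diff_Suc_1)
    finally show "\<rho> / L * q ^ n * (q ^ N - 1) * q ^ N \<le> C_lip L \<rho> \<alpha> N" .
  qed (use b_nonneg in auto)
  finally have 1: "norm ((J u N - J w N) (grad g (x w N)))
    \<le> C_lip L \<rho> \<alpha> N * (norm (grad g w) + b) * norm (u - w)" by (simp add: mult.assoc)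
  have "norm (grad g (x u N) - grad g (x w N)) \<le> L * (q ^ N * norm (u - w))"
    using smooth_loss_grad_lipschitz[OF smooth'] norm_iter_diff_le[of u N w] L_nonneg
    by (meson mult_left_mono order_trans)
  then have "norm (J u N (grad g (x u N) - grad g (x w N))) \<le> q ^ N * (L * (q ^ N * norm (u - w)))"
    using norm_blinfun[of "J u N" "grad g (x u N) - grad g (x w N)"] norm_jacobian_le[of u N]
      q_power_ge_1[of N]
    by (meson mult_mono norm_ge_zero order_trans zero_le_one)
  moreover have "meta_grad u - meta_grad w
      = J u N (grad g (x u N) - grad g (x w N)) + (J u N - J w N) (grad g (x w N))"
    by (simp add: meta_grad_def blinfun.bilinear_simps)
  ultimately have "norm (meta_grad u - meta_grad w) \<le> q ^ N * (L * (q ^ N * norm (u - w)))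
      + C_lip L \<rho> \<alpha> N * (norm (grad g w) + b) * norm (u - w)"
    using 1 by (simp only: norm_triangle_mono)
  then show ?thesis unfolding q_power_double by (simp add: algebra_simps)
qed

end

section \<open>Independent draws\<close>

text \<open>Measurability in the task is known only at fixed points, whereas the iterates are
  random. A simple function reduces the random point to finitely many fixed ones, and continuity in
  the point carries measurability to the limit.\<close>

lemma borel_measurable_Caratheodory:
  fixes f :: "'i \<Rightarrow> 'b::{metric_space, second_countable_topology} \<Rightarrow> 'c::metric_space"
  assumes meas: "\<And>w. (\<lambda>i. f i w) \<in> borel_measurable M"
    and cont: "\<And>i. i \<in> space M \<Longrightarrow> continuous_on UNIV (f i)"
    and X: "X \<in> measurable N M" and W: "W \<in> borel_measurable N"
  shows "(\<lambda>x. f (X x) (W x)) \<in> borel_measurable N"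
proof -
  obtain F where F: "\<And>n. simple_function N (F n)"
    and lim: "\<And>x. x \<in> space N \<Longrightarrow> (\<lambda>n. F n x) \<longlonglongrightarrow> W x"
    using borel_measurable_implies_sequence_metric[OF W] by metis
  show ?thesis
  proof (rule borel_measurable_LIMSEQ_metric)
    fix n
    have "finite (F n ` space N)" using F[of n] by (rule simple_functionD)
    moreover have "F n \<in> measurable N (count_space UNIV)"
      using F[of n] by (rule measurable_simple_function)
    ultimately have "F n \<in> measurable N (count_space (F n ` space N))"
      by (auto simp: measurable_def)
    then show "(\<lambda>x. f (X x) (F n x)) \<in> borel_measurable N"
      by (rule measurable_compose_countable'[rotated])
        (auto intro: measurable_compose[OF X meas] countable_finite \<open>finite (F n ` space N)\<close>)
  next
    fix x assume x: "x \<in> space N"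
    have "isCont (f (X x)) (W x)"
      using cont[OF measurable_space[OF X x]] by (simp add: continuous_on_eq_continuous_at)
    then show "(\<lambda>n. f (X x) (F n x)) \<longlonglongrightarrow> f (X x) (W x)"
      using lim[OF x] by (rule isCont_tendsto_compose)
  qed
qed

text \<open>Used for the averaged loss: a quadratic bound survives integration, so no interchange of
  derivative and integral has to be justified.\<close>

lemma GDERIV_of_quadratic_bound:
  assumes "\<And>u. \<bar>F u - F w - D \<bullet> (u - w)\<bar> \<le> C * (norm (u - w))\<^sup>2"
  shows "GDERIV F w :> D"
  unfolding gderiv_def
proof (rule has_derivativeI_sandwich[of 1])
  show "bounded_linear (\<lambda>h. h \<bullet> D)" by (rule bounded_linear_inner_left)
  show "((\<lambda>u. C * norm (u - w)) \<longlongrightarrow> 0) (at w)"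
    by (auto intro!: tendsto_eq_intros)
  fix u assume "u \<noteq> w"
  then show "norm (F u - F w - (u - w) \<bullet> D) / norm (u - w) \<le> C * norm (u - w)"
    using assms[of u] by (simp add: divide_le_eq power2_eq_square inner_commute mult.assoc)
qed simp

lemma norm_power2_add_le:
  fixes u v :: "'a::real_inner"
  shows "(norm (u + v))\<^sup>2 \<le> 2 * (norm u)\<^sup>2 + 2 * (norm v)\<^sup>2"
proof -
  have "(norm (u + v))\<^sup>2 + (norm (u - v))\<^sup>2 = 2 * (norm u)\<^sup>2 + 2 * (norm v)\<^sup>2"
    by (simp add: power2_norm_eq_inner inner_add_left inner_add_right inner_diff_left
        inner_diff_right inner_commute)
  then show ?thesis using zero_le_power2[of "norm (u - v)"] by linarith
qed

lemma continuous_on_of_local_lipschitz: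
  fixes f :: "'a::real_normed_vector \<Rightarrow> 'b::real_normed_vector"
  assumes "\<And>u w. norm (f u - f w) \<le> c w * norm (u - w)"
  shows "continuous_on UNIV f"
proof (clarsimp simp: continuous_on_def)
  fix w
  have "((\<lambda>u. f u - f w) \<longlongrightarrow> 0) (at w)"
  proof (rule tendsto_0_le)
    show "((\<lambda>u. norm (u - w)) \<longlongrightarrow> 0) (at w)" by (auto intro!: tendsto_eq_intros)
    show "\<forall>\<^sub>F u in at w. norm (f u - f w) \<le> norm (norm (u - w)) * c w"
      using assms by (simp add: mult.commute)
  qed
  then show "(f \<longlongrightarrow> f w) (at w)" by (rule LIM_zero_cancel)
qed

lemma (in prob_space) expectation_power2_le:
  fixes X :: "'a \<Rightarrow> real"
  assumes X: "integrable M X" "integrable M (\<lambda>x. (X x)\<^sup>2)"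
  shows "(expectation X)\<^sup>2 \<le> expectation (\<lambda>x. (X x)\<^sup>2)"
  using variance_positive[of X] variance_eq[OF X] by simp

lemma (in finite_measure) integrable_power2_imp:
  fixes X :: "'a \<Rightarrow> 'b::{banach, second_countable_topology}"
  assumes "X \<in> borel_measurable M" and sq: "integrable M (\<lambda>x. (norm (X x))\<^sup>2)"
  shows "integrable M X"
proof (rule Bochner_Integration.integrable_bound)
  show "integrable M (\<lambda>x. 1 + (norm (X x))\<^sup>2)" using sq by simp
  have "norm (X x) \<le> 1 + (norm (X x))\<^sup>2" for x
  proof -
    have "2 * norm (X x) \<le> 1 + (norm (X x))\<^sup>2"
      using zero_le_power2[of "norm (X x) - 1"] by (simp add: power2_diff)
    then show ?thesis using norm_ge_zero[of "X x"] by linarith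
  qed
  then show "AE x in M. norm (X x) \<le> norm (1 + (norm (X x))\<^sup>2)" by simp
qed fact

section \<open>Resampling in the infinite product of draws\<close>

locale iid_draws = prob_space M for M :: "'i measure"
begin

definition draws :: "('d \<Rightarrow> 'i) measure" where "draws = PiM UNIV (\<lambda>_. M)"

lemma prob_space_draws: "prob_space draws"
  unfolding draws_def by (intro prob_space_PiM prob_space_axioms)

lemma measurable_draw [measurable]: "(\<lambda>\<omega>. \<omega> d) \<in> measurable draws M"
  unfolding draws_def by simp

lemma space_draws: "space draws = {\<omega>. \<forall>d. \<omega> d \<in> space M}"
  by (auto simp: draws_def space_PiM PiE_def Pi_def)

lemma sets_draws: "sets draws = sets (PiM UNIV (\<lambda>_. M))"
  by (simp add: draws_def)

lemma measurable_into_draws: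
  assumes "\<And>d. (\<lambda>x. f x d) \<in> measurable N M"
  shows "f \<in> measurable N draws"
proof -
  have "(\<lambda>x d. f x d) \<in> measurable N (PiM UNIV (\<lambda>_. M))"
    using assms measurable_space[OF assms] by (intro measurable_PiM_single') auto
  then show ?thesis by (simp add: draws_def)
qed

lemma distr_draw: "distr draws M (\<lambda>\<omega>. \<omega> d) = M"
  unfolding draws_def by (rule distr_PiM_component) (simp_all add: prob_space_axioms)

lemma integrable_draw:
  fixes f :: "'i \<Rightarrow> 'b::{banach, second_countable_topology}"
  assumes "integrable M f"
  shows "integrable draws (\<lambda>\<omega>. f (\<omega> d))"
  using assms by (intro integrable_distr[OF measurable_draw]) (simp add: distr_draw)

lemma integral_draw:
  fixes f :: "'i \<Rightarrow> 'b::{banach, second_countable_topology}"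
  assumes "f \<in> borel_measurable M"
  shows "(\<integral>\<omega>. f (\<omega> d) \<partial>draws) = (\<integral>i. f i \<partial>M)"
  using integral_distr[OF measurable_draw assms, of d] by (simp add: distr_draw)

definition merge_draws :: "'d set \<Rightarrow> ('d \<Rightarrow> 'i) \<times> ('d \<Rightarrow> 'i) \<Rightarrow> 'd \<Rightarrow> 'i" where
  "merge_draws J = (\<lambda>(\<omega>, \<omega>') d. if d \<in> J then \<omega> d else \<omega>' d)"

lemma measurable_merge_draws [measurable]:
  "merge_draws J \<in> measurable (draws \<Otimes>\<^sub>M draws) draws"
proof (rule measurable_into_draws)
  fix d
  show "(\<lambda>z. merge_draws J z d) \<in> measurable (draws \<Otimes>\<^sub>M draws) M"
    by (cases "d \<in> J") (simp_all add: merge_draws_def case_prod_beta)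
qed

text \<open>Resampling the draws outside \<open>J\<close> does not change the law; all uses of independence go
  through this fact.\<close>

lemma distr_merge_draws:
  fixes J :: "'d set"
  shows "distr (draws \<Otimes>\<^sub>M draws) draws (merge_draws J) = draws"
proof -
  interpret D: prob_space "draws :: ('d \<Rightarrow> 'i) measure" by (rule prob_space_draws)
  interpret DD: pair_prob_space "draws :: ('d \<Rightarrow> 'i) measure" "draws :: ('d \<Rightarrow> 'i) measure" ..
  interpret M: product_prob_space "\<lambda>_. M" "UNIV :: 'd set" ..
  have emb: "emeasure draws {\<omega> \<in> space draws. \<forall>d\<in>I. \<omega> d \<in> A d} = (\<Prod>d\<in>I. emeasure M (A d))"
    if "finite I" "\<And>d. d \<in> I \<Longrightarrow> A d \<in> sets M" for I :: "'d set" and A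
    using M.emeasure_PiM_Collect[of I A] that by (simp add: draws_def)
  show ?thesis
    unfolding draws_def
  proof (rule measure_eqI_PiM_infinite, fold draws_def)
    fix A and I :: "'d set" assume I: "finite I" "I \<subseteq> UNIV" and A: "\<And>d. d \<in> I \<Longrightarrow> A d \<in> sets M"
    let ?C = "\<lambda>I. {\<omega> \<in> space draws. \<forall>d\<in>I. \<omega> d \<in> A d}"
    have emb_eq: "prod_emb UNIV (\<lambda>_. M) I (Pi\<^sub>E I A) = ?C I"
      by (auto simp: prod_emb_def draws_def PiE_def Pi_def restrict_def extensional_def space_PiM)
    have C: "?C I' \<in> sets draws" if "I' \<subseteq> I" for I'
    proof (rule sets.sets_Collect_finite_All)
      fix d assume "d \<in> I'"
      then have [measurable]: "A d \<in> sets M" using A that by auto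
      show "{\<omega> \<in> space draws. \<omega> d \<in> A d} \<in> sets draws" by measurable
    qed (use that I(1) finite_subset in auto)
    \<comment> \<open>The preimage of a cylinder is a rectangle: constraints in \<open>J\<close>
      fall on the first copy, the others on the second. Its measure is the product over
      \<open>I\<close>, split at \<open>J\<close>.\<close>
    have split: "merge_draws J -` ?C I \<inter> space (draws \<Otimes>\<^sub>M draws) = ?C (I \<inter> J) \<times> ?C (I - J)"
      by (auto simp: merge_draws_def space_pair_measure space_draws)
    have "emeasure (distr (draws \<Otimes>\<^sub>M draws) draws (merge_draws J)) (?C I)
        = emeasure draws (?C (I \<inter> J)) * emeasure draws (?C (I - J))"
      using C[of "I \<inter> J"] C[of "I - J"]
      by (simp only: emeasure_distr[OF measurable_merge_draws C[OF subset_refl]] split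
          D.emeasure_pair_measure_Times Int_lower1 Diff_subset)
    also have "\<dots> = (\<Prod>d\<in>I \<inter> J. emeasure M (A d)) * (\<Prod>d\<in>I - J. emeasure M (A d))"
      using I A by (intro arg_cong2[where f = "(*)"] emb) auto
    also have "\<dots> = emeasure draws (?C I)"
      using I A by (simp add: emb prod.Int_Diff[symmetric])
    finally show "emeasure (distr (draws \<Otimes>\<^sub>M draws) draws (merge_draws J))
          (prod_emb UNIV (\<lambda>_. M) I (Pi\<^sub>E I A))
        = emeasure draws (prod_emb UNIV (\<lambda>_. M) I (Pi\<^sub>E I A))"
      unfolding emb_eq .
  qed (simp_all add: DD.P.finite_measure_distr sets_draws)
qed

text \<open>Takes the place of conditional expectation: the outer integral fixes the draws in
  \<open>J\<close>, the inner one averages over fresh copies of the rest.\<close>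

lemma nn_integral_merge_draws:
  assumes [measurable]: "f \<in> borel_measurable draws"
  shows "(\<integral>\<^sup>+\<omega>. f \<omega> \<partial>draws) = (\<integral>\<^sup>+\<omega>. \<integral>\<^sup>+\<omega>'. f (merge_draws J (\<omega>, \<omega>')) \<partial>draws \<partial>draws)"
proof -
  interpret D: prob_space "draws :: ('b \<Rightarrow> 'i) measure" by (rule prob_space_draws)
  have "(\<integral>\<^sup>+\<omega>. f \<omega> \<partial>draws) = (\<integral>\<^sup>+\<omega>. f \<omega> \<partial>distr (draws \<Otimes>\<^sub>M draws) draws (merge_draws J))"
    by (simp only: distr_merge_draws)
  also have "\<dots> = (\<integral>\<^sup>+z. f (merge_draws J z) \<partial>(draws \<Otimes>\<^sub>M draws))"
    by (rule nn_integral_distr) measurable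
  also have "\<dots> = (\<integral>\<^sup>+\<omega>. \<integral>\<^sup>+\<omega>'. f (merge_draws J (\<omega>, \<omega>')) \<partial>draws \<partial>draws)"
    by (subst D.nn_integral_fst[symmetric]) measurable
  finally show ?thesis .
qed

text \<open>Independence is expressed by the coordinates on which \<open>f\<close> and
  \<open>g\<close> depend. After merging, the two factors read different copies, and Fubini
  separates them.\<close>

lemma
  fixes f g :: "('d \<Rightarrow> 'i) \<Rightarrow> real"
  assumes f: "integrable draws f" and g: "integrable draws g"
    and f_cong: "\<And>\<omega> \<omega>'. (\<And>d. d \<in> J \<Longrightarrow> \<omega> d = \<omega>' d) \<Longrightarrow> f \<omega> = f \<omega>'"
    and g_cong: "\<And>\<omega> \<omega>'. (\<And>d. d \<notin> J \<Longrightarrow> \<omega> d = \<omega>' d) \<Longrightarrow> g \<omega> = g \<omega>'"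
  shows integrable_mult_indep: "integrable draws (\<lambda>\<omega>. f \<omega> * g \<omega>)" (is ?int)
    and integral_mult_indep:
      "(\<integral>\<omega>. f \<omega> * g \<omega> \<partial>draws) = (\<integral>\<omega>. f \<omega> \<partial>draws) * (\<integral>\<omega>. g \<omega> \<partial>draws)" (is ?eq)
proof -
  interpret D: prob_space "draws :: ('d \<Rightarrow> 'i) measure" by (rule prob_space_draws)
  interpret DD: pair_prob_space "draws :: ('d \<Rightarrow> 'i) measure" "draws :: ('d \<Rightarrow> 'i) measure" ..
  have [measurable]: "f \<in> borel_measurable draws" "g \<in> borel_measurable draws"
    using f g by auto
  have merge: "f (merge_draws J (\<omega>, \<omega>')) * g (merge_draws J (\<omega>, \<omega>')) = f \<omega> * g \<omega>'" for \<omega> \<omega>'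
    by (intro arg_cong2[where f = "(*)"] f_cong g_cong) (simp_all add: merge_draws_def)
  have int: "integrable (draws \<Otimes>\<^sub>M draws) (\<lambda>z. f (fst z) * g (snd z))"
    using f g by (intro DD.Fubini_integrable) (auto simp: abs_mult)
  then have "integrable (draws \<Otimes>\<^sub>M draws) (\<lambda>z. f (merge_draws J z) * g (merge_draws J z))"
    by (rule Bochner_Integration.integrable_cong[THEN iffD1, rotated 2]) (auto simp: merge)
  then have "integrable (distr (draws \<Otimes>\<^sub>M draws) draws (merge_draws J)) (\<lambda>\<omega>. f \<omega> * g \<omega>)"
    by (subst integrable_distr_eq) measurable
  then show ?int by (simp only: distr_merge_draws)
  have "(\<integral>\<omega>. f \<omega> * g \<omega> \<partial>draws)
      = (\<integral>\<omega>. f \<omega> * g \<omega> \<partial>distr (draws \<Otimes>\<^sub>M draws) draws (merge_draws J))"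
    by (simp only: distr_merge_draws)
  also have "\<dots> = (\<integral>z. f (merge_draws J z) * g (merge_draws J z) \<partial>(draws \<Otimes>\<^sub>M draws))"
    by (rule integral_distr) measurable
  also have "\<dots> = (\<integral>z. f (fst z) * g (snd z) \<partial>(draws \<Otimes>\<^sub>M draws))"
    by (rule Bochner_Integration.integral_cong) (auto simp: merge)
  also have "\<dots> = (\<integral>\<omega>. \<integral>\<omega>'. f \<omega> * g \<omega>' \<partial>draws \<partial>draws)"
    using DD.integral_fst'[OF int] by simp
  finally show ?eq by simp
qed

text \<open>Variance of a sum of independent centred vectors. The product rule above is for real
  functions, so the cross terms are shown to vanish coordinate by coordinate: the new summand
  depends on \<open>{d}\<close>, the old sum on its complement.\<close>

lemma
  fixes f :: "'i \<Rightarrow> 'b::euclidean_space" and A :: "'d set"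
  assumes f: "integrable M f" and sq: "integrable M (\<lambda>i. (norm (f i))\<^sup>2)"
    and centred: "(\<integral>i. f i \<partial>M) = 0" and "finite A"
  shows integrable_norm2_sum_draws: "integrable draws (\<lambda>\<omega>. (norm (\<Sum>d\<in>A. f (\<omega> d)))\<^sup>2)" (is "?int A")
    and integral_norm2_sum_draws:
      "(\<integral>\<omega>. (norm (\<Sum>d\<in>A. f (\<omega> d)))\<^sup>2 \<partial>draws) = card A * (\<integral>i. (norm (f i))\<^sup>2 \<partial>M)" (is "?eq A")
proof -
  have [measurable]: "f \<in> borel_measurable M" using f by auto
  have "?int A \<and> ?eq A" using \<open>finite A\<close>
  proof induction
    case empty
    then show ?case by simp
  next
    case (insert d A)
    let ?S = "\<lambda>\<omega>. \<Sum>d\<in>A. f (\<omega> d)"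
    have fd: "integrable draws (\<lambda>\<omega>. f (\<omega> d))" for d by (rule integrable_draw[OF f])
    have S: "integrable draws ?S" by (intro Bochner_Integration.integrable_sum fd)
    have cross: "integrable draws (\<lambda>\<omega>. (f (\<omega> d) \<bullet> e) * (?S \<omega> \<bullet> e))"
      "(\<integral>\<omega>. (f (\<omega> d) \<bullet> e) * (?S \<omega> \<bullet> e) \<partial>draws) = 0" for e
    proof -
      have f_int: "integrable draws (\<lambda>\<omega>. f (\<omega> d) \<bullet> e)" using fd by (rule integrable_inner_left)
      have S_int: "integrable draws (\<lambda>\<omega>. ?S \<omega> \<bullet> e)" using S by (rule integrable_inner_left)
      have f_cong: "f (\<omega> d) \<bullet> e = f (\<omega>' d) \<bullet> e" if "\<And>c. c \<in> {d} \<Longrightarrow> \<omega> c = \<omega>' c" for \<omega> \<omega>' :: "'d \<Rightarrow> 'i"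
        using that by simp
      have S_cong: "?S \<omega> \<bullet> e = ?S \<omega>' \<bullet> e" if eq: "\<And>c. c \<notin> {d} \<Longrightarrow> \<omega> c = \<omega>' c" for \<omega> \<omega>' :: "'d \<Rightarrow> 'i"
      proof -
        have "?S \<omega> = ?S \<omega>'"
        proof (rule sum.cong)
          show "f (\<omega> c) = f (\<omega>' c)" if "c \<in> A" for c
            using eq[of c] that insert.hyps(2) by (cases "c = d") simp_all
        qed simp
        then show ?thesis by simp
      qed
      show "integrable draws (\<lambda>\<omega>. (f (\<omega> d) \<bullet> e) * (?S \<omega> \<bullet> e))"
      proof (rule integrable_mult_indep[OF f_int S_int, where J = "{d}"])
        fix \<omega> \<omega>' :: "'d \<Rightarrow> 'i"
        show "f (\<omega> d) \<bullet> e = f (\<omega>' d) \<bullet> e" if "\<And>c. c \<in> {d} \<Longrightarrow> \<omega> c = \<omega>' c"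
          using that by (rule f_cong)
        show "?S \<omega> \<bullet> e = ?S \<omega>' \<bullet> e" if "\<And>c. c \<notin> {d} \<Longrightarrow> \<omega> c = \<omega>' c"
          using that by (rule S_cong)
      qed
      have "(\<integral>\<omega>. (f (\<omega> d) \<bullet> e) * (?S \<omega> \<bullet> e) \<partial>draws)
          = (\<integral>\<omega>. f (\<omega> d) \<bullet> e \<partial>draws) * (\<integral>\<omega>. ?S \<omega> \<bullet> e \<partial>draws)"
      proof (rule integral_mult_indep[OF f_int S_int, where J = "{d}"])
        fix \<omega> \<omega>' :: "'d \<Rightarrow> 'i"
        show "f (\<omega> d) \<bullet> e = f (\<omega>' d) \<bullet> e" if "\<And>c. c \<in> {d} \<Longrightarrow> \<omega> c = \<omega>' c"
          using that by (rule f_cong)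
        show "?S \<omega> \<bullet> e = ?S \<omega>' \<bullet> e" if "\<And>c. c \<notin> {d} \<Longrightarrow> \<omega> c = \<omega>' c"
          using that by (rule S_cong)
      qed
      also have "(\<integral>\<omega>. f (\<omega> d) \<bullet> e \<partial>draws) = 0"
        using centred by (simp add: integral_inner_left[OF fd] integral_draw)
      finally show "(\<integral>\<omega>. (f (\<omega> d) \<bullet> e) * (?S \<omega> \<bullet> e) \<partial>draws) = 0" by simp
    qed
    have inner: "f (\<omega> d) \<bullet> ?S \<omega> = (\<Sum>e\<in>Basis. (f (\<omega> d) \<bullet> e) * (?S \<omega> \<bullet> e))" for \<omega>
      by (rule euclidean_inner)
    have int_inner: "integrable draws (\<lambda>\<omega>. f (\<omega> d) \<bullet> ?S \<omega>)"
      unfolding inner by (intro Bochner_Integration.integrable_sum cross)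
    have zero: "(\<integral>\<omega>. f (\<omega> d) \<bullet> ?S \<omega> \<partial>draws) = 0"
      unfolding inner by (subst Bochner_Integration.integral_sum) (simp_all only: cross sum.neutral_const)
    have expand: "(norm (\<Sum>d\<in>insert d A. f (\<omega> d)))\<^sup>2
        = (norm (f (\<omega> d)))\<^sup>2 + 2 * (f (\<omega> d) \<bullet> ?S \<omega>) + (norm (?S \<omega>))\<^sup>2" for \<omega>
      using insert.hyps by (simp add: power2_norm_eq_inner inner_add_left inner_add_right inner_commute)
    have fd2: "integrable draws (\<lambda>\<omega>. (norm (f (\<omega> d)))\<^sup>2)" by (rule integrable_draw[OF sq])
    have "?int (insert d A)"
      unfolding expand using fd2 int_inner insert.IH by simp
    moreover have "?eq (insert d A)"
      unfolding expand using fd2 int_inner insert zero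
      by (simp add: integral_draw[of "\<lambda>i. (norm (f i))\<^sup>2"] algebra_simps)
    ultimately show ?case ..
  qed
  then show "?int A" "?eq A" by auto
qed

lemma
  fixes f :: "'i \<Rightarrow> 'b::euclidean_space" and c :: "nat \<Rightarrow> 'd"
  assumes f: "integrable M f" and sq: "integrable M (\<lambda>i. (norm (f i))\<^sup>2)"
    and "inj c" and "1 \<le> n"
  defines "avg \<equiv> \<lambda>\<omega>. (1 / real n) *\<^sub>R (\<Sum>m<n. f (\<omega> (c m)))"
    and "\<mu> \<equiv> \<integral>i. f i \<partial>M"
  shows integrable_average: "integrable draws avg"
    and integral_average: "(\<integral>\<omega>. avg \<omega> \<partial>draws) = \<mu>"
    and integrable_norm2_average_diff: "integrable draws (\<lambda>\<omega>. (norm (avg \<omega> - \<mu>))\<^sup>2)"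
    and integral_norm2_average_diff:
      "(\<integral>\<omega>. (norm (avg \<omega> - \<mu>))\<^sup>2 \<partial>draws) = (\<integral>i. (norm (f i - \<mu>))\<^sup>2 \<partial>M) / real n"
proof -
  have int: "integrable draws (\<lambda>\<omega>. f (\<omega> d))" for d :: 'd by (rule integrable_draw[OF f])
  show "integrable draws avg"
    unfolding avg_def by (intro integrable_scaleR_right Bochner_Integration.integrable_sum int)
  have "(\<integral>\<omega>. avg \<omega> \<partial>draws) = (1 / real n) *\<^sub>R (\<Sum>m<n. \<integral>\<omega>. f (\<omega> (c m)) \<partial>draws)"
    unfolding avg_def by (subst integral_scaleR_right, subst Bochner_Integration.integral_sum) (simp_all add: int)
  then show "(\<integral>\<omega>. avg \<omega> \<partial>draws) = \<mu>"
    using f \<open>1 \<le> n\<close> by (simp add: integral_draw \<mu>_def sum_constant_scaleR)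
  \<comment> \<open>The variance identity is stated for a set of draws; injectivity of
    \<open>c\<close> gives this set \<open>n\<close> members.\<close>
  have diff: "avg \<omega> - \<mu> = (1 / real n) *\<^sub>R (\<Sum>d\<in>c ` {..<n}. f (\<omega> d) - \<mu>)" for \<omega>
  proof -
    have "(\<Sum>d\<in>c ` {..<n}. f (\<omega> d) - \<mu>) = (\<Sum>m<n. f (\<omega> (c m))) - real n *\<^sub>R \<mu>"
      using \<open>inj c\<close> by (subst sum.reindex) (auto simp: inj_on_def inj_def sum_subtractf sum_constant_scaleR)
    then show ?thesis using \<open>1 \<le> n\<close> by (simp add: avg_def scaleR_diff_right)
  qed
  have f': "integrable M (\<lambda>i. f i - \<mu>)" using f by simp
  have [measurable]: "f \<in> borel_measurable M" using f by auto
  have sq': "integrable M (\<lambda>i. (norm (f i - \<mu>))\<^sup>2)"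
  proof -
    have "(norm (f i - \<mu>))\<^sup>2 = (norm (f i))\<^sup>2 - 2 * (f i \<bullet> \<mu>) + (norm \<mu>)\<^sup>2" for i
      by (simp add: power2_norm_eq_inner inner_diff_left inner_diff_right inner_commute)
    then show ?thesis using f sq by simp
  qed
  have centred: "(\<integral>i. f i - \<mu> \<partial>M) = 0" using f by (simp add: \<mu>_def prob_space)
  have card: "card (c ` {..<n}) = n"
    using \<open>inj c\<close> by (simp add: card_image inj_on_def inj_def)
  show "integrable draws (\<lambda>\<omega>. (norm (avg \<omega> - \<mu>))\<^sup>2)"
    unfolding diff using integrable_norm2_sum_draws[OF f' sq' centred, of "c ` {..<n}"]
    by (simp add: power_divide)
  show "(\<integral>\<omega>. (norm (avg \<omega> - \<mu>))\<^sup>2 \<partial>draws) = (\<integral>i. (norm (f i - \<mu>))\<^sup>2 \<partial>M) / real n"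
    unfolding diff using integral_norm2_sum_draws[OF f' sq' centred, of "c ` {..<n}"] card \<open>1 \<le> n\<close>
    by (simp add: power_divide power2_eq_square)
qed

end

section \<open>The meta objective\<close>

locale maml_family = smooth_task_family P L \<rho> \<sigma> nS nT
  for P :: "('i, 't, 'a::euclidean_space) task_family" and L \<rho> \<sigma> nS nT +
  fixes N :: nat
  assumes N_pos: "1 \<le> N"
    and integrable_adapted_loss: "integrable (task_dist P) (adapted_loss P (inner_rate N L) N w)"
begin

sublocale iid_draws "task_dist P" ..

abbreviation "\<alpha> \<equiv> inner_rate N L"
abbreviation "g i \<equiv> grad (loss_T P i)"
abbreviation "G i \<equiv> meta_grad_est P \<alpha> N i"
abbreviation "C \<equiv> C_lip L \<rho> \<alpha> N"
abbreviation "b \<equiv> mean_gap P"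

definition amp :: real where "amp = (1 + \<alpha> * L) ^ (2 * N)"
definition mean_G :: "'a \<Rightarrow> 'a" where "mean_G w = expectation (\<lambda>i. G i w)"
definition mean_norm :: "'a \<Rightarrow> real" where "mean_norm w = expectation (\<lambda>i. norm (g i w))"
definition Lip :: "'a \<Rightarrow> real" where "Lip w = amp * L + C * b + C * mean_norm w"

lemma rate_pos: "0 < \<alpha>"
  using L_pos N_pos by (simp add: inner_rate_def)

lemma rate_L: "\<alpha> * L = 1 / (8 * real N)"
  using L_pos by (simp add: inner_rate_def)

lemma amp_ge_1: "1 \<le> amp"
  unfolding amp_def using rate_pos L_pos by (intro one_le_power) simp

text \<open>The fourth power raises the exponent to 8N, the reciprocal of \<alpha>L, so
  \<open>amp ^ 4\<close> is at most e, hence at most 3, which lies below (4/3)^4 = 256/81.\<close>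

lemma amp_le: "amp \<le> 4 / 3"
proof (rule power_le_imp_le_base)
  have "1 + \<alpha> * L \<le> exp (\<alpha> * L)" by (rule exp_ge_add_one_self)
  then have "amp ^ Suc 3 \<le> (exp (\<alpha> * L) ^ (2 * N)) ^ 4"
    unfolding amp_def using rate_pos L_pos by (simp add: power_mono)
  also have "\<dots> = exp (real (8 * N) * (\<alpha> * L))"
    by (simp flip: power_mult exp_of_nat_mult)
  also have "\<dots> = exp 1" using N_pos by (simp add: rate_L)
  also have "\<dots> \<le> (4 / 3) ^ Suc 3" using exp_le by (simp add: power_divide)
  finally show "amp ^ Suc 3 \<le> (4 / 3) ^ Suc 3" .
qed simp

lemma C_nonneg: "0 \<le> C"
  unfolding C_lip_def using rate_pos L_pos rho_nonneg by simp

text \<open>Provides uniformity in \<open>N\<close>: in units of \<rho>/L the two summands of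
  \<open>C\<close> are at most 1/8 and 4/3, and (1/8 + 4/3) * 4/3 = 35/18 < 2.\<close>

lemma C_le: "C \<le> 2 * \<rho> / L"
proof -
  have "\<alpha> \<le> 1 / (8 * L)" 
    using N_pos L_pos by (simp add: inner_rate_def field_simps)
  then have 1: "\<alpha> * \<rho> \<le> 1 / 8 * (\<rho> / L)"
    using mult_right_mono[OF _ rho_nonneg] by fastforce
  have "(1 + \<alpha> * L) ^ (N - 1) \<le> amp"
    unfolding amp_def using rate_pos L_pos by (intro power_increasing) auto
  then have 2: "\<rho> / L * (1 + \<alpha> * L) ^ (N - 1) \<le> \<rho> / L * (4 / 3)"
    using amp_le rho_nonneg L_pos by (intro mult_left_mono) auto
  have "C \<le> (1 / 8 * (\<rho> / L) + \<rho> / L * (4 / 3)) * (4 / 3)"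
    unfolding C_lip_def amp_def[symmetric]
    using amp_ge_1 rho_nonneg L_pos by (intro mult_mono[OF add_mono[OF 1 2] amp_le]) auto
  also have "\<dots> \<le> 2 * (\<rho> / L)" using rho_nonneg L_pos by (simp add: field_simps)
  finally show ?thesis by simp
qed

lemma task_adapted:
  assumes "i \<in> space (task_dist P)"
  shows "adapted_task (loss_S P i) L \<rho> \<alpha> (loss_T P i) (grad_gap P i)"
  using assms smooth_S smooth_T gap_bound L_pos rate_pos by unfold_locales auto

lemma meta_grad_est_eq:
  assumes "i \<in> space (task_dist P)"
  shows "G i w = adapted_task.meta_grad (loss_S P i) \<alpha> (loss_T P i) N w"
  unfolding meta_grad_est_def adapted_task.meta_grad_def[OF task_adapted[OF assms]]
    inner_jacobian_eq_foldr ..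

lemma
  assumes i: "i \<in> space (task_dist P)"
  shows GDERIV_adapted_loss: "GDERIV (\<lambda>w. adapted_loss P \<alpha> N w i) w :> G i w"
    and norm_G_le: "norm (G i w) \<le> amp * (norm (g i w) + grad_gap P i)"
    and norm_G_diff_g_le: "norm (G i w - g i w) \<le> (amp - 1) * (norm (g i w) + grad_gap P i)"
    and norm_G_diff_le: "norm (G i u - G i w)
      \<le> (amp * L + C * (norm (g i w) + grad_gap P i)) * norm (u - w)"
proof -
  interpret adapted_task "loss_S P i" L \<rho> \<alpha> "loss_T P i" "grad_gap P i" N
    by (rule task_adapted[OF i])
  note G = meta_grad_est_eq[OF i]
  have amp: "q ^ (2 * N) = amp" by (simp add: amp_def q_def)
  show "GDERIV (\<lambda>w. adapted_loss P \<alpha> N w i) w :> G i w"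
    unfolding G adapted_loss_def by (rule GDERIV_adapted)
  show "norm (G i w) \<le> amp * (norm (g i w) + grad_gap P i)"
    using norm_meta_grad_le[of w] by (simp only: G amp)
  show "norm (G i w - g i w) \<le> (amp - 1) * (norm (g i w) + grad_gap P i)"
    using norm_meta_grad_diff_grad_le[of w] by (simp only: G amp)
  show "norm (G i u - G i w) \<le> (amp * L + C * (norm (g i w) + grad_gap P i)) * norm (u - w)"
    using norm_meta_grad_diff_le[OF L_pos N_pos, of u w] by (simp only: G amp)
qed

lemma adapted_loss_quadratic_bound:
  assumes i: "i \<in> space (task_dist P)"
  shows "\<bar>adapted_loss P \<alpha> N u i - adapted_loss P \<alpha> N w i - G i w \<bullet> (u - w)\<bar>
    \<le> (amp * L + C * (norm (g i w) + grad_gap P i)) / 2 * (norm (u - w))\<^sup>2"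
  by (rule quadratic_bound[OF GDERIV_adapted_loss[OF i] norm_G_diff_le[OF i]])

lemma g_lipschitz: "i \<in> space (task_dist P) \<Longrightarrow> norm (g i u - g i w) \<le> L * norm (u - w)"
  by (rule smooth_loss_grad_lipschitz[OF smooth_T])

lemma measurable_g [measurable]: "(\<lambda>i. g i w) \<in> borel_measurable (task_dist P)"
  using integrable_grad[of w] by auto

text \<open>The coordinates of \<open>G i w\<close> are limits of difference quotients of the
  adapted loss, which is measurable in the task. This avoids tracking measurability through Hessians
  and inner iterates.\<close>

lemma measurable_G [measurable]: "(\<lambda>i. G i w) \<in> borel_measurable (task_dist P)"
proof (subst borel_measurable_euclidean_space, safe)
  fix e :: 'a assume e: "e \<in> Basis"
  let ?F = "adapted_loss P \<alpha> N"
  have [measurable]: "?F u \<in> borel_measurable (task_dist P)" for u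
    using integrable_adapted_loss[of u] by auto
  show "(\<lambda>i. G i w \<bullet> e) \<in> borel_measurable (task_dist P)"
  proof (rule borel_measurable_LIMSEQ_real)
    fix i assume i: "i \<in> space (task_dist P)"
    define K where "K = (amp * L + C * (norm (g i w) + grad_gap P i)) / 2"
    show "(\<lambda>n. real (Suc n) * (?F (w + (1 / real (Suc n)) *\<^sub>R e) i - ?F w i)) \<longlonglongrightarrow> G i w \<bullet> e"
    proof (rule LIM_zero_cancel, rule tendsto_0_le)
      show "(\<lambda>n. K * (1 / real (Suc n))) \<longlonglongrightarrow> 0"
        using tendsto_mult_right_zero[OF LIMSEQ_inverse_real_of_nat, of K]
        by (simp add: inverse_eq_divide)
      have "\<bar>real (Suc n) * (?F (w + (1 / real (Suc n)) *\<^sub>R e) i - ?F w i) - G i w \<bullet> e\<bar>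
          \<le> \<bar>K * (1 / real (Suc n))\<bar> * 1" for n
      proof -
        let ?t = "1 / real (Suc n)"
        have "\<bar>?F (w + ?t *\<^sub>R e) i - ?F w i - ?t * (G i w \<bullet> e)\<bar> \<le> K * ?t\<^sup>2"
          using adapted_loss_quadratic_bound[OF i, of "w + ?t *\<^sub>R e" w] e by (simp add: K_def)
        then have "real (Suc n) * \<bar>?F (w + ?t *\<^sub>R e) i - ?F w i - ?t * (G i w \<bullet> e)\<bar>
            \<le> real (Suc n) * (K * ?t\<^sup>2)" by (intro mult_left_mono) auto
        also have "real (Suc n) * \<bar>?F (w + ?t *\<^sub>R e) i - ?F w i - ?t * (G i w \<bullet> e)\<bar>
            = \<bar>real (Suc n) * (?F (w + ?t *\<^sub>R e) i - ?F w i - ?t * (G i w \<bullet> e))\<bar>"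
          by (simp add: abs_mult)
        also have "real (Suc n) * (?F (w + ?t *\<^sub>R e) i - ?F w i - ?t * (G i w \<bullet> e))
            = real (Suc n) * (?F (w + ?t *\<^sub>R e) i - ?F w i) - G i w \<bullet> e"
          by (simp add: field_simps)
        also have "real (Suc n) * (K * ?t\<^sup>2) = K * ?t"
          by (simp add: power2_eq_square del: of_nat_Suc)
        finally show ?thesis by (rule order_trans) (simp only: mult_1_right abs_ge_self)
      qed
      then show "\<forall>\<^sub>F n in sequentially.
          norm (real (Suc n) * (?F (w + (1 / real (Suc n)) *\<^sub>R e) i - ?F w i) - G i w \<bullet> e)
          \<le> norm (K * (1 / real (Suc n))) * 1" by simp
    qed
  qed measurable
qed

section \<open>Moments of the task gradients and averaging over tasks\<close>

lemma integrable_norm_g: "integrable (task_dist P) (\<lambda>i. norm (g i w))"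
  using integrable_grad by (rule integrable_norm)

lemma
  shows integrable_norm_g_sq: "integrable (task_dist P) (\<lambda>i. (norm (g i w))\<^sup>2)"
    and expectation_norm_g_sq_le:
      "expectation (\<lambda>i. (norm (g i w))\<^sup>2) \<le> (norm (mean_grad_T P w))\<^sup>2 + \<sigma>\<^sup>2"
proof -
  let ?m = "mean_grad_T P w"
  have expand: "(norm (g i w))\<^sup>2 = (norm (g i w - ?m))\<^sup>2 + (2 * (g i w \<bullet> ?m) - (norm ?m)\<^sup>2)" for i
    by (simp add: power2_norm_eq_inner inner_diff_left inner_diff_right inner_commute)
  have int: "integrable (task_dist P) (\<lambda>i. 2 * (g i w \<bullet> ?m) - (norm ?m)\<^sup>2)"
    using integrable_grad[of w] by simp
  show "integrable (task_dist P) (\<lambda>i. (norm (g i w))\<^sup>2)"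
    unfolding expand using integrable_variance int by (rule Bochner_Integration.integrable_add)
  have "expectation (\<lambda>i. 2 * (g i w \<bullet> ?m) - (norm ?m)\<^sup>2) = (norm ?m)\<^sup>2"
    using integrable_grad[of w]
    by (simp add: prob_space power2_norm_eq_inner flip: mean_grad_T_def)
  then show "expectation (\<lambda>i. (norm (g i w))\<^sup>2) \<le> (norm ?m)\<^sup>2 + \<sigma>\<^sup>2"
    unfolding expand using integrable_variance[of w] int variance_le[of w] by simp
qed

lemma b_nonneg: "0 \<le> b"
  unfolding mean_gap_def using gap_pos by (intro integral_nonneg_AE) (auto intro!: AE_I2 less_imp_le)

lemma mean_norm_nonneg: "0 \<le> mean_norm w"
  unfolding mean_norm_def by (intro integral_nonneg_AE) auto

lemma Lip_pos: "0 < Lip w" and L_le_Lip: "L \<le> Lip w"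
proof -
  have "L \<le> amp * L" using amp_ge_1 L_pos by simp
  then show "L \<le> Lip w"
    using mult_nonneg_nonneg[OF C_nonneg b_nonneg]
      mult_nonneg_nonneg[OF C_nonneg mean_norm_nonneg[of w]] by (simp add: Lip_def)
  then show "0 < Lip w" using L_pos by simp
qed

lemma mean_norm_le: "mean_norm w \<le> norm (mean_grad_T P w) + \<sigma>"
proof -
  let ?m = "mean_grad_T P w"
  have d: "integrable (task_dist P) (\<lambda>i. norm (g i w - ?m))" using integrable_grad[of w] by simp
  have "(expectation (\<lambda>i. norm (g i w - ?m)))\<^sup>2 \<le> \<sigma>\<^sup>2"
    using expectation_power2_le[OF d integrable_variance] variance_le by (rule order_trans)
  then have s: "expectation (\<lambda>i. norm (g i w - ?m)) \<le> \<sigma>"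
    using sigma_nonneg by (rule power2_le_imp_le)
  have "mean_norm w \<le> expectation (\<lambda>i. norm ?m + norm (g i w - ?m))"
    unfolding mean_norm_def using d integrable_norm_g norm_triangle_sub
    by (intro integral_mono) auto
  also have "\<dots> = norm ?m + expectation (\<lambda>i. norm (g i w - ?m))"
    using d by (simp add: prob_space)
  finally show ?thesis using s by simp
qed

text \<open>The constant 32/9 is 2 * (4/3)^2: the squared bound on \<open>amp\<close>, and a factor
  2 from splitting the square of a sum.\<close>

lemma
  shows integrable_G: "integrable (task_dist P) (\<lambda>i. G i w)"
    and integrable_norm_G_sq: "integrable (task_dist P) (\<lambda>i. (norm (G i w))\<^sup>2)"
    and expectation_norm_G_sq_le: "expectation (\<lambda>i. (norm (G i w))\<^sup>2)
      \<le> 32 / 9 * ((norm (mean_grad_T P w))\<^sup>2 + \<sigma>\<^sup>2 + expectation (\<lambda>i. (grad_gap P i)\<^sup>2))"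
proof -
  let ?h = "\<lambda>i. 32 / 9 * ((norm (g i w))\<^sup>2 + (grad_gap P i)\<^sup>2)"
  have h: "integrable (task_dist P) ?h"
    using integrable_norm_g_sq integrable_gap_sq by simp
  have le: "(norm (G i w))\<^sup>2 \<le> ?h i" if i: "i \<in> space (task_dist P)" for i
  proof -
    have "norm (G i w) \<le> 4 / 3 * (norm (g i w) + grad_gap P i)"
      using norm_G_le[OF i, of w] mult_right_mono[OF amp_le, of "norm (g i w) + grad_gap P i"]
        gap_pos[OF i] by simp
    then have "(norm (G i w))\<^sup>2 \<le> (4 / 3 * (norm (g i w) + grad_gap P i))\<^sup>2"
      by (intro power_mono) auto
    also have "\<dots> = 16 / 9 * (norm (norm (g i w) + grad_gap P i))\<^sup>2"
      unfolding power_mult_distrib real_norm_def power2_abs by (simp add: power_divide)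
    also have "\<dots> \<le> 16 / 9 * (2 * (norm (norm (g i w)))\<^sup>2 + 2 * (norm (grad_gap P i))\<^sup>2)"
      by (intro mult_left_mono norm_power2_add_le) simp
    finally show ?thesis by simp
  qed
  show sq: "integrable (task_dist P) (\<lambda>i. (norm (G i w))\<^sup>2)"
    using h by (rule Bochner_Integration.integrable_bound) (auto intro!: AE_I2 dest!: le)
  show "integrable (task_dist P) (\<lambda>i. G i w)" by (rule integrable_power2_imp[OF measurable_G sq])
  have "expectation (\<lambda>i. (norm (G i w))\<^sup>2) \<le> expectation ?h"
    using sq h le by (rule integral_mono)
  also have "\<dots> = 32 / 9 * (expectation (\<lambda>i. (norm (g i w))\<^sup>2) + expectation (\<lambda>i. (grad_gap P i)\<^sup>2))"
    using integrable_norm_g_sq integrable_gap_sq by simp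
  finally show "expectation (\<lambda>i. (norm (G i w))\<^sup>2)
      \<le> 32 / 9 * ((norm (mean_grad_T P w))\<^sup>2 + \<sigma>\<^sup>2 + expectation (\<lambda>i. (grad_gap P i)\<^sup>2))"
    using expectation_norm_g_sq_le[of w] by simp
qed

text \<open>The two gradients differ by at most 1/3 of the plain gradient plus noise, so that third
  is absorbed on the left; dividing by 2/3 yields the factors 3/2 and 1/2. Through this bound the
  moments of the raw task gradients are controlled by the meta-gradient.\<close>

lemma norm_mean_grad_T_le: "norm (mean_grad_T P w) \<le> 3 / 2 * norm (mean_G w) + (\<sigma> + b) / 2"
proof -
  have "mean_G w - mean_grad_T P w = expectation (\<lambda>i. G i w - g i w)"
    using integrable_G integrable_grad by (simp add: mean_G_def mean_grad_T_def)
  then have "norm (mean_G w - mean_grad_T P w) \<le> expectation (\<lambda>i. norm (G i w - g i w))"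
    by (simp only: integral_norm_bound)
  also have "\<dots> \<le> expectation (\<lambda>i. 1 / 3 * (norm (g i w) + grad_gap P i))"
  proof (rule integral_mono)
    fix i assume i: "i \<in> space (task_dist P)"
    have "(amp - 1) * (norm (g i w) + grad_gap P i) \<le> 1 / 3 * (norm (g i w) + grad_gap P i)"
      using amp_le gap_pos[OF i] by (intro mult_right_mono) auto
    then show "norm (G i w - g i w) \<le> 1 / 3 * (norm (g i w) + grad_gap P i)"
      using norm_G_diff_g_le[OF i, of w] by simp
  qed (use integrable_G integrable_grad integrable_norm_g integrable_gap in auto)
  also have "\<dots> = 1 / 3 * (mean_norm w + b)"
    using integrable_norm_g integrable_gap by (simp add: mean_norm_def mean_gap_def)
  finally have "norm (mean_G w - mean_grad_T P w) \<le> 1 / 3 * (norm (mean_grad_T P w) + \<sigma> + b)"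
    using mean_norm_le[of w] by simp
  moreover have "norm (mean_grad_T P w) \<le> norm (mean_G w) + norm (mean_G w - mean_grad_T P w)"
    by (metis norm_minus_commute norm_triangle_sub)
  ultimately show ?thesis by argo
qed

text \<open>The constants of the single tasks are affine in \<open>norm (g i w)\<close> and
  \<open>grad_gap P i\<close>, so their mean is exactly \<open>Lip w\<close>.\<close>

lemma meta_loss_quadratic_bound:
  "\<bar>meta_loss P \<alpha> N u - meta_loss P \<alpha> N w - mean_G w \<bullet> (u - w)\<bar> \<le> Lip w / 2 * (norm (u - w))\<^sup>2"
proof -
  let ?F = "adapted_loss P \<alpha> N"
  have eq: "meta_loss P \<alpha> N u - meta_loss P \<alpha> N w - mean_G w \<bullet> (u - w)
      = expectation (\<lambda>i. ?F u i - ?F w i - G i w \<bullet> (u - w))"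
    using integrable_adapted_loss integrable_G[of w] by (simp add: meta_loss_def mean_G_def)
  have "\<bar>expectation (\<lambda>i. ?F u i - ?F w i - G i w \<bullet> (u - w))\<bar>
      \<le> expectation (\<lambda>i. \<bar>?F u i - ?F w i - G i w \<bullet> (u - w)\<bar>)"
    by (rule integral_abs_bound)
  also have "\<dots> \<le> expectation (\<lambda>i.
      (amp * L + C * (norm (g i w) + grad_gap P i)) / 2 * (norm (u - w))\<^sup>2)"
    using integrable_adapted_loss integrable_G[of w] integrable_norm_g integrable_gap
      adapted_loss_quadratic_bound
    by (intro integral_mono) auto
  also have "\<dots> = Lip w / 2 * (norm (u - w))\<^sup>2"
    using integrable_norm_g[of w] integrable_gap
    by (simp add: Lip_def mean_norm_def mean_gap_def prob_space algebra_simps)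
  finally show ?thesis by (simp only: eq)
qed

lemma grad_meta_loss: "grad (meta_loss P \<alpha> N) w = mean_G w"
  by (intro grad_eqI GDERIV_of_quadratic_bound[OF meta_loss_quadratic_bound])

lemma continuous_meta_loss: "continuous_on UNIV (meta_loss P \<alpha> N)"
proof -
  have "GDERIV (meta_loss P \<alpha> N) w :> mean_G w" for w
    by (intro GDERIV_of_quadratic_bound[OF meta_loss_quadratic_bound])
  then show ?thesis
    unfolding gderiv_def continuous_on_eq_continuous_at[OF open_UNIV]
    using has_derivative_continuous by blast
qed

lemma norm_mean_G_diff_le: "norm (mean_G u - mean_G w) \<le> Lip w * norm (u - w)"
proof -
  have "norm (mean_G u - mean_G w) = norm (expectation (\<lambda>i. G i u - G i w))"
    using integrable_G by (simp add: mean_G_def)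
  also have "\<dots> \<le> expectation (\<lambda>i. norm (G i u - G i w))" by (rule integral_norm_bound)
  also have "\<dots> \<le> expectation (\<lambda>i. (amp * L + C * (norm (g i w) + grad_gap P i)) * norm (u - w))"
    using integrable_G integrable_norm_g integrable_gap norm_G_diff_le
    by (intro integral_mono) auto
  also have "\<dots> = Lip w * norm (u - w)"
    using integrable_norm_g[of w] integrable_gap
    by (simp add: Lip_def mean_norm_def mean_gap_def prob_space algebra_simps)
  finally show ?thesis .
qed

text \<open>Serves the measurability of \<open>Lip\<close>, through the continuity of
  \<open>mean_norm\<close>.\<close>

lemma mean_norm_diff_le: "\<bar>mean_norm u - mean_norm w\<bar> \<le> L * norm (u - w)"
proof -
  have "\<bar>mean_norm u - mean_norm w\<bar> = \<bar>expectation (\<lambda>i. norm (g i u) - norm (g i w))\<bar>"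
    using integrable_norm_g by (simp add: mean_norm_def)
  also have "\<dots> \<le> expectation (\<lambda>i. \<bar>norm (g i u) - norm (g i w)\<bar>)" by (rule integral_abs_bound)
  also have "\<dots> \<le> expectation (\<lambda>i. L * norm (u - w))"
  proof (rule integral_mono)
    fix i assume i: "i \<in> space (task_dist P)"
    show "\<bar>norm (g i u) - norm (g i w)\<bar> \<le> L * norm (u - w)"
      using norm_triangle_ineq3 g_lipschitz[OF i] by (rule order_trans)
  qed (use integrable_norm_g in auto)
  finally show ?thesis by (simp add: prob_space)
qed

section \<open>Measurability at random points\<close>

lemma measurable_meta_loss [measurable]: "meta_loss P \<alpha> N \<in> borel_measurable borel"
  by (rule borel_measurable_continuous_onI[OF continuous_meta_loss])

lemma measurable_mean_G [measurable]: "mean_G \<in> borel_measurable borel"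
  by (intro borel_measurable_continuous_onI continuous_on_of_local_lipschitz[OF norm_mean_G_diff_le])

lemma measurable_Lip [measurable]: "Lip \<in> borel_measurable borel"
proof -
  have "mean_norm \<in> borel_measurable borel"
    by (intro borel_measurable_continuous_onI continuous_on_of_local_lipschitz[where c = "\<lambda>_. L"])
      (simp add: mean_norm_diff_le)
  then show ?thesis
    unfolding Lip_def[abs_def] by (intro borel_measurable_add borel_measurable_times) auto
qed

lemma measurable_norm_g_draw:
  assumes "X \<in> measurable R (task_dist P)" and "W \<in> borel_measurable R"
  shows "(\<lambda>x. norm (g (X x) (W x))) \<in> borel_measurable R"
proof (rule borel_measurable_Caratheodory[OF _ _ assms])
  show "continuous_on UNIV (\<lambda>w. norm (g i w))" if "i \<in> space (task_dist P)" for i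
    by (intro continuous_on_norm continuous_on_of_local_lipschitz[OF g_lipschitz[OF that]])
qed measurable

lemma measurable_G_draw:
  assumes "X \<in> measurable R (task_dist P)" and "W \<in> borel_measurable R"
  shows "(\<lambda>x. G (X x) (W x)) \<in> borel_measurable R"
proof (rule borel_measurable_Caratheodory[OF _ _ assms])
  show "continuous_on UNIV (G i)" if "i \<in> space (task_dist P)" for i
    by (rule continuous_on_of_local_lipschitz[OF norm_G_diff_le[OF that]])
qed measurable

end

section \<open>Moments of the step size and of the batch gradient\<close>

text \<open>Tangent at \<open>y\<close> of the convex function 1/x. When \<open>y\<close> is the
  mean of \<open>x\<close>, integrating the tangent gives 1/y, which is Jensen's inequality for the
  reciprocal.\<close>

lemma inverse_ge_tangent:
  fixes x y :: real
  assumes "0 < x" "0 < y"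
  shows "2 / y - x / y\<^sup>2 \<le> 1 / x"
proof -
  have "x * (2 * y - x) \<le> y\<^sup>2"
    using zero_le_power2[of "x - y"] by (simp add: power2_eq_square algebra_simps)
  then have "(2 * y - x) / y\<^sup>2 \<le> 1 / x" using assms by (simp add: divide_simps mult.commute)
  moreover have "2 / y - x / y\<^sup>2 = (2 * y - x) / y\<^sup>2"
    using assms by (simp add: power2_eq_square diff_divide_distrib)
  ultimately show ?thesis by simp
qed

text \<open>Turns a variance bound into a second moment of the reciprocal: \<open>y\<close> is split
  into \<open>x\<close> and the deviation from it, and the floor \<open>a\<close> is used only where
  the deviation is divided by x^2, so that the main term stays relative to \<open>y\<close>.\<close>

lemma inverse_power2_le:
  fixes x y a :: real
  assumes "0 < a" "a \<le> x" "0 < y"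
  shows "(1 / x)\<^sup>2 \<le> (2 + 2 / a\<^sup>2 * (x - y)\<^sup>2) / y\<^sup>2"
proof -
  have "y\<^sup>2 \<le> 2 * x\<^sup>2 + 2 * (x - y)\<^sup>2"
    using zero_le_power2[of "2 * x - y"] by (simp add: power2_eq_square algebra_simps)
  then have "y\<^sup>2 / x\<^sup>2 \<le> 2 + 2 / x\<^sup>2 * (x - y)\<^sup>2"
    using assms by (simp add: field_simps)
  also have "\<dots> \<le> 2 + 2 / a\<^sup>2 * (x - y)\<^sup>2"
    using assms by (intro add_left_mono mult_right_mono divide_left_mono power_mono) auto
  finally have "y\<^sup>2 * (1 / x)\<^sup>2 \<le> 2 + 2 / a\<^sup>2 * (x - y)\<^sup>2" by (simp add: power_divide)
  then show ?thesis using assms by (simp add: pos_le_divide_eq mult.commute)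
qed

context maml_family
begin

abbreviation "Q \<equiv> expectation (\<lambda>i. (grad_gap P i)\<^sup>2)"

lemma Q_nonneg: "0 \<le> Q"
  by (intro integral_nonneg_AE) auto

lemma b_power2_le: "b\<^sup>2 \<le> Q"
  unfolding mean_gap_def using integrable_gap integrable_gap_sq by (rule expectation_power2_le)

text \<open>Here 16 = 32/9 * 9/2, while the noise collects 32/9 twice, and 64/9 \<le> 8.\<close>

lemma expectation_norm_G_sq_le':
  "expectation (\<lambda>i. (norm (G i w))\<^sup>2) \<le> 16 * (norm (mean_G w))\<^sup>2 + 8 * (\<sigma>\<^sup>2 + Q)"
proof -
  have "(norm (mean_grad_T P w))\<^sup>2 \<le> (norm (3 / 2 * norm (mean_G w) + (\<sigma> + b) / 2))\<^sup>2"
    using norm_mean_grad_T_le[of w] sigma_nonneg b_nonneg by (intro power_mono) auto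
  also have "\<dots> \<le> 2 * (norm (3 / 2 * norm (mean_G w)))\<^sup>2 + 2 * (norm ((\<sigma> + b) / 2))\<^sup>2"
    by (rule norm_power2_add_le)
  also have "\<dots> = 9 / 2 * (norm (mean_G w))\<^sup>2 + 1 / 2 * (norm (\<sigma> + b))\<^sup>2"
    by (simp add: power_mult_distrib power_divide)
  finally have "(norm (mean_grad_T P w))\<^sup>2
      \<le> 9 / 2 * (norm (mean_G w))\<^sup>2 + 1 / 2 * (norm (\<sigma> + b))\<^sup>2" .
  moreover have "(norm (\<sigma> + b))\<^sup>2 \<le> 2 * (norm \<sigma>)\<^sup>2 + 2 * (norm b)\<^sup>2"
    by (rule norm_power2_add_le)
  ultimately have "(norm (mean_grad_T P w))\<^sup>2 \<le> 9 / 2 * (norm (mean_G w))\<^sup>2 + (\<sigma>\<^sup>2 + Q)"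
    unfolding real_norm_def power2_abs using b_power2_le by argo
  then show ?thesis
    using expectation_norm_G_sq_le[of w] Q_nonneg zero_le_power2[of \<sigma>] by argo
qed

text \<open>The mean is the best constant in mean square, so \<open>mean_norm w\<close> may be
  replaced by the norm of the mean gradient; the reverse triangle inequality then compares with the
  vector variance.\<close>

lemma variance_norm_g_le: "expectation (\<lambda>i. (norm (norm (g i w) - mean_norm w))\<^sup>2) \<le> \<sigma>\<^sup>2"
proof -
  let ?c = "norm (mean_grad_T P w)"
  have expand: "(norm (g i w) - ?c)\<^sup>2 = (norm (norm (g i w) - mean_norm w))\<^sup>2
      + (2 * (mean_norm w - ?c) * (norm (g i w) - mean_norm w) + (mean_norm w - ?c)\<^sup>2)" for i
    by (simp add: power2_eq_square algebra_simps)
  have int: "integrable (task_dist P) (\<lambda>i. (norm (norm (g i w) - mean_norm w))\<^sup>2)"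
    using integrable_norm_g integrable_norm_g_sq by (simp add: power2_diff)
  have int': "integrable (task_dist P)
      (\<lambda>i. 2 * (mean_norm w - ?c) * (norm (g i w) - mean_norm w) + (mean_norm w - ?c)\<^sup>2)"
    using integrable_norm_g by simp
  have zero: "expectation (\<lambda>i. norm (g i w) - mean_norm w) = 0"
    using integrable_norm_g by (simp add: mean_norm_def prob_space)
  have "expectation (\<lambda>i. (norm (norm (g i w) - mean_norm w))\<^sup>2)
      \<le> expectation (\<lambda>i. (norm (norm (g i w) - mean_norm w))\<^sup>2) + (mean_norm w - ?c)\<^sup>2"
    by simp
  also have "\<dots> = expectation (\<lambda>i. (norm (g i w) - ?c)\<^sup>2)"
  proof -
    have "expectation (\<lambda>i. 2 * (mean_norm w - ?c) * (norm (g i w) - mean_norm w) + (mean_norm w - ?c)\<^sup>2)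
        = (mean_norm w - ?c)\<^sup>2"
      using integrable_norm_g by (simp add: zero prob_space del: Bochner_Integration.integral_diff)
    then show ?thesis unfolding expand using int int' by (simp only: Bochner_Integration.integral_add)
  qed
  also have "\<dots> \<le> expectation (\<lambda>i. (norm (g i w - mean_grad_T P w))\<^sup>2)"
  proof (rule integral_mono)
    show "integrable (task_dist P) (\<lambda>i. (norm (g i w) - ?c)\<^sup>2)"
      unfolding expand using int int' by (rule Bochner_Integration.integrable_add)
    show "(norm (g i w) - ?c)\<^sup>2 \<le> (norm (g i w - mean_grad_T P w))\<^sup>2" for i
      using power_mono[OF norm_triangle_ineq3[of "g i w" "mean_grad_T P w"], of 2] by simp
  qed (rule integrable_variance)
  also have "\<dots> \<le> \<sigma>\<^sup>2" by (rule variance_le)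
  finally show ?thesis .
qed

lemma L_hat_eq:
  "L_hat P L \<rho> \<alpha> N n i w
    = amp * L + C * b + C * ((1 / real n) *\<^sub>R (\<Sum>m<n. norm (g (i m) w)))"
  by (simp add: L_hat_def amp_def)

lemma L_hat_ge: "amp * L + C * b \<le> L_hat P L \<rho> \<alpha> N n i w"
  unfolding L_hat_eq using C_nonneg by (auto intro!: mult_nonneg_nonneg divide_nonneg_nonneg sum_nonneg)

lemma L_hat_base_pos: "0 < amp * L + C * b"
proof -
  have "0 < amp * L" using amp_ge_1 L_pos by simp
  then show ?thesis using mult_nonneg_nonneg[OF C_nonneg b_nonneg] by simp
qed

lemma measurable_L_hat:
  assumes "\<And>m. (\<lambda>x. X x m) \<in> measurable R (task_dist P)" and "W \<in> borel_measurable R"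
  shows "(\<lambda>x. L_hat P L \<rho> \<alpha> N n (X x) (W x)) \<in> borel_measurable R"
  unfolding L_hat_def using measurable_norm_g_draw[OF assms] by measurable

section \<open>The estimated smoothness constant\<close>

context
  fixes c :: "nat \<Rightarrow> 'd" and n :: nat
  assumes c: "inj c" and n: "1 \<le> n" and n_ge: "aux_batch_bound P L \<rho> \<sigma> \<alpha> N \<le> real n"
begin

abbreviation (input) "Lh w \<omega> \<equiv> L_hat P L \<rho> \<alpha> N n (\<lambda>m. \<omega> (c m)) w"

lemma
  shows integrable_L_hat: "integrable draws (\<lambda>\<omega>. Lh w \<omega>)"
    and integral_L_hat: "(\<integral>\<omega>. Lh w \<omega> \<partial>draws) = Lip w"
    and integrable_L_hat_diff_sq: "integrable draws (\<lambda>\<omega>. (Lh w \<omega> - Lip w)\<^sup>2)"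
    and integral_L_hat_diff_sq_le:
      "(\<integral>\<omega>. (Lh w \<omega> - Lip w)\<^sup>2 \<partial>draws) \<le> (amp * L + C * b)\<^sup>2 / 2"
proof -
  interpret D: prob_space "draws :: ('d \<Rightarrow> 'i) measure" by (rule prob_space_draws)
  let ?f = "\<lambda>i. norm (g i w)"
  let ?avg = "\<lambda>\<omega>. (1 / real n) *\<^sub>R (\<Sum>m<n. ?f (\<omega> (c m)))"
  have f: "integrable (task_dist P) ?f" by (rule integrable_norm_g)
  have f2: "integrable (task_dist P) (\<lambda>i. (norm (?f i))\<^sup>2)" using integrable_norm_g_sq by simp
  note avg = integrable_average[OF f f2 c n] integral_average[OF f f2 c n, folded mean_norm_def]
    integrable_norm2_average_diff[OF f f2 c n, folded mean_norm_def]
    integral_norm2_average_diff[OF f f2 c n, folded mean_norm_def]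
  have lin: "(\<integral>\<omega>. k + C * A \<omega> \<partial>draws) = k + C * (\<integral>\<omega>. A \<omega> \<partial>draws)"
    if "integrable draws A" for A :: "('d \<Rightarrow> 'i) \<Rightarrow> real" and k
    using that by (simp add: D.prob_space)
  show "integrable draws (\<lambda>\<omega>. Lh w \<omega>)"
    unfolding L_hat_eq
    by (intro Bochner_Integration.integrable_add integrable_mult_right D.integrable_const avg(1))
  show "(\<integral>\<omega>. Lh w \<omega> \<partial>draws) = Lip w"
    unfolding L_hat_eq Lip_def lin[OF avg(1)] avg(2) ..
  have diff: "(Lh w \<omega> - Lip w)\<^sup>2 = C\<^sup>2 * (norm (?avg \<omega> - mean_norm w))\<^sup>2" for \<omega>
  proof -
    have "Lh w \<omega> - Lip w = C * (?avg \<omega> - mean_norm w)"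
      unfolding L_hat_eq Lip_def by (simp only: right_diff_distrib)
    then show ?thesis by (simp add: power_mult_distrib)
  qed
  show "integrable draws (\<lambda>\<omega>. (Lh w \<omega> - Lip w)\<^sup>2)"
    unfolding diff using avg(3) by (rule integrable_mult_right)
  have "(\<integral>\<omega>. (Lh w \<omega> - Lip w)\<^sup>2 \<partial>draws)
      = C\<^sup>2 * (expectation (\<lambda>i. (norm (norm (g i w) - mean_norm w))\<^sup>2) / real n)"
    unfolding diff using avg(4) by (simp only: integral_mult_right_zero)
  also have "\<dots> \<le> C\<^sup>2 * (\<sigma>\<^sup>2 / real n)"
    using variance_norm_g_le[of w] by (intro mult_left_mono divide_right_mono) auto
  \<comment> \<open>The prescribed batch size is exactly the one at which the variance bound falls
    to half the square of the deterministic part of \<open>L_hat\<close>.\<close>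
  also have "\<dots> \<le> (amp * L + C * b)\<^sup>2 / 2"
  proof -
    have "2 * C\<^sup>2 * \<sigma>\<^sup>2 / (amp * L + C * b)\<^sup>2 \<le> real n"
      using n_ge by (simp add: aux_batch_bound_def amp_def add.commute)
    moreover have "0 < (amp * L + C * b)\<^sup>2" using L_hat_base_pos by (intro zero_less_power)
    ultimately have "2 * C\<^sup>2 * \<sigma>\<^sup>2 \<le> real n * (amp * L + C * b)\<^sup>2"
      by (simp only: pos_divide_le_eq)
    then show ?thesis using n by (simp add: field_simps)
  qed
  finally show "(\<integral>\<omega>. (Lh w \<omega> - Lip w)\<^sup>2 \<partial>draws) \<le> (amp * L + C * b)\<^sup>2 / 2" .
qed

lemma L_hat_pos: "0 < Lh w \<omega>"
  using L_hat_base_pos L_hat_ge by (rule less_le_trans)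

text \<open>The reciprocal is bounded because \<open>L_hat\<close> never falls below its
  deterministic part. In the second moment this floor cancels against the variance bound, and 3
  arises as 2 + 2 * 1/2.\<close>

lemma
  shows integrable_inverse_L_hat: "integrable draws (\<lambda>\<omega>. 1 / Lh w \<omega>)"
    and integral_inverse_L_hat_ge: "1 / Lip w \<le> (\<integral>\<omega>. 1 / Lh w \<omega> \<partial>draws)"
    and integrable_inverse_L_hat_sq: "integrable draws (\<lambda>\<omega>. (1 / Lh w \<omega>)\<^sup>2)"
    and integral_inverse_L_hat_sq_le: "(\<integral>\<omega>. (1 / Lh w \<omega>)\<^sup>2 \<partial>draws) \<le> 3 / (Lip w)\<^sup>2"
proof -
  interpret D: prob_space "draws :: ('d \<Rightarrow> 'i) measure" by (rule prob_space_draws)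
  let ?a = "amp * L + C * b"
  have [measurable]: "(\<lambda>\<omega>. Lh w \<omega>) \<in> borel_measurable draws"
    by (rule measurable_L_hat) measurable
  have "norm (1 / Lh w \<omega>) \<le> 1 / ?a" for \<omega>
    using L_hat_base_pos L_hat_ge[of n "\<lambda>m. \<omega> (c m)" w] L_hat_pos[of \<omega> w]
    by (simp add: frac_le)
  then show int: "integrable draws (\<lambda>\<omega>. 1 / Lh w \<omega>)"
    by (intro D.integrable_const_bound[of _ "1 / ?a"] AE_I2) measurable
  have sq_le: "(1 / Lh w \<omega>)\<^sup>2 \<le> (2 + 2 / ?a\<^sup>2 * (Lh w \<omega> - Lip w)\<^sup>2) / (Lip w)\<^sup>2" for \<omega>
    by (rule inverse_power2_le[OF L_hat_base_pos L_hat_ge Lip_pos])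
  have int_sq_le: "integrable draws (\<lambda>\<omega>. (2 + 2 / ?a\<^sup>2 * (Lh w \<omega> - Lip w)\<^sup>2) / (Lip w)\<^sup>2)"
    using integrable_L_hat_diff_sq by simp
  show int_sq: "integrable draws (\<lambda>\<omega>. (1 / Lh w \<omega>)\<^sup>2)"
  proof (rule Bochner_Integration.integrable_bound[OF int_sq_le])
    show "AE \<omega> in draws. norm ((1 / Lh w \<omega>)\<^sup>2)
        \<le> norm ((2 + 2 / ?a\<^sup>2 * (Lh w \<omega> - Lip w)\<^sup>2) / (Lip w)\<^sup>2)"
      using order_trans[OF sq_le abs_ge_self] by (intro AE_I2) (simp only: real_norm_def abs_power2)
  qed measurable
  have "1 / Lip w = (\<integral>\<omega>. 2 / Lip w - Lh w \<omega> / (Lip w)\<^sup>2 \<partial>draws)"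
    using integrable_L_hat integral_L_hat Lip_pos[of w]
    by (simp add: D.prob_space power2_eq_square field_simps)
  also have "\<dots> \<le> (\<integral>\<omega>. 1 / Lh w \<omega> \<partial>draws)"
    using integrable_L_hat int inverse_ge_tangent[OF L_hat_pos Lip_pos]
    by (intro integral_mono) auto
  finally show "1 / Lip w \<le> (\<integral>\<omega>. 1 / Lh w \<omega> \<partial>draws)" .
  have "(\<integral>\<omega>. (1 / Lh w \<omega>)\<^sup>2 \<partial>draws)
      \<le> (\<integral>\<omega>. (2 + 2 / ?a\<^sup>2 * (Lh w \<omega> - Lip w)\<^sup>2) / (Lip w)\<^sup>2 \<partial>draws)"
    using int_sq int_sq_le sq_le by (rule integral_mono)
  also have "\<dots> = (2 + 2 / ?a\<^sup>2 * (\<integral>\<omega>. (Lh w \<omega> - Lip w)\<^sup>2 \<partial>draws)) / (Lip w)\<^sup>2"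
    using integrable_L_hat_diff_sq by (simp add: D.prob_space)
  also have "\<dots> \<le> (2 + 2 / ?a\<^sup>2 * (?a\<^sup>2 / 2)) / (Lip w)\<^sup>2"
    using integral_L_hat_diff_sq_le by (intro divide_right_mono add_left_mono mult_left_mono) auto
  also have "\<dots> = 3 / (Lip w)\<^sup>2" using L_hat_base_pos by simp
  finally show "(\<integral>\<omega>. (1 / Lh w \<omega>)\<^sup>2 \<partial>draws) \<le> 3 / (Lip w)\<^sup>2" .
qed

end

section \<open>The batch gradient\<close>

context
  fixes c :: "nat \<Rightarrow> 'd" and B :: nat
  assumes c: "inj c" and B: "1 \<le> B"
begin

abbreviation (input) "Gh w \<omega> \<equiv> (1 / real B) *\<^sub>R (\<Sum>m<B. G (\<omega> (c m)) w)"

text \<open>Second moment as squared mean plus variance: only the variance gains the factor 1/B, and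
  there it is replaced by the raw second moment of a single \<open>G\<close>.\<close>

lemma
  shows integrable_batch_grad: "integrable draws (\<lambda>\<omega>. Gh w \<omega>)"
    and integral_batch_grad: "(\<integral>\<omega>. Gh w \<omega> \<partial>draws) = mean_G w"
    and integrable_batch_grad_sq: "integrable draws (\<lambda>\<omega>. (norm (Gh w \<omega>))\<^sup>2)"
    and integral_batch_grad_sq_le: "(\<integral>\<omega>. (norm (Gh w \<omega>))\<^sup>2 \<partial>draws)
      \<le> (norm (mean_G w))\<^sup>2 + (16 * (norm (mean_G w))\<^sup>2 + 8 * (\<sigma>\<^sup>2 + Q)) / real B"
proof -
  interpret D: prob_space "draws :: ('d \<Rightarrow> 'i) measure" by (rule prob_space_draws)
  note avg = integrable_average[OF integrable_G integrable_norm_G_sq c B]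
    integral_average[OF integrable_G integrable_norm_G_sq c B, folded mean_G_def]
    integrable_norm2_average_diff[OF integrable_G integrable_norm_G_sq c B, folded mean_G_def]
    integral_norm2_average_diff[OF integrable_G integrable_norm_G_sq c B, folded mean_G_def]
  show int: "integrable draws (\<lambda>\<omega>. Gh w \<omega>)" by (rule avg(1))
  show mean: "(\<integral>\<omega>. Gh w \<omega> \<partial>draws) = mean_G w" by (rule avg(2))
  have expand: "(norm (Gh w \<omega>))\<^sup>2
      = (norm (Gh w \<omega> - mean_G w))\<^sup>2 + (2 * (Gh w \<omega> \<bullet> mean_G w) - (norm (mean_G w))\<^sup>2)" for \<omega>
    by (simp only: power2_norm_eq_inner inner_diff_left inner_diff_right inner_commute)
  have int': "integrable draws (\<lambda>\<omega>. 2 * (Gh w \<omega> \<bullet> mean_G w) - (norm (mean_G w))\<^sup>2)"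
    by (intro Bochner_Integration.integrable_diff integrable_mult_right integrable_inner_left int
        D.integrable_const)
  show "integrable draws (\<lambda>\<omega>. (norm (Gh w \<omega>))\<^sup>2)"
    unfolding expand using avg(3) int' by (rule Bochner_Integration.integrable_add)
  have lin: "(\<integral>\<omega>. 2 * A \<omega> - k \<partial>draws) = 2 * (\<integral>\<omega>. A \<omega> \<partial>draws) - k"
    if "integrable draws A" for A :: "('d \<Rightarrow> 'i) \<Rightarrow> real" and k
    using that by (simp add: D.prob_space)
  have mean': "(\<integral>\<omega>. 2 * (Gh w \<omega> \<bullet> mean_G w) - (norm (mean_G w))\<^sup>2 \<partial>draws) = (norm (mean_G w))\<^sup>2"
    unfolding lin[OF integrable_inner_left[OF int]] integral_inner_left[OF int] mean
    by (simp add: power2_norm_eq_inner)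
  have "expectation (\<lambda>i. (norm (G i w - mean_G w))\<^sup>2) \<le> expectation (\<lambda>i. (norm (G i w))\<^sup>2)"
  proof -
    have *: "(norm (G i w - mean_G w))\<^sup>2
        = (norm (G i w))\<^sup>2 - (2 * (G i w \<bullet> mean_G w) - (norm (mean_G w))\<^sup>2)" for i
      by (simp add: power2_norm_eq_inner inner_diff_left inner_diff_right inner_commute)
    have "expectation (\<lambda>i. (norm (G i w - mean_G w))\<^sup>2)
        = expectation (\<lambda>i. (norm (G i w))\<^sup>2) - (norm (mean_G w))\<^sup>2"
      unfolding * using integrable_G[of w] integrable_norm_G_sq[of w]
      by (simp add: prob_space power2_norm_eq_inner flip: mean_G_def)
    then show ?thesis by simp
  qed
  from order_trans[OF this expectation_norm_G_sq_le'] have var: "expectation (\<lambda>i. (norm (G i w - mean_G w))\<^sup>2) / real B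
      \<le> (16 * (norm (mean_G w))\<^sup>2 + 8 * (\<sigma>\<^sup>2 + Q)) / real B"
    by (rule divide_right_mono) simp
  have "(\<integral>\<omega>. (norm (Gh w \<omega>))\<^sup>2 \<partial>draws)
      = (\<integral>\<omega>. (norm (Gh w \<omega> - mean_G w))\<^sup>2 \<partial>draws) + (norm (mean_G w))\<^sup>2"
    unfolding expand Bochner_Integration.integral_add[OF avg(3) int'] mean' ..
  then show "(\<integral>\<omega>. (norm (Gh w \<omega>))\<^sup>2 \<partial>draws)
      \<le> (norm (mean_G w))\<^sup>2 + (16 * (norm (mean_G w))\<^sup>2 + 8 * (\<sigma>\<^sup>2 + Q)) / real B"
    using var avg(4) by simp
qed

end

end

section \<open>Descent along a run\<close>

text \<open>The meta iteration that consumes a draw, so that past and present draws are separated by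
  a threshold.\<close>

primrec stage :: "draw \<Rightarrow> nat" where
  "stage (Batch k m) = k"
| "stage (AuxBatch k m) = k"

text \<open>For \<phi> = x^2/l, the bound on \<open>l\<close> becomes a quadratic inequality in
  \<open>x\<close>, whence x \<le> c\<phi> + sqrt (a\<phi>). The root is then linearised by the
  arithmetic-geometric mean inequality at level \<open>\<Delta>\<close>, so that only the mean of
  \<phi> remains to be bounded.\<close>

lemma le_of_self_bounding:
  fixes x l a c \<Delta> :: real
  assumes "0 \<le> x" "0 < l" "l \<le> a + c * x" "0 \<le> c" "0 \<le> a" "0 < \<Delta>"
  shows "x \<le> (c + sqrt a / (2 * sqrt \<Delta>)) * (x\<^sup>2 / l) + sqrt a * sqrt \<Delta> / 2"
proof -
  define \<phi> where "\<phi> = x\<^sup>2 / l"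
  have \<phi>: "0 \<le> \<phi>" using assms by (simp add: \<phi>_def)
  have sq: "x\<^sup>2 \<le> a * \<phi> + c * \<phi> * x"
  proof -
    have "x\<^sup>2 = l * \<phi>" using assms(2) by (simp add: \<phi>_def)
    then show ?thesis using mult_right_mono[OF assms(3) \<phi>] by (simp add: algebra_simps)
  qed
  have "x \<le> c * \<phi> + sqrt (a * \<phi>)"
  proof (rule ccontr)
    assume "\<not> ?thesis"
    then have x: "c * \<phi> + sqrt (a * \<phi>) < x" by simp
    have s: "0 \<le> sqrt (a * \<phi>)" "sqrt (a * \<phi>) * sqrt (a * \<phi>) = a * \<phi>" and c\<phi>: "0 \<le> c * \<phi>"
      using assms \<phi> by auto
    then have "0 < x" using x by linarith
    have "a * \<phi> + c * \<phi> * x \<le> (c * \<phi> + sqrt (a * \<phi>)) * x"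
      using s mult_left_mono[of "sqrt (a * \<phi>)" x "sqrt (a * \<phi>)"] x c\<phi> by (simp add: algebra_simps)
    also have "\<dots> < x\<^sup>2" using x \<open>0 < x\<close> by (simp add: power2_eq_square)
    finally show False using sq by simp
  qed
  also have "sqrt (a * \<phi>) = sqrt a * sqrt \<phi>" by (rule real_sqrt_mult)
  finally have "x \<le> c * \<phi> + sqrt a * sqrt \<phi>" .
  moreover have "sqrt \<phi> \<le> \<phi> / (2 * sqrt \<Delta>) + sqrt \<Delta> / 2"
  proof -
    have "2 * (sqrt \<phi> * sqrt \<Delta>) \<le> \<phi> + \<Delta>"
      using zero_le_power2[of "sqrt \<phi> - sqrt \<Delta>"] \<phi> assms(6) by (simp add: power2_diff)
    then show ?thesis
      using assms(6) by (simp add: field_simps)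
  qed
  then have "sqrt a * sqrt \<phi> \<le> sqrt a * (\<phi> / (2 * sqrt \<Delta>) + sqrt \<Delta> / 2)"
    using assms(5) by (intro mult_left_mono) auto
  ultimately have "x \<le> c * \<phi> + sqrt a * (\<phi> / (2 * sqrt \<Delta>) + sqrt \<Delta> / 2)" by simp
  also have "\<dots> = (c + sqrt a / (2 * sqrt \<Delta>)) * \<phi> + sqrt a * sqrt \<Delta> / 2"
    by (simp add: algebra_simps)
  finally show ?thesis unfolding \<phi>_def .
qed

text \<open>As \<open>1 \<le> B\<close>, the second moment \<open>EA\<close> has coefficient at most
  1 + 16 = 17, and the quadratic term is at most 3 * 17 / (2 * 6400) = 51/12800 of
  \<open>x2 / l\<close>. The linear gain is 160/12800 and the decrease to be kept is 80/12800, which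
  fits since 51 + 80 \<le> 160.\<close>

lemma descent_arithmetic:
  fixes l x2 E1 E2 EA V B L :: real
  assumes "0 < L" "L \<le> l" "0 \<le> x2" "0 \<le> V" "1 \<le> B"
    and E1: "1 / l \<le> E1" and E2: "E2 \<le> 3 / l\<^sup>2" and EA: "EA \<le> x2 + (16 * x2 + 8 * V) / B"
    and "0 \<le> EA"
  shows "l / 2 * (E2 * EA / 6400) - E1 * x2 / 80 + x2 / (160 * l) \<le> 3 * V / (1600 * L * B)"
proof -
  have l: "0 < l" using assms by simp
  have "16 * x2 / B \<le> 16 * x2" using assms by (simp add: divide_le_eq mult_le_cancel_left1)
  then have EA': "EA \<le> 17 * x2 + 8 * V / B" using EA by (simp add: add_divide_distrib)
  have "E2 * EA \<le> 3 / l\<^sup>2 * (17 * x2 + 8 * V / B)"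
    using E2 EA' \<open>0 \<le> EA\<close> l by (intro mult_mono) auto
  then have "l / 2 * (E2 * EA / 6400) \<le> l / 2 * (3 / l\<^sup>2 * (17 * x2 + 8 * V / B) / 6400)"
    using l by (intro mult_left_mono divide_right_mono) auto
  also have "\<dots> = 51 / 12800 * (x2 / l) + 3 / 1600 * (V / (l * B))"
    using l assms(5) by (simp add: power2_eq_square field_simps)
  finally have 1: "l / 2 * (E2 * EA / 6400) \<le> 51 / 12800 * (x2 / l) + 3 / 1600 * (V / (l * B))" .
  have 2: "x2 / l \<le> E1 * x2" using mult_right_mono[OF E1 assms(3)] by simp
  have 3: "V / (l * B) \<le> V / (L * B)"
    using assms by (intro divide_left_mono mult_right_mono) auto
  have 4: "0 \<le> x2 / l" using l assms by simp
  have "x2 / (160 * l) = 1 / 160 * (x2 / l)" "3 * V / (1600 * L * B) = 3 / 1600 * (V / (L * B))"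
    by simp_all
  with 1 2 3 4 show ?thesis by argo
qed

context maml_family
begin

text \<open>Step size and batch gradient use disjoint draws, so both the linear and the quadratic
  term of the centred bound factor into known moments. The point \<open>w\<close> is deterministic
  here; the randomness of the iterate enters afterwards by resampling.\<close>

lemma step_descent:
  fixes c c' :: "nat \<Rightarrow> 'd"
  assumes c: "inj c" and c': "inj c'" and disjoint: "\<And>m m'. c m \<noteq> c' m'"
    and B: "1 \<le> B" and n: "1 \<le> n" and n_ge: "aux_batch_bound P L \<rho> \<sigma> \<alpha> N \<le> real n"
    and lower: "\<And>u. I \<le> meta_loss P \<alpha> N u"
  shows "(\<integral>\<^sup>+\<omega>. ennreal (meta_loss P \<alpha> N
        (w - (1 / (80 * L_hat P L \<rho> \<alpha> N n (\<lambda>m. \<omega> (c' m)) w) / real B) *\<^sub>R (\<Sum>m<B. G (\<omega> (c m)) w)) - I)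
        \<partial>draws) + ennreal ((norm (mean_G w))\<^sup>2 / (160 * Lip w))
    \<le> ennreal (meta_loss P \<alpha> N w - I) + ennreal (3 * (\<sigma>\<^sup>2 + Q) / (1600 * L * real B))"
proof -
  interpret D: prob_space "draws :: ('d \<Rightarrow> 'i) measure" by (rule prob_space_draws)
  define r where "r \<omega> = 1 / L_hat P L \<rho> \<alpha> N n (\<lambda>m. \<omega> (c' m)) w" for \<omega> :: "'d \<Rightarrow> 'i"
  define A where "A \<omega> = (1 / real B) *\<^sub>R (\<Sum>m<B. G (\<omega> (c m)) w)" for \<omega> :: "'d \<Rightarrow> 'i"
  let ?u = "\<lambda>\<omega>. w - (r \<omega> / 80) *\<^sub>R A \<omega>"
  let ?x2 = "(norm (mean_G w))\<^sup>2"
  note r_facts = integrable_inverse_L_hat[OF c' n n_ge, of w, folded r_def]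
    integral_inverse_L_hat_ge[OF c' n n_ge, of w, folded r_def]
    integrable_inverse_L_hat_sq[OF c' n n_ge, of w, folded r_def]
    integral_inverse_L_hat_sq_le[OF c' n n_ge, of w, folded r_def]
  note A_facts = integrable_batch_grad[OF c B, of w, folded A_def]
    integral_batch_grad[OF c B, of w, folded A_def]
    integrable_batch_grad_sq[OF c B, of w, folded A_def]
    integral_batch_grad_sq_le[OF c B, of w, folded A_def]
  have r_cong: "r \<omega> = r \<omega>'" if "\<And>d. d \<in> range c' \<Longrightarrow> \<omega> d = \<omega>' d" for \<omega> \<omega>'
    unfolding r_def using that by simp
  have A_cong: "A \<omega> = A \<omega>'" if "\<And>d. d \<notin> range c' \<Longrightarrow> \<omega> d = \<omega>' d" for \<omega> \<omega>'
  proof -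
    have "\<omega> (c m) = \<omega>' (c m)" for m using that[of "c m"] disjoint by blast
    then show ?thesis by (simp add: A_def)
  qed
  have lin: "integrable draws (\<lambda>\<omega>. r \<omega> * (A \<omega> \<bullet> mean_G w))"
    "(\<integral>\<omega>. r \<omega> * (A \<omega> \<bullet> mean_G w) \<partial>draws) = (\<integral>\<omega>. r \<omega> \<partial>draws) * ?x2"
  proof -
    note indep = integrable_mult_indep[OF r_facts(1) integrable_inner_left[OF A_facts(1)], of "range c'"]
      integral_mult_indep[OF r_facts(1) integrable_inner_left[OF A_facts(1)], of "range c'"]
    show "integrable draws (\<lambda>\<omega>. r \<omega> * (A \<omega> \<bullet> mean_G w))"
      by (rule indep(1)) (metis r_cong, metis A_cong)
    have "(\<integral>\<omega>. r \<omega> * (A \<omega> \<bullet> mean_G w) \<partial>draws)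
        = (\<integral>\<omega>. r \<omega> \<partial>draws) * (\<integral>\<omega>. A \<omega> \<bullet> mean_G w \<partial>draws)"
      by (rule indep(2)) (metis r_cong, metis A_cong)
    then show "(\<integral>\<omega>. r \<omega> * (A \<omega> \<bullet> mean_G w) \<partial>draws) = (\<integral>\<omega>. r \<omega> \<partial>draws) * ?x2"
      by (simp only: integral_inner_left[OF A_facts(1)] A_facts(2) power2_norm_eq_inner)
  qed
  have quad: "integrable draws (\<lambda>\<omega>. (r \<omega>)\<^sup>2 * (norm (A \<omega>))\<^sup>2)"
    "(\<integral>\<omega>. (r \<omega>)\<^sup>2 * (norm (A \<omega>))\<^sup>2 \<partial>draws) = (\<integral>\<omega>. (r \<omega>)\<^sup>2 \<partial>draws) * (\<integral>\<omega>. (norm (A \<omega>))\<^sup>2 \<partial>draws)"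
  proof -
    note indep = integrable_mult_indep[OF r_facts(3) A_facts(3), of "range c'"]
      integral_mult_indep[OF r_facts(3) A_facts(3), of "range c'"]
    show "integrable draws (\<lambda>\<omega>. (r \<omega>)\<^sup>2 * (norm (A \<omega>))\<^sup>2)"
      by (rule indep(1)) (metis r_cong, metis A_cong)
    show "(\<integral>\<omega>. (r \<omega>)\<^sup>2 * (norm (A \<omega>))\<^sup>2 \<partial>draws)
        = (\<integral>\<omega>. (r \<omega>)\<^sup>2 \<partial>draws) * (\<integral>\<omega>. (norm (A \<omega>))\<^sup>2 \<partial>draws)"
      by (rule indep(2)) (metis r_cong, metis A_cong)
  qed
  \<comment> \<open>An integrable majorant of the new gap, with computable mean. It is nonnegative
    because the gap is, so the passage to \<open>ennreal\<close> truncates nothing.\<close>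
  define h where "h \<omega> = meta_loss P \<alpha> N w - I - r \<omega> * (A \<omega> \<bullet> mean_G w) / 80
      + Lip w / 2 * ((r \<omega>)\<^sup>2 * (norm (A \<omega>))\<^sup>2 / 6400)" for \<omega>
  have le_h: "meta_loss P \<alpha> N (?u \<omega>) - I \<le> h \<omega>" for \<omega>
  proof -
    have e1: "mean_G w \<bullet> (?u \<omega> - w) = - (r \<omega> * (A \<omega> \<bullet> mean_G w) / 80)"
      by (simp add: inner_commute)
    have e2: "(norm (?u \<omega> - w))\<^sup>2 = (r \<omega>)\<^sup>2 * (norm (A \<omega>))\<^sup>2 / 6400"
      by (simp add: power_mult_distrib power_divide)
    have "meta_loss P \<alpha> N (?u \<omega>) - meta_loss P \<alpha> N w - mean_G w \<bullet> (?u \<omega> - w)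
        \<le> Lip w / 2 * (norm (?u \<omega> - w))\<^sup>2"
      using meta_loss_quadratic_bound abs_le_D1 by blast
    then show ?thesis unfolding e1 e2 h_def by linarith
  qed
  have int_h: "integrable draws h"
    unfolding h_def using lin(1) quad(1) by simp
  have h_nonneg: "0 \<le> h \<omega>" for \<omega> using le_h[of \<omega>] lower[of "?u \<omega>"] by linarith
  have Eh: "(\<integral>\<omega>. h \<omega> \<partial>draws) = meta_loss P \<alpha> N w - I - (\<integral>\<omega>. r \<omega> \<partial>draws) * ?x2 / 80
      + Lip w / 2 * ((\<integral>\<omega>. (r \<omega>)\<^sup>2 \<partial>draws) * (\<integral>\<omega>. (norm (A \<omega>))\<^sup>2 \<partial>draws) / 6400)"
    unfolding h_def lin(2)[symmetric] quad(2)[symmetric]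
    using lin(1) quad(1) by (simp add: D.prob_space)
  have "(\<integral>\<omega>. h \<omega> \<partial>draws) + ?x2 / (160 * Lip w)
      \<le> (meta_loss P \<alpha> N w - I) + 3 * (\<sigma>\<^sup>2 + Q) / (1600 * L * real B)"
  proof -
    have "0 \<le> \<sigma>\<^sup>2 + Q" "1 \<le> real B" "0 \<le> (\<integral>\<omega>. (norm (A \<omega>))\<^sup>2 \<partial>draws)"
      using Q_nonneg B by (auto intro: integral_nonneg_AE)
    from descent_arithmetic[OF L_pos L_le_Lip zero_le_power2 this(1,2) r_facts(2,4) A_facts(4) this(3)]
    show ?thesis unfolding Eh by linarith
  qed
  then have "ennreal ((\<integral>\<omega>. h \<omega> \<partial>draws) + ?x2 / (160 * Lip w))
      \<le> ennreal ((meta_loss P \<alpha> N w - I) + 3 * (\<sigma>\<^sup>2 + Q) / (1600 * L * real B))"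
    by (rule ennreal_leI)
  then have "ennreal (\<integral>\<omega>. h \<omega> \<partial>draws) + ennreal (?x2 / (160 * Lip w))
      \<le> ennreal (meta_loss P \<alpha> N w - I) + ennreal (3 * (\<sigma>\<^sup>2 + Q) / (1600 * L * real B))"
    using h_nonneg lower[of w] Lip_pos[of w] Q_nonneg L_pos
    by (subst (asm) (1 2) ennreal_plus) (auto intro!: integral_nonneg_AE divide_nonneg_nonneg)
  moreover have "(\<integral>\<^sup>+\<omega>. ennreal (meta_loss P \<alpha> N (?u \<omega>) - I) \<partial>draws) \<le> ennreal (\<integral>\<omega>. h \<omega> \<partial>draws)"
    using le_h h_nonneg
    by (subst nn_integral_eq_integral[OF int_h, symmetric])
      (auto intro!: nn_integral_mono ennreal_leI)
  ultimately have "(\<integral>\<^sup>+\<omega>. ennreal (meta_loss P \<alpha> N (?u \<omega>) - I) \<partial>draws) + ennreal (?x2 / (160 * Lip w))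
      \<le> ennreal (meta_loss P \<alpha> N w - I) + ennreal (3 * (\<sigma>\<^sup>2 + Q) / (1600 * L * real B))"
    using add_right_mono order_trans by blast
  moreover have "w - (1 / (80 * L_hat P L \<rho> \<alpha> N n (\<lambda>m. \<omega> (c' m)) w) / real B) *\<^sub>R (\<Sum>m<B. G (\<omega> (c m)) w)
      = ?u \<omega>" for \<omega>
    by (simp add: r_def A_def)
  ultimately show ?thesis by (simp only:)
qed

end

section \<open>The random iterates and their telescoped descent\<close>

locale maml_run = maml_family P L \<rho> \<sigma> nS nT N
  for P :: "('i, 't, 'a::euclidean_space) task_family" and L \<rho> \<sigma> nS nT N +
  fixes B :: nat and B' :: "nat \<Rightarrow> nat" and w0 :: 'a and I :: real
  assumes B_pos: "1 \<le> B" and B'_pos: "1 \<le> B' k"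
    and B'_ge: "aux_batch_bound P L \<rho> \<sigma> \<alpha> N \<le> real (B' k)"
    and lower: "I \<le> meta_loss P \<alpha> N u"
begin

abbreviation "W k \<omega> \<equiv> maml_iter P L \<rho> \<alpha> N B B' w0 \<omega> k"

definition update :: "nat \<Rightarrow> 'a \<Rightarrow> (draw \<Rightarrow> 'i) \<Rightarrow> 'a" where
  "update k w \<omega> = w - (1 / (80 * L_hat P L \<rho> \<alpha> N (B' k) (\<lambda>m. \<omega> (AuxBatch k m)) w) / real B) *\<^sub>R
     (\<Sum>m<B. G (\<omega> (Batch k m)) w)"

lemma W_Suc: "W (Suc k) \<omega> = update k (W k \<omega>) \<omega>"
  by (simp add: update_def outer_rate_def Let_def)

lemma measurable_update:
  assumes "\<And>d. (\<lambda>x. X x d) \<in> measurable R (task_dist P)" and "V \<in> borel_measurable R"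
  shows "(\<lambda>x. update k (V x) (X x)) \<in> borel_measurable R"
proof -
  have [measurable]: "(\<lambda>x. L_hat P L \<rho> \<alpha> N (B' k) (\<lambda>m. X x (AuxBatch k m)) (V x)) \<in> borel_measurable R"
    using assms by (intro measurable_L_hat)
  have [measurable]: "(\<lambda>x. G (X x (Batch k m)) (V x)) \<in> borel_measurable R" for m
    using assms by (intro measurable_G_draw)
  show ?thesis unfolding update_def using assms(2) by measurable
qed

lemma measurable_W [measurable]: "W k \<in> borel_measurable draws"
proof (induction k)
  case (Suc k)
  then show ?case
    unfolding W_Suc by (intro measurable_update) auto
qed simp

lemma update_cong:
  assumes "\<And>d. stage d = k \<Longrightarrow> \<omega> d = \<omega>' d"
  shows "update k w \<omega> = update k w \<omega>'"
  unfolding update_def using assms by simp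

lemma W_cong:
  assumes "\<And>d. stage d < k \<Longrightarrow> \<omega> d = \<omega>' d"
  shows "W k \<omega> = W k \<omega>'"
  using assms
proof (induction k)
  case (Suc k)
  have "W k \<omega> = W k \<omega>'" using Suc.prems by (intro Suc.IH) simp
  moreover have "update k w \<omega> = update k w \<omega>'" for w using Suc.prems by (intro update_cong) simp
  ultimately show ?case unfolding W_Suc by simp
qed simp

definition noise :: ennreal where "noise = ennreal (3 * (\<sigma>\<^sup>2 + Q) / (1600 * L * real B))"
definition gap :: "nat \<Rightarrow> ennreal" where
  "gap k = (\<integral>\<^sup>+\<omega>. ennreal (meta_loss P \<alpha> N (W k \<omega>) - I) \<partial>draws)"
definition decrease :: "nat \<Rightarrow> ennreal" where
  "decrease k = (\<integral>\<^sup>+\<omega>. ennreal ((norm (mean_G (W k \<omega>)))\<^sup>2 / (160 * Lip (W k \<omega>))) \<partial>draws)"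

text \<open>\<open>W k\<close> reads only stages below \<open>k\<close>, and the update reads only
  stage \<open>k\<close>. Resampling all stages from \<open>k\<close> on makes the iterate a
  constant under the inner integral, where the one-step bound applies for every outcome of the
  past.\<close>

lemma gap_Suc: "gap (Suc k) + decrease k \<le> gap k + noise"
proof -
  interpret D: prob_space "draws :: (draw \<Rightarrow> 'i) measure" by (rule prob_space_draws)
  let ?J = "{d. stage d < k}"
  let ?f = "\<lambda>w \<omega>. ennreal (meta_loss P \<alpha> N (update k w \<omega>) - I)"
  let ?\<phi> = "\<lambda>w. ennreal ((norm (mean_G w))\<^sup>2 / (160 * Lip w))"
  have [measurable]: "(\<lambda>\<omega>. ?f (W k \<omega>) \<omega>) \<in> borel_measurable draws"
    unfolding W_Suc[symmetric] by measurable
  have merge: "?f (W k (merge_draws ?J (\<omega>, \<omega>'))) (merge_draws ?J (\<omega>, \<omega>')) = ?f (W k \<omega>) \<omega>'" for \<omega> \<omega>'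
  proof -
    have "W k (merge_draws ?J (\<omega>, \<omega>')) = W k \<omega>" by (rule W_cong) (simp add: merge_draws_def)
    moreover have "update k w (merge_draws ?J (\<omega>, \<omega>')) = update k w \<omega>'" for w
      by (rule update_cong) (simp add: merge_draws_def)
    ultimately show ?thesis by simp
  qed
  \<comment> \<open>Joint measurability in the past and the fresh draws is inherited from the merged
    draws, where the integrand is one already known to be measurable.\<close>
  have [measurable]: "(\<lambda>\<omega>. \<integral>\<^sup>+\<omega>'. ?f (W k \<omega>) \<omega>' \<partial>draws) \<in> borel_measurable draws"
  proof -
    have "(\<lambda>z. ?f (W k (merge_draws ?J z)) (merge_draws ?J z)) \<in> borel_measurable (draws \<Otimes>\<^sub>M draws)"
      by measurable
    from D.borel_measurable_nn_integral_fst[OF this] show ?thesis by (simp only: merge)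
  qed
  have "gap (Suc k) = (\<integral>\<^sup>+\<omega>. ?f (W k \<omega>) \<omega> \<partial>draws)" unfolding gap_def W_Suc ..
  also have "\<dots> = (\<integral>\<^sup>+\<omega>. \<integral>\<^sup>+\<omega>'. ?f (W k \<omega>) \<omega>' \<partial>draws \<partial>draws)"
    by (subst nn_integral_merge_draws[of _ ?J]) (measurable, simp only: merge)
  finally have "gap (Suc k) + decrease k
      = (\<integral>\<^sup>+\<omega>. (\<integral>\<^sup>+\<omega>'. ?f (W k \<omega>) \<omega>' \<partial>draws) + ?\<phi> (W k \<omega>) \<partial>draws)"
    unfolding decrease_def by (simp add: nn_integral_add)
  also have "\<dots> \<le> (\<integral>\<^sup>+\<omega>. ennreal (meta_loss P \<alpha> N (W k \<omega>) - I) + noise \<partial>draws)"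
  proof (rule nn_integral_mono)
    fix \<omega>
    show "(\<integral>\<^sup>+\<omega>'. ?f (W k \<omega>) \<omega>' \<partial>draws) + ?\<phi> (W k \<omega>) \<le> ennreal (meta_loss P \<alpha> N (W k \<omega>) - I) + noise"
      unfolding update_def noise_def
      by (rule step_descent[OF _ _ _ B_pos B'_pos B'_ge lower]) (simp_all add: inj_def)
  qed
  also have "\<dots> = gap k + noise"
    unfolding gap_def by (simp add: nn_integral_add D.emeasure_space_1)
  finally show ?thesis .
qed

lemma sum_decrease_le: "(\<Sum>k<K. decrease k) \<le> ennreal (meta_loss P \<alpha> N w0 - I) + of_nat K * noise"
proof -
  interpret D: prob_space "draws :: (draw \<Rightarrow> 'i) measure" by (rule prob_space_draws)
  have "gap K + (\<Sum>k<K. decrease k) \<le> gap 0 + of_nat K * noise"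
  proof (induction K)
    case (Suc K)
    have "gap (Suc K) + (\<Sum>k<Suc K. decrease k) = (gap (Suc K) + decrease K) + (\<Sum>k<K. decrease k)"
      by (simp add: ac_simps)
    also have "\<dots> \<le> (gap K + noise) + (\<Sum>k<K. decrease k)"
      using gap_Suc by (rule add_right_mono)
    also have "\<dots> = (gap K + (\<Sum>k<K. decrease k)) + noise" by (simp add: ac_simps)
    also have "\<dots> \<le> (gap 0 + of_nat K * noise) + noise" using Suc by (rule add_right_mono)
    finally show ?case by (simp add: algebra_simps)
  qed simp
  moreover have "gap 0 = ennreal (meta_loss P \<alpha> N w0 - I)"
    by (simp add: gap_def D.emeasure_space_1)
  moreover have "(\<Sum>k<K. decrease k) \<le> gap K + (\<Sum>k<K. decrease k)" by simp
  ultimately show ?thesis by (auto elim: order_trans[rotated])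
qed

lemma draw_space_eq: "draw_space P = draws"
  by (simp add: draw_space_def draws_def)

text \<open>Chaining \<open>mean_norm_le\<close> and \<open>norm_mean_grad_T_le\<close> costs 3/2,
  and \<open>C\<close> costs 2\<rho>/L, together 3\<rho>/L. This affine growth is the hypothesis of
  \<open>le_of_self_bounding\<close>.\<close>

lemma Lip_le: "Lip w \<le> (4 / 3 * L + 3 * \<rho> / L * (\<sigma> + b)) + 3 * \<rho> / L * norm (mean_G w)"
proof -
  have "b + mean_norm w \<le> 3 / 2 * (\<sigma> + b + norm (mean_G w))"
    using mean_norm_le[of w] norm_mean_grad_T_le[of w] by argo
  then have "C * (b + mean_norm w) \<le> 2 * \<rho> / L * (3 / 2 * (\<sigma> + b + norm (mean_G w)))"
    using C_le C_nonneg b_nonneg mean_norm_nonneg[of w] rho_nonneg L_pos by (intro mult_mono) auto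
  moreover have "amp * L \<le> 4 / 3 * L" using amp_le L_pos by (intro mult_right_mono) auto
  ultimately show ?thesis by (simp add: Lip_def algebra_simps add_divide_distrib)
qed

text \<open>The uniform index turns the telescoped sum divided by \<open>K\<close> into a mean over
  the run space, and 160 undoes the descent constant. \<open>\<Delta>\<close> serves twice: as a
  bound on this mean and as the level of the linearisation.\<close>

lemma expected_grad_norm:
  assumes K: "1 \<le> K" and "0 < \<Delta>"
    and \<Delta>: "160 * ((meta_loss P \<alpha> N w0 - I) / real K + 3 * (\<sigma>\<^sup>2 + Q) / (1600 * L * real B)) \<le> \<Delta>"
    and a: "4 / 3 * L + 3 * \<rho> / L * (\<sigma> + b) \<le> a"
  shows "expected_grad_norm_le P L \<rho> \<alpha> N K B B' w0 (3 * \<rho> / L * \<Delta> + sqrt a * sqrt \<Delta>)"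
proof -
  interpret D: prob_space "draws :: (draw \<Rightarrow> 'i) measure" by (rule prob_space_draws)
  define \<mu> where "\<mu> = pmf_of_set {..<K}"
  have K0: "{..<K} \<noteq> {}" using K by (auto simp: lessThan_empty_iff)
  interpret R: pair_prob_space "draws :: (draw \<Rightarrow> 'i) measure" "measure_pmf \<mu>" ..
  let ?R = "draws \<Otimes>\<^sub>M measure_pmf \<mu>"
  have run: "run_space P K = ?R" by (simp add: run_space_def draw_space_eq \<mu>_def)
  define X where "X z = norm (mean_G (W (snd z) (fst z)))" for z
  define \<phi> where "\<phi> z = (X z)\<^sup>2 / Lip (W (snd z) (fst z))" for z
  \<comment> \<open>The index ranges over a countable discrete space, so measurability of each
    single \<open>W k\<close> suffices.\<close>
  have meas_run: "(\<lambda>z. f (W (snd z) (fst z))) \<in> borel_measurable ?R"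
    if [measurable]: "f \<in> borel_measurable borel" for f :: "'a \<Rightarrow> real"
  proof -
    have "(\<lambda>z. f (W (snd z) (fst z))) \<in> borel_measurable (draws \<Otimes>\<^sub>M count_space UNIV)"
      by measurable
    also have "borel_measurable (draws \<Otimes>\<^sub>M count_space UNIV) = borel_measurable ?R"
      by (intro measurable_cong_sets sets_pair_measure_cong) auto
    finally show ?thesis .
  qed
  have [measurable]: "X \<in> borel_measurable ?R"
    unfolding X_def by (rule meas_run) measurable
  have [measurable]: "\<phi> \<in> borel_measurable ?R"
    unfolding \<phi>_def X_def by (rule meas_run) measurable
  have out: "output_grad_norm P L \<rho> \<alpha> N B B' w0 = X"
    by (auto simp: fun_eq_iff output_grad_norm_def X_def grad_meta_loss)
  have \<phi>_nonneg: "0 \<le> \<phi> z" for z using Lip_pos by (simp add: \<phi>_def less_imp_le)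
  have int_\<phi>: "(\<integral>\<^sup>+z. ennreal (\<phi> z) \<partial>?R) \<le> ennreal \<Delta>"
  proof -
    have "(\<integral>\<^sup>+z. ennreal (\<phi> z) \<partial>?R) = (\<integral>\<^sup>+k. \<integral>\<^sup>+\<omega>. ennreal (\<phi> (\<omega>, k)) \<partial>draws \<partial>measure_pmf \<mu>)"
      by (rule R.nn_integral_snd[symmetric]) measurable
    also have "\<dots> = (\<integral>\<^sup>+k. 160 * decrease k \<partial>measure_pmf \<mu>)"
    proof (rule nn_integral_cong)
      fix k
      have "ennreal (\<phi> (\<omega>, k)) = 160 * ennreal ((norm (mean_G (W k \<omega>)))\<^sup>2 / (160 * Lip (W k \<omega>)))" for \<omega>
        using Lip_pos[of "W k \<omega>"]
        by (subst ennreal_numeral[symmetric], subst ennreal_mult'[symmetric]) (auto simp: \<phi>_def X_def)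
      then show "(\<integral>\<^sup>+\<omega>. ennreal (\<phi> (\<omega>, k)) \<partial>draws) = 160 * decrease k"
        by (simp add: decrease_def nn_integral_cmult)
    qed
    also have "\<dots> = 160 * ((\<Sum>k<K. decrease k) / of_nat K)"
      using K0 by (simp add: nn_integral_cmult \<mu>_def nn_integral_pmf_of_set)
    also have "\<dots> \<le> 160 * ((ennreal (meta_loss P \<alpha> N w0 - I) + of_nat K * noise) / of_nat K)"
      by (intro mult_left_mono divide_right_mono_ennreal sum_decrease_le) simp
    also have "\<dots> = ennreal (160 * ((meta_loss P \<alpha> N w0 - I + real K * (3 * (\<sigma>\<^sup>2 + Q) / (1600 * L * real B))) / real K))"
    proof -
      have n: "0 \<le> 3 * (\<sigma>\<^sup>2 + Q) / (1600 * L * real B)" using Q_nonneg L_pos by simp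
      have m: "0 \<le> meta_loss P \<alpha> N w0 - I" using lower[of w0] by simp
      have nn: "0 \<le> meta_loss P \<alpha> N w0 - I + real K * (3 * (\<sigma>\<^sup>2 + Q) / (1600 * L * real B))"
        using m n by (intro add_nonneg_nonneg mult_nonneg_nonneg) auto
      show ?thesis
        unfolding noise_def ennreal_of_nat_eq_real_of_nat
        using K n m nn
        by (simp only: ennreal_mult[symmetric] ennreal_plus[symmetric] divide_ennreal of_nat_0_le_iff
            mult_nonneg_nonneg of_nat_0_less_iff)
          (subst ennreal_numeral[symmetric], subst ennreal_mult[symmetric], auto)
    qed
    also have "\<dots> \<le> ennreal \<Delta>"
      using \<Delta> K by (intro ennreal_leI) (simp add: add_divide_distrib)
    finally show ?thesis .
  qed
  have a0: "0 \<le> a"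
  proof -
    have "0 \<le> 3 * \<rho> / L * (\<sigma> + b)" using rho_nonneg L_pos sigma_nonneg b_nonneg by simp
    then show ?thesis using a L_pos by argo
  qed
  have c0: "0 \<le> 3 * \<rho> / L" using rho_nonneg L_pos by simp
  define p where "p = 3 * \<rho> / L + sqrt a / (2 * sqrt \<Delta>)"
  define t where "t = sqrt a * sqrt \<Delta> / 2"
  have p0: "0 \<le> p" and t0: "0 \<le> t" using c0 a0 \<open>0 < \<Delta>\<close> by (auto simp: p_def t_def)
  have "X z \<le> p * \<phi> z + t" for z
    unfolding p_def t_def \<phi>_def
  proof (rule le_of_self_bounding)
    show "Lip (W (snd z) (fst z)) \<le> a + 3 * \<rho> / L * X z"
      using Lip_le[of "W (snd z) (fst z)"] a unfolding X_def by argo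
  qed (use c0 a0 \<open>0 < \<Delta>\<close> Lip_pos in \<open>auto simp: X_def\<close>)
  then have "(\<integral>\<^sup>+z. ennreal (X z) \<partial>?R) \<le> (\<integral>\<^sup>+z. ennreal p * ennreal (\<phi> z) + ennreal t \<partial>?R)"
    using p0 t0 \<phi>_nonneg
    by (intro nn_integral_mono) (simp flip: ennreal_mult ennreal_plus add: ennreal_leI)
  also have "\<dots> = ennreal p * (\<integral>\<^sup>+z. ennreal (\<phi> z) \<partial>?R) + ennreal t"
    by (simp add: nn_integral_add nn_integral_cmult R.emeasure_space_1)
  also have "\<dots> \<le> ennreal p * ennreal \<Delta> + ennreal t"
    using int_\<phi> by (intro add_right_mono mult_left_mono) simp_all
  also have "\<dots> = ennreal (p * \<Delta> + t)"
    using p0 t0 \<open>0 < \<Delta>\<close> by (simp add: ennreal_mult)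
  \<comment> \<open>Slope and offset of the linearisation each contribute half of
    \<open>sqrt a * sqrt \<Delta>\<close>.\<close>
  also have "p * \<Delta> + t = 3 * \<rho> / L * \<Delta> + sqrt a * sqrt \<Delta>"
  proof -
    have "sqrt a / (2 * r) * (r * r) = sqrt a * r / 2" if "0 < r" for r
      using that by simp
    from this[of "sqrt \<Delta>"] have "sqrt a / (2 * sqrt \<Delta>) * \<Delta> = sqrt a * sqrt \<Delta> / 2"
      using \<open>0 < \<Delta>\<close> by simp
    then show ?thesis by (simp add: p_def t_def algebra_simps)
  qed
  finally have le: "(\<integral>\<^sup>+z. ennreal (X z) \<partial>?R) \<le> ennreal (3 * \<rho> / L * \<Delta> + sqrt a * sqrt \<Delta>)" .
  have X0: "0 \<le> X z" for z by (simp add: X_def)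
  have int_X: "integrable ?R X"
    using le X0 by (intro integrableI_nonneg) (auto intro: le_less_trans simp: ennreal_less_top)
  have "(\<integral>z. X z \<partial>?R) \<le> 3 * \<rho> / L * \<Delta> + sqrt a * sqrt \<Delta>"
  proof -
    have "ennreal (\<integral>z. X z \<partial>?R) \<le> ennreal (3 * \<rho> / L * \<Delta> + sqrt a * sqrt \<Delta>)"
      using le nn_integral_eq_integral[OF int_X] X0 by simp
    moreover have "0 \<le> 3 * \<rho> / L * \<Delta> + sqrt a * sqrt \<Delta>"
      using c0 a0 \<open>0 < \<Delta>\<close> by (intro add_nonneg_nonneg mult_nonneg_nonneg) auto
    ultimately show ?thesis by (simp only: ennreal_le_iff)
  qed
  then show ?thesis using int_X by (simp add: expected_grad_norm_le_def run out)
qed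

end

section \<open>Convergence rate and complexity\<close>

text \<open>Bounding \<open>C\<close> above and the base of the denominator below by
  \<open>L\<close> removes \<open>N\<close>, so the auxiliary batches do not affect the order of the
  cost.\<close>

lemma (in maml_family) aux_batch_bound_le:
  "aux_batch_bound P L \<rho> \<sigma> \<alpha> N \<le> 2 * (2 * \<rho> / L)\<^sup>2 * \<sigma>\<^sup>2 / L\<^sup>2"
  unfolding aux_batch_bound_def
proof (rule frac_le)
  show "2 * C\<^sup>2 * \<sigma>\<^sup>2 \<le> 2 * (2 * \<rho> / L)\<^sup>2 * \<sigma>\<^sup>2"
    using C_nonneg C_le by (intro mult_right_mono mult_left_mono power_mono) auto
  have "L \<le> amp * L" using amp_ge_1 L_pos by simp
  then have "L \<le> C * b + amp * L" using mult_nonneg_nonneg[OF C_nonneg b_nonneg] by simp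
  then show "L\<^sup>2 \<le> (C * b + (1 + \<alpha> * L) ^ (2 * N) * L)\<^sup>2"
    unfolding amp_def[symmetric] using L_pos by (intro power_mono) auto
qed (use L_pos in auto)

context
  fixes P :: "('i, 't, 'a::euclidean_space) task_family"
    and L \<rho> \<sigma> D s \<kappa> :: real and nS nT N :: nat and w0 :: 'a
  assumes inst: "maml_instance P L \<rho> \<sigma> nS nT N w0 D s \<kappa>"
begin

lemma maml_instance_family: "maml_family P L \<rho> \<sigma> nS nT N"
  using inst by (auto simp: maml_instance_def maml_family_def maml_family_axioms_def)

text \<open>Absolute values keep the constants nonnegative whatever the signs of \<open>D\<close>,
  \<open>s\<close> and \<open>\<kappa>\<close>, so they can be fixed before the instance. In
  \<open>c\<close>, the factor 3/10 is 160 * 3/1600, and the summand 1 keeps the level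
  \<open>c * \<delta>\<close> positive.\<close>

lemma maml_instance_rate:
  fixes K B :: nat and B' :: "nat \<Rightarrow> nat"
  defines "\<delta> \<equiv> 1 / real K + \<sigma>\<^sup>2 / real B"
    and "c \<equiv> 160 * \<bar>D\<bar> + 3 * (1 + \<bar>\<kappa>\<bar>) / (10 * L) + 1"
    and "a \<equiv> 4 / 3 * L + 3 * \<rho> / L * (\<bar>s\<bar> + sqrt \<bar>\<kappa>\<bar> * \<bar>s\<bar>)"
  assumes K: "1 \<le> K" and B: "1 \<le> B"
    and B': "\<And>k. 1 \<le> B' k \<and> aux_batch_bound P L \<rho> \<sigma> (inner_rate N L) N \<le> real (B' k)"
  shows "expected_grad_norm_le P L \<rho> (inner_rate N L) N K B B' w0
    ((3 * \<rho> / L * c + sqrt a * sqrt c) * (\<delta> + sqrt \<delta>))"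
proof -
  interpret maml_family P L \<rho> \<sigma> nS nT N by (rule maml_instance_family)
  define I where "I = (INF w. meta_loss P (inner_rate N L) N w)"
  have I: "I \<le> meta_loss P (inner_rate N L) N u" for u
    using inst unfolding I_def maml_instance_def by (intro cINF_lower) auto
  interpret maml_run P L \<rho> \<sigma> nS nT N B B' w0 I
    using B B' I by unfold_locales auto
  have D: "meta_loss P \<alpha> N w0 - I \<le> \<bar>D\<bar>" and s: "\<sigma> \<le> \<bar>s\<bar>" and Q: "Q \<le> \<kappa> * \<sigma>\<^sup>2"
    using inst unfolding maml_instance_def I_def by auto
  have \<kappa>: "\<kappa> * \<sigma>\<^sup>2 \<le> \<bar>\<kappa>\<bar> * \<sigma>\<^sup>2" by (intro mult_right_mono) auto
  have "b\<^sup>2 \<le> (sqrt \<bar>\<kappa>\<bar> * \<sigma>)\<^sup>2" using b_power2_le Q \<kappa> by (simp add: power_mult_distrib)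
  then have "b \<le> sqrt \<bar>\<kappa>\<bar> * \<sigma>" using sigma_nonneg by (auto elim: power2_le_imp_le)
  also have "\<dots> \<le> sqrt \<bar>\<kappa>\<bar> * \<bar>s\<bar>" using s by (intro mult_left_mono) auto
  finally have a: "4 / 3 * L + 3 * \<rho> / L * (\<sigma> + b) \<le> a"
    unfolding a_def using s rho_nonneg L_pos by (intro add_left_mono mult_left_mono add_mono) auto
  have a0: "0 \<le> a" unfolding a_def using rho_nonneg L_pos by simp
  have c: "1 \<le> c" unfolding c_def using L_pos by simp
  have \<delta>: "0 < \<delta>" unfolding \<delta>_def using K by (intro add_pos_nonneg) auto
  have "160 * ((meta_loss P \<alpha> N w0 - I) / real K + 3 * (\<sigma>\<^sup>2 + Q) / (1600 * L * real B))
      \<le> 160 * (\<bar>D\<bar> / real K + 3 * ((1 + \<bar>\<kappa>\<bar>) * \<sigma>\<^sup>2) / (1600 * L * real B))"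
    using D Q \<kappa> L_pos
    by (intro mult_left_mono add_mono divide_right_mono) (auto simp: distrib_right)
  also have "\<dots> = 160 * \<bar>D\<bar> * (1 / real K) + 3 * (1 + \<bar>\<kappa>\<bar>) / (10 * L) * (\<sigma>\<^sup>2 / real B)"
    using L_pos B by (simp add: field_simps)
  also have "\<dots> \<le> c * (1 / real K) + c * (\<sigma>\<^sup>2 / real B)"
    unfolding c_def using L_pos by (intro add_mono mult_right_mono) auto
  also have "\<dots> = c * \<delta>" by (simp add: \<delta>_def distrib_left)
  finally have "expected_grad_norm_le P L \<rho> \<alpha> N K B B' w0
      (3 * \<rho> / L * (c * \<delta>) + sqrt a * sqrt (c * \<delta>))"
    using expected_grad_norm[OF K _ _ a, of "c * \<delta>"] c \<delta> by simp
  moreover have "3 * \<rho> / L * (c * \<delta>) + sqrt a * sqrt (c * \<delta>)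
      \<le> (3 * \<rho> / L * c + sqrt a * sqrt c) * (\<delta> + sqrt \<delta>)"
  proof -
    have "0 \<le> 3 * \<rho> / L * c * sqrt \<delta>" "0 \<le> sqrt a * sqrt c * \<delta>"
      using rho_nonneg L_pos c a0 \<delta> by auto
    then show ?thesis by (simp add: real_sqrt_mult algebra_simps add_divide_distrib)
  qed
  ultimately show ?thesis unfolding expected_grad_norm_le_def by auto
qed

text \<open>Both batches have their prescribed size up to rounding, and
  \<open>\<epsilon> \<le> 1\<close> absorbs each rounding error into 1/\<epsilon>^2. The auxiliary
  size is bounded independently of \<epsilon>, so its gradients of order nT are covered as
  well.\<close>

lemma maml_instance_cost:
  fixes B :: nat and B' :: "nat \<Rightarrow> nat" and C\<^sub>B \<epsilon> :: real
  defines "c \<equiv> C\<^sub>B * s\<^sup>2 + 1" and "c' \<equiv> 2 * (2 * \<rho> / L)\<^sup>2 * s\<^sup>2 / L\<^sup>2 + 1"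
  assumes \<epsilon>: "0 < \<epsilon>" "\<epsilon> \<le> 1" and "0 \<le> C\<^sub>B"
    and B: "real B \<le> C\<^sub>B * \<sigma>\<^sup>2 / \<epsilon>\<^sup>2 + 1"
    and B': "\<And>k. real (B' k) \<le> aux_batch_bound P L \<rho> \<sigma> (inner_rate N L) N + 1"
    and \<omega>: "\<omega> \<in> space (draw_space P)"
  shows "real (grad_count P N B B' \<omega> k) \<le> (c + c') * (real nT + real N * real nS) / \<epsilon>\<^sup>2"
    and "real (hess_count P N B \<omega> k) \<le> c * (real N * real nS) / \<epsilon>\<^sup>2"
proof -
  interpret maml_family P L \<rho> \<sigma> nS nT N by (rule maml_instance_family)
  have draw: "\<omega> d \<in> space (task_dist P)" for d
    using \<omega> by (auto simp: draw_space_def space_PiM)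
  have card: "card (S_set P (\<omega> d)) = nS" "card (T_set P (\<omega> d)) = nT" for d
    using card_S[OF draw] card_T[OF draw] by auto
  have s: "\<sigma>\<^sup>2 \<le> s\<^sup>2"
    using inst sigma_nonneg unfolding maml_instance_def by (intro power_mono) auto
  have e: "1 \<le> 1 / \<epsilon>\<^sup>2" using \<epsilon> by (simp add: power_le_one)
  have "real B \<le> C\<^sub>B * s\<^sup>2 / \<epsilon>\<^sup>2 + 1 / \<epsilon>\<^sup>2"
    using B e s \<open>0 \<le> C\<^sub>B\<close> mult_left_mono[OF s, of C\<^sub>B]
    by (meson add_mono divide_right_mono order_trans zero_le_power2)
  then have B_le: "real B \<le> c / \<epsilon>\<^sup>2" by (simp add: c_def add_divide_distrib)
  have "real (B' k) \<le> c'"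
  proof -
    have "2 * (2 * \<rho> / L)\<^sup>2 * \<sigma>\<^sup>2 / L\<^sup>2 \<le> 2 * (2 * \<rho> / L)\<^sup>2 * s\<^sup>2 / L\<^sup>2"
      using s by (intro divide_right_mono mult_left_mono) auto
    then show ?thesis using B'[of k] aux_batch_bound_le by (simp add: c'_def)
  qed
  also have "c' \<le> c' * (1 / \<epsilon>\<^sup>2)"
    using mult_left_mono[OF e, of c'] by (simp add: c'_def)
  finally have B'_le: "real (B' k) \<le> c' / \<epsilon>\<^sup>2" by simp
  have "real (grad_count P N B B' \<omega> k) = real B * (real nT + real N * real nS) + real (B' k) * real nT"
    by (simp add: grad_count_def card algebra_simps)
  also have "\<dots> \<le> c / \<epsilon>\<^sup>2 * (real nT + real N * real nS) + c' / \<epsilon>\<^sup>2 * (real nT + real N * real nS)"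
    using B_le B'_le by (intro add_mono mult_mono) (auto intro: order_trans[OF of_nat_0_le_iff])
  also have "\<dots> = (c + c') * (real nT + real N * real nS) / \<epsilon>\<^sup>2"
    by (simp add: add_divide_distrib distrib_right)
  finally show "real (grad_count P N B B' \<omega> k) \<le> (c + c') * (real nT + real N * real nS) / \<epsilon>\<^sup>2" .
  have "real (hess_count P N B \<omega> k) = real B * (real N * real nS)"
    by (simp add: hess_count_def card)
  also have "\<dots> \<le> c / \<epsilon>\<^sup>2 * (real N * real nS)" using B_le by (intro mult_right_mono) auto
  finally show "real (hess_count P N B \<omega> k) \<le> c * (real N * real nS) / \<epsilon>\<^sup>2" by simp
qed

end

text \<open>As \<epsilon>\<eta> \<le> 1, both \<delta> and its root are at most \<epsilon>\<eta>,
  and the last bound on \<eta> is made for their sum.\<close>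

lemma rate_le_epsilon:
  fixes C \<epsilon> \<delta> \<eta> :: real
  assumes "0 < C" "0 < \<epsilon>" "\<epsilon> \<le> 1" "0 \<le> \<delta>" "\<delta> \<le> (\<epsilon> * \<eta>)\<^sup>2" "0 < \<eta>" "\<eta> \<le> 1" "\<eta> \<le> 1 / (2 * C)"
  shows "C * (\<delta> + sqrt \<delta>) \<le> \<epsilon>"
proof -
  have sqrt: "sqrt \<delta> \<le> \<epsilon> * \<eta>" using assms by (intro real_le_lsqrt) auto
  have "\<epsilon> * \<eta> \<le> 1" using assms by (simp add: mult_le_one)
  then have "(\<epsilon> * \<eta>)\<^sup>2 \<le> \<epsilon> * \<eta>"
    using assms by (simp add: power2_eq_square mult_left_le)
  then have "C * (\<delta> + sqrt \<delta>) \<le> C * (2 * (\<epsilon> * \<eta>))"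
    using sqrt assms by (intro mult_left_mono) auto
  also have "\<dots> = \<epsilon> * (\<eta> * (2 * C))" by simp
  also have "\<dots> \<le> \<epsilon> * 1"
    using assms by (intro mult_left_mono) (auto simp: le_divide_eq)
  finally show ?thesis by simp
qed

text \<open>The quantifier order carries the uniformity: all hidden constants precede
  \<open>N\<close>, the tasks, the sample sizes and the starting point. Lower bounds on the batches
  give convergence at every horizon from \<open>K\<close> on; the matching upper bounds, up to
  rounding, enter only the counts.\<close>

theorem corollary6:
  fixes L \<rho> D s \<kappa> :: real
  assumes "0 < L" and "0 \<le> \<rho>"
  shows
    "(\<exists>C>0. \<forall>(P :: ('i, 't, 'a::euclidean_space) task_family) \<sigma> nS nT N w0 K B B'.
        maml_instance P L \<rho> \<sigma> nS nT N w0 D s \<kappa> \<and> 1 \<le> K \<and> 1 \<le> B \<and>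
        (\<forall>k. 1 \<le> B' k \<and> aux_batch_bound P L \<rho> \<sigma> (inner_rate N L) N \<le> real (B' k)) \<longrightarrow>
        expected_grad_norm_le P L \<rho> (inner_rate N L) N K B B' w0
          (C * (1 / real K + \<sigma>\<^sup>2 / real B + sqrt (1 / real K + \<sigma>\<^sup>2 / real B)))) \<and>
     (\<exists>C0>0. \<forall>C\<^sub>B\<ge>C0. \<exists>C\<^sub>K>0. \<exists>C\<^sub>G>0. \<exists>C\<^sub>H>0.
        \<forall>(P :: ('i, 't, 'a) task_family) \<sigma> nS nT N w0 \<epsilon>.
        maml_instance P L \<rho> \<sigma> nS nT N w0 D s \<kappa> \<and> 0 < \<epsilon> \<and> \<epsilon> \<le> 1 \<longrightarrow>
        (\<exists>K\<ge>1. real K \<le> C\<^sub>K / \<epsilon>\<^sup>2 \<and>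
          (\<forall>B B'. 1 \<le> B \<and> C\<^sub>B * \<sigma>\<^sup>2 / \<epsilon>\<^sup>2 \<le> real B \<and>
            (\<forall>k. 1 \<le> B' k \<and> aux_batch_bound P L \<rho> \<sigma> (inner_rate N L) N \<le> real (B' k)) \<longrightarrow>
            (\<forall>K'\<ge>K. expected_grad_norm_le P L \<rho> (inner_rate N L) N K' B B' w0 \<epsilon>) \<and>
            (real B \<le> C\<^sub>B * \<sigma>\<^sup>2 / \<epsilon>\<^sup>2 + 1 \<and>
             (\<forall>k. real (B' k) \<le> aux_batch_bound P L \<rho> \<sigma> (inner_rate N L) N + 1) \<longrightarrow>
             (\<forall>\<omega>\<in>space (draw_space P). \<forall>k.
               real (grad_count P N B B' \<omega> k) \<le> C\<^sub>G * (real nT + real N * real nS) / \<epsilon>\<^sup>2 \<and>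
               real (hess_count P N B \<omega> k) \<le> C\<^sub>H * (real N * real nS) / \<epsilon>\<^sup>2)))))"
proof -
  define c a where "c = 160 * \<bar>D\<bar> + 3 * (1 + \<bar>\<kappa>\<bar>) / (10 * L) + 1"
    and "a = 4 / 3 * L + 3 * \<rho> / L * (\<bar>s\<bar> + sqrt \<bar>\<kappa>\<bar> * \<bar>s\<bar>)"
  define C where "C = 3 * \<rho> / L * c + sqrt a * sqrt c"
  have "0 < a" unfolding a_def using assms by (intro add_pos_nonneg) auto
  moreover have c: "0 < c" unfolding c_def using assms by (intro add_nonneg_pos) auto
  ultimately have C: "0 < C" unfolding C_def using assms by (intro add_nonneg_pos) auto
  define \<eta> where "\<eta> = min 1 (1 / (2 * C))"
  \<comment> \<open>With this value 1/K and \<sigma>^2/B are each at most half of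
    (\<epsilon>\<eta>)^2.\<close>
  define C0 where "C0 = 2 / \<eta>\<^sup>2"
  have \<eta>: "0 < \<eta>" "\<eta> \<le> 1" "\<eta> \<le> 1 / (2 * C)" using C by (auto simp: \<eta>_def)
  have C0: "0 < C0" using \<eta> by (simp add: C0_def)
  define c' where "c' = 2 * (2 * \<rho> / L)\<^sup>2 * s\<^sup>2 / L\<^sup>2 + 1"
  have c': "0 < c'" by (simp add: c'_def add_nonneg_pos)
  have rate: "expected_grad_norm_le P L \<rho> (inner_rate N L) N K B B' w0
      (C * (1 / real K + \<sigma>\<^sup>2 / real B + sqrt (1 / real K + \<sigma>\<^sup>2 / real B)))"
    if "maml_instance P L \<rho> \<sigma> nS nT N w0 D s \<kappa>" "1 \<le> K" "1 \<le> B"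
      "\<forall>k. 1 \<le> B' k \<and> aux_batch_bound P L \<rho> \<sigma> (inner_rate N L) N \<le> real (B' k)"
    for P :: "('i, 't, 'a) task_family" and \<sigma> nS nT N w0 K B B'
    unfolding C_def c_def a_def using that by (intro maml_instance_rate) auto
  have small: "expected_grad_norm_le P L \<rho> (inner_rate N L) N K' B B' w0 \<epsilon>"
    if inst: "maml_instance P L \<rho> \<sigma> nS nT N w0 D s \<kappa>" and \<epsilon>: "0 < \<epsilon>" "\<epsilon> \<le> 1"
      and C\<^sub>B: "C0 \<le> C\<^sub>B" and K': "C0 / \<epsilon>\<^sup>2 \<le> real K'" and B: "1 \<le> B" "C\<^sub>B * \<sigma>\<^sup>2 / \<epsilon>\<^sup>2 \<le> real B"
      and B': "\<forall>k. 1 \<le> B' k \<and> aux_batch_bound P L \<rho> \<sigma> (inner_rate N L) N \<le> real (B' k)"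
    for P :: "('i, 't, 'a) task_family" and \<sigma> nS nT N w0 K' B B' C\<^sub>B \<epsilon>
  proof -
    have half: "\<epsilon>\<^sup>2 / C0 = (\<epsilon> * \<eta>)\<^sup>2 / 2" using \<eta> by (simp add: C0_def power_mult_distrib)
    have K0: "0 < real K'" using less_le_trans[OF divide_pos_pos K'] C0 \<epsilon> by simp
    then have "1 / real K' \<le> \<epsilon>\<^sup>2 / C0" using K' C0 \<epsilon> by (simp add: field_simps)
    moreover have "\<sigma>\<^sup>2 / real B \<le> \<epsilon>\<^sup>2 / C0"
    proof -
      have "C0 * \<sigma>\<^sup>2 \<le> C\<^sub>B * \<sigma>\<^sup>2" using C\<^sub>B by (intro mult_right_mono) auto
      also have "\<dots> \<le> real B * \<epsilon>\<^sup>2" using B(2) \<epsilon> by (simp add: pos_divide_le_eq)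
      finally show ?thesis using B(1) C0 by (simp add: field_simps)
    qed
    ultimately have "1 / real K' + \<sigma>\<^sup>2 / real B \<le> (\<epsilon> * \<eta>)\<^sup>2" unfolding half by linarith
    then have le: "C * (1 / real K' + \<sigma>\<^sup>2 / real B + sqrt (1 / real K' + \<sigma>\<^sup>2 / real B)) \<le> \<epsilon>"
      using C \<epsilon> \<eta> by (intro rate_le_epsilon) auto
    have "1 \<le> K'" using K0 by simp
    from rate[OF inst this B(1) B'] le show ?thesis unfolding expected_grad_norm_le_def by auto
  qed
  show ?thesis
  proof (rule conjI, goal_cases)
    case 1
    show ?case using C rate by blast
  next
    case 2
    show ?case
    proof (rule exI[of _ C0], intro conjI C0 allI impI, goal_cases)
      case C\<^sub>B: (1 C\<^sub>B)
      define d where "d = C\<^sub>B * s\<^sup>2 + 1"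
      have CB0: "0 \<le> C\<^sub>B" using C\<^sub>B C0 by simp
      then have d: "0 < d" by (simp add: d_def add_nonneg_pos)
      have pos: "0 < C0 + 1" "0 < d + c'" using C0 d c' by simp_all
      show ?case
      proof (rule exI[of _ "C0 + 1"], rule conjI[OF pos(1)], rule exI[of _ "d + c'"],
          rule conjI[OF pos(2)], rule exI[of _ d], rule conjI[OF d], intro allI impI, elim conjE, goal_cases)
        case (1 P \<sigma> nS nT N w0 \<epsilon>)
        note inst = 1(1) and \<epsilon> = 1(2,3)
        \<comment> \<open>Rounding up costs at most 1, which \<open>\<epsilon> \<le> 1\<close>
          absorbs into the constant \<open>C0 + 1\<close>.\<close>
        define K where "K = nat \<lceil>C0 / \<epsilon>\<^sup>2\<rceil>"
        have pos: "0 < C0 / \<epsilon>\<^sup>2" using C0 \<epsilon> by simp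
        have K_ge: "C0 / \<epsilon>\<^sup>2 \<le> real K" unfolding K_def by (rule of_nat_ceiling)
        have K1: "1 \<le> K" using less_le_trans[OF pos K_ge] by simp
        have "real K \<le> C0 / \<epsilon>\<^sup>2 + 1"
          unfolding K_def using pos of_int_ceiling_le_add_one[of "C0 / \<epsilon>\<^sup>2"] by simp
        also have "\<dots> \<le> (C0 + 1) / \<epsilon>\<^sup>2"
          using \<epsilon> by (simp add: add_divide_distrib power_le_one)
        finally have K_le: "real K \<le> (C0 + 1) / \<epsilon>\<^sup>2" .
        show ?case
        proof (rule exI[of _ K], intro conjI allI impI ballI K1 K_le; elim conjE)
          fix B :: nat and B' :: "nat \<Rightarrow> nat" and K' :: nat
          assume "K \<le> K'" and B: "1 \<le> B" "C\<^sub>B * \<sigma>\<^sup>2 / \<epsilon>\<^sup>2 \<le> real B"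
            and B': "\<forall>k. 1 \<le> B' k \<and> aux_batch_bound P L \<rho> \<sigma> (inner_rate N L) N \<le> real (B' k)"
          then have K': "C0 / \<epsilon>\<^sup>2 \<le> real K'" using K_ge by simp
          show "expected_grad_norm_le P L \<rho> (inner_rate N L) N K' B B' w0 \<epsilon>"
            by (rule small[OF inst \<epsilon> C\<^sub>B K' B B'])
        next
          fix B :: nat and B' :: "nat \<Rightarrow> nat" and \<omega> k
          assume \<omega>: "\<omega> \<in> space (draw_space P)" and B: "real B \<le> C\<^sub>B * \<sigma>\<^sup>2 / \<epsilon>\<^sup>2 + 1"
            and B': "\<forall>k. real (B' k) \<le> aux_batch_bound P L \<rho> \<sigma> (inner_rate N L) N + 1"
          note cost = maml_instance_cost[OF inst \<epsilon> CB0 B B'[rule_format] \<omega>, folded d_def c'_def]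
          show "real (grad_count P N B B' \<omega> k) \<le> (d + c') * (real nT + real N * real nS) / \<epsilon>\<^sup>2"
            by (rule cost(1))
          show "real (hess_count P N B \<omega> k) \<le> d * (real N * real nS) / \<epsilon>\<^sup>2"
            by (rule cost(2))
        qed
      qed
    qed
  qed
qed

end
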